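(* Let $\mathcal{M}=(M,g)$ be a harmonic space, let $P\in M$ and $\xi\in T_PM$. Let $\mathcal{H}_k(\xi)=\mathcal{H}_k(P;\xi)$ be the degree-$k$ homogeneous term of the Taylor series at $\xi=0$ of the volume density $\tilde\Theta_{\mathcal{M}}(P;\xi)$, and let $\mathcal{J}_k(\xi)=\nabla_\xi^k\mathcal{J}(\xi)$, where $\mathcal{J}=\mathcal{J}_0$ is the Jacobi operator (all defined in the context). Then $\mathcal{H}_{2k+1}(\xi)=0$ for all $k\ge1$, and: (1) $\mathcal{H}_2(\xi)=-\frac16\operatorname{Tr}\{\mathcal{J}(\xi)\}$. (2) $\mathcal{H}_4(\xi)=\frac1{72}\operatorname{Tr}\{\mathcal{J}(\xi)\}^2-\frac1{180}\operatorname{Tr}\{\mathcal{J}(\xi)^2\}$. (3) $\mathcal{H}_6(\xi)=-\frac{\operatorname{Tr}\{\mathcal{J}(\xi)\}^3}{1296}+\frac{\operatorname{Tr}\{\mathcal{J}(\xi)\}\operatorname{Tr}\{\mathcal{J}(\xi)^2\}}{1080}-\frac{\operatorname{Tr}\{\mathcal{J}(\xi)^3\}}{2835}+\frac{\operatorname{Tr}\{\mathcal{J}_1(\xi)^2\}}{10080}$. (4) $\mathcal{H}_8(\xi)=\frac{\operatorname{Tr}\{\mathcal{J}(\xi)\}^4}{31104}-\frac{\operatorname{Tr}\{\mathcal{J}(\xi)\}^2\operatorname{Tr}\{\mathcal{J}(\xi)^2\}}{12960}+\frac{\operatorname{Tr}\{\mathcal{J}(\xi)\}\operatorname{Tr}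\{\mathcal{J}(\xi)^3\}}{17010}-\frac{\operatorname{Tr}\{\mathcal{J}(\xi)\}\operatorname{Tr}\{\mathcal{J}_1(\xi)^2\}}{60480}+\frac{\operatorname{Tr}\{\mathcal{J}(\xi)^2\}^2}{64800}-\frac{\operatorname{Tr}\{\mathcal{J}(\xi)^4\}}{37800}-\frac{\operatorname{Tr}\{\mathcal{J}(\xi)^2\mathcal{J}_2(\xi)\}}{340200}+\frac{\operatorname{Tr}\{\mathcal{J}(\xi)\mathcal{J}_1(\xi)^2\}}{54432}-\frac{\operatorname{Tr}\{\mathcal{J}_2(\xi)^2\}}{907200}$.
   Context: Let $\mathcal{M}=(M,g)$ be a (smooth) Riemannian manifold of dimension $m$ with Riemannian measure $\operatorname{dvol}_{\mathcal{M}}$ and Levi-Civita connection $\nabla$. Identify a neighborhood of $P\in M$ with a neighborhood of $0\in T_PM$ via $\exp_P$, and let $d\xi$ be the Lebesgue measure of the inner product space $T_PM$. The density $\tilde\Theta_{\mathcal{M}}(P;\xi)$ is defined for $\xi$ near $0$ by $\exp_P^*\{\operatorname{dvol}_{\mathcal{M}}\}(\xi)=\tilde\Theta_{\mathcal{M}}(P;\xi)\,d\xi$; equivalently $\tilde\Theta_{\mathcal{M}}(P;\xi)=\sqrt{\det(g_{ij}(\xi))}$ in geodesic normal coordinates at $P$ given by an orthonormal basis of $T_PM$. Its formal Taylor series at $\xi=0$ is $\tilde\Theta_{\mathcal{M}}(P;\xi)\sim 1+\sum_{k=2}^\infty\mathcal{H}_k(P;\xi)$ with $\mathcal{H}_k(P;c\xi)=c^k\mathcal{H}_k(P;\xi)$.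 $\mathcal{M}$ is a harmonic space if $\tilde\Theta_{\mathcal{M}}(P;\xi)$ depends only on $\|\xi\|$ (for all $P$ and all sufficiently small $\xi$). No completeness is assumed. Curvature conventions: $R(\xi,\eta)=\nabla_\xi\nabla_\eta-\nabla_\eta\nabla_\xi-\nabla_{[\xi,\eta]}$ and $R(\xi_1,\xi_2,\xi_3,\xi_4)=g(R(\xi_1,\xi_2)\xi_3,\xi_4)$. The Jacobi operator is $\mathcal{J}(\xi)\eta=R(\eta,\xi)\xi$. For $k\ge0$, $\mathcal{J}_k(\xi)$ is the endomorphism of $T_PM$ defined by $g(\mathcal{J}_k(\xi)\xi_1,\xi_2)=(\nabla^kR)(\xi_1,\xi,\xi,\xi_2;\xi,\dots,\xi)$, with $k$ copies of $\xi$ after the semicolon; $\mathcal{J}_0=\mathcal{J}$. *)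

theory Defs
  imports "HOL-Analysis.Analysis"
begin

section \<open>Directional derivatives, smoothness, Taylor terms\<close>

definition dir_deriv ::
  "('a::real_normed_vector \<Rightarrow> 'b::real_normed_vector) \<Rightarrow> 'a \<Rightarrow> 'a \<Rightarrow> 'b"
  where "dir_deriv f x v = vector_derivative (\<lambda>t. f (x + t *\<^sub>R v)) (at 0)"

primrec Ck_on ::
  "nat \<Rightarrow> 'a::real_normed_vector set \<Rightarrow> ('a \<Rightarrow> 'b::real_normed_vector) \<Rightarrow> bool"
  where
    "Ck_on 0 S f \<longleftrightarrow> continuous_on S f"
  | "Ck_on (Suc k) S f \<longleftrightarrow>
       f differentiable_on S \<and> (\<forall>v. Ck_on k S (\<lambda>x. dir_deriv f x v))"

text \<open>Meant for open sets only.\<close>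

definition smooth_on ::
  "'a::real_normed_vector set \<Rightarrow> ('a \<Rightarrow> 'b::real_normed_vector) \<Rightarrow> bool"
  where "smooth_on S f \<longleftrightarrow> (\<forall>k. Ck_on k S f)"

text \<open>The degree-\<open>k\<close> homogeneous term of the Taylor series of \<open>f\<close> at \<open>0\<close>:
  \<open>(1/k!) (\<xi> \<cdot> \<partial>)\<^sup>k f\<close> at \<open>0\<close>.\<close>

definition taylor_term :: "nat \<Rightarrow> ('a::real_normed_vector \<Rightarrow> real) \<Rightarrow> 'a \<Rightarrow> real"
  where "taylor_term k f \<xi> = ((\<lambda>h x. dir_deriv h x \<xi>) ^^ k) f 0 / fact k"

section \<open>Riemannian manifolds\<close>

text \<open>A chart is a pair of its domain and its coordinate map (whose values outside the domain
  are irrelevant). The metric is given by its matrix of components in every chart.\<close>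

type_synonym ('a, 'n) chart = "'a set \<times> ('a \<Rightarrow> real ^ 'n)"

record ('a, 'n) manifold =
  mtop :: "'a topology"
  atlas :: "('a, 'n::finite) chart set"
  gmat :: "('a, 'n) chart \<Rightarrow> real ^ 'n \<Rightarrow> real ^ 'n ^ 'n"

abbreviation cdom :: "('a, 'n::finite) chart \<Rightarrow> 'a set" where "cdom \<equiv> fst"
abbreviation cmap :: "('a, 'n::finite) chart \<Rightarrow> 'a \<Rightarrow> real ^ 'n" where "cmap \<equiv> snd"

definition transition ::
  "('a, 'n::finite) chart \<Rightarrow> ('a, 'n) chart \<Rightarrow> real ^ 'n \<Rightarrow> real ^ 'n"
  where "transition c d = cmap d \<circ> inv_into (cdom c) (cmap c)"

definition ginner :: "(real ^ 'n \<Rightarrow> real ^ 'n ^ 'n) \<Rightarrow> real ^ 'n \<Rightarrow> real ^ 'n \<Rightarrow> real ^ 'n \<Rightarrow> real"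
  where "ginner G x v w = v \<bullet> (G x *v w)"

definition smooth_manifold :: "('a, 'n::finite, 'z) manifold_scheme \<Rightarrow> bool"
  where "smooth_manifold M \<longleftrightarrow>
    Hausdorff_space (mtop M) \<and> second_countable (mtop M) \<and>
    (\<Union>c\<in>atlas M. cdom c) = topspace (mtop M) \<and>
    (\<forall>c\<in>atlas M.
       openin (mtop M) (cdom c) \<and> open (cmap c ` cdom c) \<and>
       homeomorphic_map (subtopology (mtop M) (cdom c)) (top_of_set (cmap c ` cdom c)) (cmap c)) \<and>
    (\<forall>c\<in>atlas M. \<forall>d\<in>atlas M.
       smooth_on (cmap c ` (cdom c \<inter> cdom d)) (transition c d))"

definition riemannian_manifold :: "('a, 'n::finite, 'z) manifold_scheme \<Rightarrow> bool"
  where "riemannian_manifold M \<longleftrightarrow>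
    smooth_manifold M \<and>
    (\<forall>c\<in>atlas M.
       smooth_on (cmap c ` cdom c) (gmat M c) \<and>
       (\<forall>x\<in>cmap c ` cdom c.
          (\<forall>v w. ginner (gmat M c) x v w = ginner (gmat M c) x w v) \<and>
          (\<forall>v. v \<noteq> 0 \<longrightarrow> ginner (gmat M c) x v v > 0))) \<and>
    (\<forall>c\<in>atlas M. \<forall>d\<in>atlas M. \<forall>p\<in>cdom c \<inter> cdom d. \<forall>v w.
       ginner (gmat M d) (cmap d p)
         (dir_deriv (transition c d) (cmap c p) v) (dir_deriv (transition c d) (cmap c p) w)
       = ginner (gmat M c) (cmap c p) v w)"

text \<open>The charts around \<open>P\<close>. Such a chart \<open>c\<close> identifies the tangent space at \<open>P\<close> with
  \<open>real ^ 'n\<close>; below, a tangent vector \<open>\<xi>\<close> at \<open>P\<close> is given by its components in \<open>c\<close>, and its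
  length is \<open>gnorm M c P \<xi>\<close>.\<close>

definition charts_at :: "('a, 'n::finite, 'z) manifold_scheme \<Rightarrow> 'a \<Rightarrow> ('a, 'n) chart set"
  where "charts_at M P = {c \<in> atlas M. P \<in> cdom c}"

definition gnorm ::
  "('a, 'n::finite, 'z) manifold_scheme \<Rightarrow> ('a, 'n) chart \<Rightarrow> 'a \<Rightarrow> real ^ 'n \<Rightarrow> real"
  where "gnorm M c P \<xi> = sqrt (ginner (gmat M c) (cmap c P) \<xi> \<xi>)"

section \<open>Levi-Civita connection and curvature in a chart\<close>

text \<open>\<open>christoffel G x v w\<close> has components
  \<open>\<Gamma>\<^sup>k\<^sub>i\<^sub>j v\<^sup>i w\<^sup>j\<close> with
  \<open>\<Gamma>\<^sup>k\<^sub>i\<^sub>j = (1/2) g\<^sup>k\<^sup>l (\<partial>\<^sub>i g\<^sub>j\<^sub>l + \<partial>\<^sub>j g\<^sub>i\<^sub>l - \<partial>\<^sub>l g\<^sub>i\<^sub>j)\<close>.\<close>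

definition christoffel ::
  "(real ^ 'n \<Rightarrow> real ^ 'n ^ 'n) \<Rightarrow> real ^ 'n \<Rightarrow> real ^ 'n \<Rightarrow> real ^ 'n \<Rightarrow> real ^ 'n::finite"
  where "christoffel G x v w =
    matrix_inv (G x) *v
      (\<chi> l. (dir_deriv (\<lambda>y. ginner G y w (axis l 1)) x v
            + dir_deriv (\<lambda>y. ginner G y v (axis l 1)) x w
            - dir_deriv (\<lambda>y. ginner G y v w) x (axis l 1)) / 2)"

definition nabla ::
  "(real ^ 'n \<Rightarrow> real ^ 'n ^ 'n) \<Rightarrow> (real ^ 'n \<Rightarrow> real ^ 'n) \<Rightarrow> (real ^ 'n \<Rightarrow> real ^ 'n) \<Rightarrow>
   real ^ 'n \<Rightarrow> real ^ 'n::finite"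
  where "nabla G X Y x = dir_deriv Y x (X x) + christoffel G x (X x) (Y x)"

definition lie_bracket ::
  "(real ^ 'n \<Rightarrow> real ^ 'n) \<Rightarrow> (real ^ 'n \<Rightarrow> real ^ 'n) \<Rightarrow> real ^ 'n \<Rightarrow> real ^ 'n::finite"
  where "lie_bracket X Y x = dir_deriv Y x (X x) - dir_deriv X x (Y x)"

definition curvature_op ::
  "(real ^ 'n \<Rightarrow> real ^ 'n ^ 'n) \<Rightarrow> (real ^ 'n \<Rightarrow> real ^ 'n) \<Rightarrow> (real ^ 'n \<Rightarrow> real ^ 'n) \<Rightarrow>
   (real ^ 'n \<Rightarrow> real ^ 'n) \<Rightarrow> real ^ 'n \<Rightarrow> real ^ 'n::finite"
  where "curvature_op G X Y Z x =
    nabla G X (nabla G Y Z) x - nabla G Y (nabla G X Z) x - nabla G (lie_bracket X Y) Z x"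

text \<open>A covariant tensor field of rank \<open>r\<close> in a chart is a function \<open>T\<close> for which \<open>T x vs\<close> is the
  value at the point \<open>x\<close> on the list \<open>vs\<close> of \<open>r\<close> vectors. Vectors are evaluated by extending them
  to vector fields with constant components.\<close>

definition riemann_tensor ::
  "(real ^ 'n \<Rightarrow> real ^ 'n ^ 'n) \<Rightarrow> real ^ 'n \<Rightarrow> (real ^ 'n::finite) list \<Rightarrow> real"
  where "riemann_tensor G x vs =
    ginner G x (curvature_op G (\<lambda>_. vs ! 0) (\<lambda>_. vs ! 1) (\<lambda>_. vs ! 2) x) (vs ! 3)"

text \<open>\<open>\<nabla>T (v\<^sub>1, \<dots>, v\<^sub>r; u) = (\<nabla>\<^sub>u T) (v\<^sub>1, \<dots>, v\<^sub>r)\<close>: the direction of differentiation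
  comes last. For constant \<open>v\<^sub>i\<close>, \<open>\<nabla>\<^sub>u v\<^sub>i\<close> is the Christoffel term.\<close>

definition cov_deriv ::
  "(real ^ 'n \<Rightarrow> real ^ 'n ^ 'n) \<Rightarrow> (real ^ 'n \<Rightarrow> (real ^ 'n) list \<Rightarrow> real) \<Rightarrow>
   real ^ 'n \<Rightarrow> (real ^ 'n::finite) list \<Rightarrow> real"
  where "cov_deriv G T x vs =
    (let ws = butlast vs; u = last vs in
       dir_deriv (\<lambda>y. T y ws) x u
       - (\<Sum>i<length ws. T x (ws[i := christoffel G x u (ws ! i)])))"

text \<open>The matrix, in the chart \<open>c\<close>, of the endomorphism \<open>\<J>\<^sub>k(\<xi>)\<close> of the tangent space at
  \<open>P\<close>; \<open>k = 0\<close> is the Jacobi operator.\<close>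

definition jacobi_op ::
  "('a, 'n::finite, 'z) manifold_scheme \<Rightarrow> ('a, 'n) chart \<Rightarrow> 'a \<Rightarrow> nat \<Rightarrow> real ^ 'n \<Rightarrow> real ^ 'n ^ 'n"
  where "jacobi_op M c P k \<xi> =
    (THE A. \<forall>v w. ginner (gmat M c) (cmap c P) (A *v v) w =
       (cov_deriv (gmat M c) ^^ k) (riemann_tensor (gmat M c)) (cmap c P)
         ([v, \<xi>, \<xi>, w] @ replicate k \<xi>))"

section \<open>Exponential map, volume density, harmonic spaces\<close>

definition geodesic_on ::
  "('a, 'n::finite, 'z) manifold_scheme \<Rightarrow> real set \<Rightarrow> (real \<Rightarrow> 'a) \<Rightarrow> bool"
  where "geodesic_on M I \<gamma> \<longleftrightarrow>
    open I \<and> is_interval I \<and> continuous_map (top_of_set I) (mtop M) \<gamma> \<and>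
    (\<forall>c\<in>atlas M. \<exists>v. \<forall>t\<in>I. \<gamma> t \<in> cdom c \<longrightarrow>
       ((cmap c \<circ> \<gamma>) has_vector_derivative v t) (at t) \<and>
       (v has_vector_derivative - christoffel (gmat M c) (cmap c (\<gamma> t)) (v t) (v t)) (at t))"

text \<open>No completeness is assumed: \<open>exp_map M c P \<xi>\<close> is meaningful only if the geodesic with initial
  velocity \<open>\<xi>\<close> exists up to time \<open>1\<close>, in particular for all small \<open>\<xi>\<close>.\<close>

definition exp_map ::
  "('a, 'n::finite, 'z) manifold_scheme \<Rightarrow> ('a, 'n) chart \<Rightarrow> 'a \<Rightarrow> real ^ 'n \<Rightarrow> 'a"
  where "exp_map M c P \<xi> =
    (THE q. \<exists>I \<gamma>. geodesic_on M I \<gamma> \<and> {0..1} \<subseteq> I \<and> \<gamma> 0 = P \<and>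
       ((cmap c \<circ> \<gamma>) has_vector_derivative \<xi>) (at 0) \<and> q = \<gamma> 1)"

text \<open>In a chart with coordinates \<open>x\<close>, the Riemannian measure is \<open>sqrt (det g) dx\<close>.\<close>

definition vol_density ::
  "('a, 'n::finite, 'z) manifold_scheme \<Rightarrow> ('a, 'n) chart \<Rightarrow> 'a \<Rightarrow> real"
  where "vol_density M c p = sqrt (det (gmat M c (cmap c p)))"

text \<open>The factor by which the pull-back of the Riemannian measure under the exponential map at
  \<open>P\<close> differs from the Lebesgue measure of the inner product space of tangent vectors at \<open>P\<close>. With
  tangent vectors given by components \<open>v\<close> in the chart \<open>c\<close>, the latter is
  \<open>vol_density M c P dv\<close>, whence the denominator. The point \<open>exp_map M c P \<xi>\<close> lies in the
  domain of \<open>c\<close> for small \<open>\<xi>\<close>; only those are relevant.\<close>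

definition volume_density ::
  "('a, 'n::finite, 'z) manifold_scheme \<Rightarrow> ('a, 'n) chart \<Rightarrow> 'a \<Rightarrow> real ^ 'n \<Rightarrow> real"
  where "volume_density M c P \<xi> =
    vol_density M c (exp_map M c P \<xi>)
      * \<bar>det (matrix (dir_deriv (cmap c \<circ> exp_map M c P) \<xi>))\<bar> / vol_density M c P"

definition harmonic_space :: "('a, 'n::finite, 'z) manifold_scheme \<Rightarrow> bool"
  where "harmonic_space M \<longleftrightarrow>
    riemannian_manifold M \<and>
    (\<forall>P\<in>topspace (mtop M). \<forall>c\<in>charts_at M P. \<exists>\<epsilon>>0. \<exists>f. \<forall>\<xi>.
       gnorm M c P \<xi> < \<epsilon> \<longrightarrow> volume_density M c P \<xi> = f (gnorm M c P \<xi>))"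

definition taylor_H ::
  "('a, 'n::finite, 'z) manifold_scheme \<Rightarrow> ('a, 'n) chart \<Rightarrow> 'a \<Rightarrow> nat \<Rightarrow> real ^ 'n \<Rightarrow> real"
  where "taylor_H M c P k \<xi> = taylor_term k (volume_density M c P) \<xi>"

end

theory Submission
  imports Defs
begin

text \<open>Along the geodesic \<open>x\<close> with initial velocity \<open>\<xi>\<close>, the differential of the exponential map at
  \<open>s \<xi>\<close> is \<open>A(s) / s\<close> in a parallel frame, where \<open>A'' + R A = 0\<close>, \<open>A(0) = 0\<close>, \<open>A'(0) = 1\<close> and \<open>R(s)\<close> is
  the matrix of the Jacobi operator of the velocity at time \<open>s\<close>, so that \<open>R\<^sup>(\<^sup>k\<^sup>)(0)\<close> represents
  \<open>\<J>\<^sub>k(\<xi>)\<close>. Hence the density is \<open>det (A(s) / s)\<close>, and the Riccati equation for its logarithmic derivative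
  yields all Taylor coefficients as polynomials in traces of words in the derivatives of \<open>R\<close>. In a harmonic
  space the density at every point of the geodesic is even, so the coefficients of degree 3, 5 and 7 vanish
  identically along it: \<open>Tr R' = 0\<close>, \<open>Tr (R R') = 0\<close>, and one relation of degree 7. Differentiating these
  relations along the geodesic eliminates all traces which do not occur in the theorem.\<close>

section \<open>Calculus of \<open>C\<^sup>k\<close> functions on open sets\<close>

lemma dir_deriv_at_line:
  assumes "((\<lambda>t. f (x + t *\<^sub>R v)) has_vector_derivative D) (at 0)"
  shows "dir_deriv f x v = D"
  unfolding dir_deriv_def by (rule vector_derivative_at[OF assms])

lemma has_vector_derivative_chain:
  assumes "(f has_derivative f') (at (c t))" "(c has_vector_derivative c') (at t)"
  shows "((\<lambda>t. f (c t)) has_vector_derivative f' c') (at t)"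
  using vector_derivative_diff_chain_within[of c c' t UNIV f f'] assms
  by (simp add: o_def has_derivative_at_withinI)

lemma has_vector_derivative_line: "((\<lambda>t. x + t *\<^sub>R v) has_vector_derivative v) (at t)"
  by (auto intro!: derivative_eq_intros)

lemma dir_deriv_at:
  assumes "(f has_derivative f') (at x)"
  shows "dir_deriv f x v = f' v"
proof (rule dir_deriv_at_line)
  show "((\<lambda>t. f (x + t *\<^sub>R v)) has_vector_derivative f' v) (at 0)"
    by (rule has_vector_derivative_chain[where c="\<lambda>t. x + t *\<^sub>R v", OF _ has_vector_derivative_line])
       (simp add: assms)
qed

lemma dir_deriv_cong:
  assumes "open S" "x \<in> S" "\<And>y. y \<in> S \<Longrightarrow> f y = g y"
  shows "dir_deriv f x v = dir_deriv g x v"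
proof -
  have "continuous (at 0) (\<lambda>t. x + t *\<^sub>R v)" by (intro continuous_intros)
  then have "\<forall>\<^sub>F t in nhds 0. x + t *\<^sub>R v \<in> S"
    using topological_tendstoD[OF _ assms(1), of "\<lambda>t. x + t *\<^sub>R v" x "nhds 0"] assms(2)
      tendsto_at_iff_tendsto_nhds[of "\<lambda>t. x + t *\<^sub>R v" 0]
    by (simp add: continuous_at)
  then have "\<forall>\<^sub>F t in nhds 0. f (x + t *\<^sub>R v) = g (x + t *\<^sub>R v)"
    by (rule eventually_mono) (rule assms(3))
  then show ?thesis unfolding dir_deriv_def
    by (intro vector_derivative_cong_eq) auto
qed

lemma dir_deriv_const [simp]: "dir_deriv (\<lambda>_. a) x v = 0"
  by (rule dir_deriv_at) (rule has_derivative_const)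

lemma dir_deriv_zero [simp]: "dir_deriv f x 0 = 0"
  unfolding dir_deriv_def by (simp add: vector_derivative_at)

lemma dir_deriv_bounded_linear:
  assumes "bounded_linear L" "(f has_derivative f') (at x)"
  shows "dir_deriv (\<lambda>y. L (f y)) x v = L (dir_deriv f x v)"
  using dir_deriv_at[OF bounded_linear.has_derivative[OF assms]] dir_deriv_at[OF assms(2)] by simp

lemma linear_Basis_expansion:
  fixes f :: "'a::euclidean_space \<Rightarrow> 'b::real_vector"
  assumes "linear f"
  shows "f v = (\<Sum>b\<in>Basis. (v \<bullet> b) *\<^sub>R f b)"
proof -
  have "f v = f (\<Sum>b\<in>Basis. (v \<bullet> b) *\<^sub>R b)" by (simp add: euclidean_representation)
  also have "\<dots> = (\<Sum>b\<in>Basis. (v \<bullet> b) *\<^sub>R f b)"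
    by (simp only: linear_sum[OF assms] linear_cmul[OF assms])
  finally show ?thesis .
qed

lemma has_derivative_dir_deriv:
  assumes "Ck_on (Suc k) S f" "open S" "x \<in> S"
  shows "(f has_derivative dir_deriv f x) (at x)"
proof -
  obtain f' where f': "(f has_derivative f') (at x)"
    using assms by (auto simp: differentiable_on_eq_differentiable_at differentiable_def)
  then have "dir_deriv f x = f'" by (intro ext dir_deriv_at)
  with f' show ?thesis by simp
qed

lemma Ck_on_cong:
  assumes "open S" "Ck_on k S f" "\<And>x. x \<in> S \<Longrightarrow> f x = g x"
  shows "Ck_on k S g"
  using assms(2,3)
proof (induction k arbitrary: f g)
  case 0
  then show ?case by (simp cong: continuous_on_cong)
next
  case (Suc k)
  have "g differentiable_on S"
    using Suc.prems has_derivative_transform_within_open[OF _ assms(1), where f=f and g=g]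
    by (fastforce simp: differentiable_on_eq_differentiable_at[OF assms(1)] differentiable_def)
  moreover have "Ck_on k S (\<lambda>x. dir_deriv g x v)" for v
    by (rule Suc.IH[of "\<lambda>x. dir_deriv f x v"])
       (use Suc.prems in \<open>auto intro: dir_deriv_cong[OF assms(1)]\<close>)
  ultimately show ?case by simp
qed

lemma Ck_on_SucI:
  assumes "open S" "\<And>x. x \<in> S \<Longrightarrow> (f has_derivative f' x) (at x)"
    and "\<And>v. Ck_on k S (\<lambda>x. f' x v)"
  shows "Ck_on (Suc k) S f"
proof -
  have "f differentiable_on S"
    using assms(1,2) by (auto simp: differentiable_on_eq_differentiable_at differentiable_def)
  moreover have "Ck_on k S (\<lambda>x. dir_deriv f x v)" for v
    by (rule Ck_on_cong[OF assms(1) assms(3)[of v]]) (simp add: dir_deriv_at[OF assms(2)])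
  ultimately show ?thesis by simp
qed

lemma Ck_on_SucD: "Ck_on (Suc k) S f \<Longrightarrow> Ck_on k S f"
proof (induction k arbitrary: f)
  case 0
  then show ?case by (auto intro: differentiable_imp_continuous_on)
qed auto

lemma Ck_on_subset:
  assumes "open S" "open T" "T \<subseteq> S" "Ck_on k S f"
  shows "Ck_on k T f"
  using assms(4)
proof (induction k arbitrary: f)
  case 0
  then show ?case using assms(3) by (auto intro: continuous_on_subset)
next
  case (Suc k)
  then show ?case using assms(3) by (auto intro: differentiable_on_subset)
qed

lemma Ck_on_const: "open S \<Longrightarrow> Ck_on k S (\<lambda>x. a)"
proof (induction k arbitrary: a)
  case (Suc k)
  then show ?case by (intro Ck_on_SucI[where f'="\<lambda>_ _. 0"]) auto
qed simp

lemma Ck_on_bounded_linear: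
  assumes "bounded_linear L" "open S" "Ck_on k S f"
  shows "Ck_on k S (\<lambda>x. L (f x))"
  using assms(3)
proof (induction k arbitrary: f)
  case 0
  then show ?case
    using bounded_linear.continuous_on[OF assms(1)] by auto
next
  case (Suc k)
  show ?case
    by (rule Ck_on_SucI[OF assms(2), where f'="\<lambda>x v. L (dir_deriv f x v)"])
       (use Suc in \<open>auto intro!: bounded_linear.has_derivative[OF assms(1)]
          has_derivative_dir_deriv[OF Suc.prems assms(2)]\<close>)
qed

lemma Ck_on_id: "open S \<Longrightarrow> Ck_on k S (\<lambda>x. x)"
proof (cases k)
  case (Suc j)
  assume "open S"
  then show ?thesis
    unfolding Suc by (intro Ck_on_SucI[where f'="\<lambda>_ v. v"] Ck_on_const has_derivative_ident)
qed simp

lemma Ck_on_add: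
  assumes "open S" "Ck_on k S f" "Ck_on k S g"
  shows "Ck_on k S (\<lambda>x. f x + g x)"
  using assms(2,3)
proof (induction k arbitrary: f g)
  case 0
  then show ?case by (auto intro: continuous_intros)
next
  case (Suc k)
  show ?case
    by (rule Ck_on_SucI[OF assms(1), where f'="\<lambda>x v. dir_deriv f x v + dir_deriv g x v"])
       (use Suc in \<open>auto intro!: derivative_intros has_derivative_dir_deriv[OF _ assms(1), of k]\<close>)
qed

lemma Ck_on_sum:
  assumes "open S" "\<And>i. i \<in> A \<Longrightarrow> Ck_on k S (f i)"
  shows "Ck_on k S (\<lambda>x. \<Sum>i\<in>A. f i x)"
  using assms(2)
  by (induction A rule: infinite_finite_induct) (auto intro: Ck_on_const Ck_on_add assms(1))

lemma Ck_on_bilinear: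
  assumes "bounded_bilinear p" "open S" "Ck_on k S f" "Ck_on k S g"
  shows "Ck_on k S (\<lambda>x. p (f x) (g x))"
  using assms(3,4)
proof (induction k arbitrary: f g)
  case 0
  then show ?case using bounded_bilinear.continuous_on[OF assms(1)] by auto
next
  case (Suc k)
  have "Ck_on k S (\<lambda>x. p (f x) (dir_deriv g x v) + p (dir_deriv f x v) (g x))" for v
    using Suc.prems Ck_on_SucD[OF Suc.prems(1)] Ck_on_SucD[OF Suc.prems(2)]
    by (intro Ck_on_add[OF assms(2)] Suc.IH) auto
  then show ?case
    by (intro Ck_on_SucI[OF assms(2), where f'="\<lambda>x v. p (f x) (dir_deriv g x v) + p (dir_deriv f x v) (g x)"]
          bounded_bilinear.FDERIV[OF assms(1)] has_derivative_dir_deriv[OF Suc.prems(1) assms(2)]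
          has_derivative_dir_deriv[OF Suc.prems(2) assms(2)])
qed

lemma Ck_on_compose:
  fixes f :: "'a::euclidean_space \<Rightarrow> 'b::real_normed_vector"
  assumes "open S" "open T" "g ` T \<subseteq> S" "Ck_on k S f" "Ck_on k T g"
  shows "Ck_on k T (\<lambda>x. f (g x))"
  using assms(4,5)
proof (induction k arbitrary: f)
  case 0
  then show ?case using assms(3) continuous_on_compose2[of S f T g] by auto
next
  case (Suc k)
  have deriv_f: "(f has_derivative dir_deriv f (g x)) (at (g x))" if "x \<in> T" for x
    using has_derivative_dir_deriv[OF Suc.prems(1) assms(1)] assms(3) that by blast
  show ?case
  proof (rule Ck_on_SucI[OF assms(2), where f'="\<lambda>x v. dir_deriv f (g x) (dir_deriv g x v)"])
    show "((\<lambda>x. f (g x)) has_derivative (\<lambda>v. dir_deriv f (g x) (dir_deriv g x v))) (at x)" if "x \<in> T" for x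
      using has_derivative_compose[OF has_derivative_dir_deriv[OF Suc.prems(2) assms(2) that] deriv_f[OF that]] .
    fix v
    have "Ck_on k T (\<lambda>x. \<Sum>b\<in>Basis. (dir_deriv g x v \<bullet> b) *\<^sub>R dir_deriv f (g x) b)"
      using Suc.prems Ck_on_SucD[OF Suc.prems(2)]
      by (intro Ck_on_sum[OF assms(2)] Ck_on_bilinear[OF bounded_bilinear_scaleR assms(2)]
          Ck_on_bounded_linear[OF bounded_linear_inner_left assms(2)] Suc.IH) auto
    then show "Ck_on k T (\<lambda>x. dir_deriv f (g x) (dir_deriv g x v))"
      by (rule Ck_on_cong[OF assms(2)])
         (rule linear_Basis_expansion[OF has_derivative_linear[OF deriv_f], symmetric])
  qed
qed

lemma Ck_on_inverse:
  fixes f :: "'a::real_normed_vector \<Rightarrow> real"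
  assumes "open S" "Ck_on k S f" "\<And>x. x \<in> S \<Longrightarrow> f x \<noteq> 0"
  shows "Ck_on k S (\<lambda>x. inverse (f x))"
  using assms(2)
proof (induction k)
  case 0
  then show ?case using assms(3) by (auto intro!: continuous_intros)
next
  case (Suc k)
  have "Ck_on k S (\<lambda>x. inverse (f x))" using Suc Ck_on_SucD by blast
  then have "Ck_on k S (\<lambda>x. - (inverse (f x) * dir_deriv f x v * inverse (f x)))" for v
    using Suc.prems
    by (intro Ck_on_bounded_linear[OF bounded_linear_minus[OF bounded_linear_ident] assms(1)]
        Ck_on_bilinear[OF bounded_bilinear_mult assms(1)]) auto
  then show ?case
    by (intro Ck_on_SucI[OF assms(1), where f'="\<lambda>x v. - (inverse (f x) * dir_deriv f x v * inverse (f x))"]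
       Deriv.has_derivative_inverse has_derivative_dir_deriv[OF Suc.prems assms(1)] assms(3)) auto
qed

lemma smooth_on_dir_deriv: "smooth_on S f \<Longrightarrow> smooth_on S (\<lambda>x. dir_deriv f x v)"
  unfolding smooth_on_def by (metis Ck_on.simps(2))

lemma smooth_on_has_derivative:
  "smooth_on S f \<Longrightarrow> open S \<Longrightarrow> x \<in> S \<Longrightarrow> (f has_derivative dir_deriv f x) (at x)"
  unfolding smooth_on_def using has_derivative_dir_deriv by blast

lemma smooth_on_linear_dir_deriv:
  "smooth_on S f \<Longrightarrow> open S \<Longrightarrow> x \<in> S \<Longrightarrow> linear (dir_deriv f x)"
  using smooth_on_has_derivative has_derivative_linear by blast

lemma smooth_on_imp_continuous_on: "smooth_on S f \<Longrightarrow> continuous_on S f"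
  unfolding smooth_on_def by (metis Ck_on.simps(1))

lemma smooth_on_cong: "smooth_on S f \<Longrightarrow> open S \<Longrightarrow> (\<And>x. x \<in> S \<Longrightarrow> f x = g x) \<Longrightarrow> smooth_on S g"
  unfolding smooth_on_def by (intro allI, rule Ck_on_cong[of S _ f]) auto

lemma smooth_on_subset: "smooth_on S f \<Longrightarrow> open S \<Longrightarrow> open T \<Longrightarrow> T \<subseteq> S \<Longrightarrow> smooth_on T f"
  unfolding smooth_on_def by (blast intro: Ck_on_subset)

lemma smooth_on_const: "open S \<Longrightarrow> smooth_on S (\<lambda>x. a)"
  unfolding smooth_on_def by (intro allI Ck_on_const)

lemma smooth_on_id: "open S \<Longrightarrow> smooth_on S (\<lambda>x. x)"
  unfolding smooth_on_def by (intro allI Ck_on_id)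

lemma smooth_on_bounded_linear:
  "bounded_linear L \<Longrightarrow> open S \<Longrightarrow> smooth_on S f \<Longrightarrow> smooth_on S (\<lambda>x. L (f x))"
  unfolding smooth_on_def by (intro allI, rule Ck_on_bounded_linear) auto

lemma smooth_on_add:
  "open S \<Longrightarrow> smooth_on S f \<Longrightarrow> smooth_on S g \<Longrightarrow> smooth_on S (\<lambda>x. f x + g x)"
  unfolding smooth_on_def by (intro allI Ck_on_add) auto

lemma smooth_on_minus: "open S \<Longrightarrow> smooth_on S f \<Longrightarrow> smooth_on S (\<lambda>x. - f x)"
  by (rule smooth_on_bounded_linear[OF bounded_linear_minus[OF bounded_linear_ident]])

lemma smooth_on_diff:
  "open S \<Longrightarrow> smooth_on S f \<Longrightarrow> smooth_on S g \<Longrightarrow> smooth_on S (\<lambda>x. f x - g x)"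
  using smooth_on_add[of S f "\<lambda>x. - g x"] smooth_on_minus[of S g] by simp

lemma smooth_on_sum:
  "open S \<Longrightarrow> (\<And>i. i \<in> A \<Longrightarrow> smooth_on S (f i)) \<Longrightarrow> smooth_on S (\<lambda>x. \<Sum>i\<in>A. f i x)"
  unfolding smooth_on_def by (intro allI Ck_on_sum) auto

lemma smooth_on_bilinear:
  "bounded_bilinear p \<Longrightarrow> open S \<Longrightarrow> smooth_on S f \<Longrightarrow> smooth_on S g \<Longrightarrow> smooth_on S (\<lambda>x. p (f x) (g x))"
  unfolding smooth_on_def by (intro allI, rule Ck_on_bilinear) auto

lemma smooth_on_compose:
  fixes f :: "'a::euclidean_space \<Rightarrow> 'b::real_normed_vector"
  shows "smooth_on S f \<Longrightarrow> smooth_on T g \<Longrightarrow> open S \<Longrightarrow> open T \<Longrightarrow> g ` T \<subseteq> S \<Longrightarrow> smooth_on T (\<lambda>x. f (g x))"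
  unfolding smooth_on_def by (intro allI, rule Ck_on_compose[of S T]) auto

lemma smooth_on_inverse:
  fixes f :: "'a::real_normed_vector \<Rightarrow> real"
  shows "open S \<Longrightarrow> smooth_on S f \<Longrightarrow> (\<And>x. x \<in> S \<Longrightarrow> f x \<noteq> 0) \<Longrightarrow> smooth_on S (\<lambda>x. inverse (f x))"
  unfolding smooth_on_def by (intro allI Ck_on_inverse) auto

lemma smooth_on_mult:
  fixes f g :: "'a::real_normed_vector \<Rightarrow> real"
  shows "open S \<Longrightarrow> smooth_on S f \<Longrightarrow> smooth_on S g \<Longrightarrow> smooth_on S (\<lambda>x. f x * g x)"
  by (rule smooth_on_bilinear[OF bounded_bilinear_mult])

lemma smooth_on_prod:
  fixes f :: "'i \<Rightarrow> 'a::real_normed_vector \<Rightarrow> real"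
  assumes "open S" "\<And>i. i \<in> A \<Longrightarrow> smooth_on S (f i)"
  shows "smooth_on S (\<lambda>x. \<Prod>i\<in>A. f i x)"
  using assms(2)
  by (induction A rule: infinite_finite_induct) (auto intro: smooth_on_const smooth_on_mult assms(1))

lemma smooth_on_euclidean_componentwise:
  fixes f :: "'a::real_normed_vector \<Rightarrow> 'b::euclidean_space"
  assumes "open S" "\<And>b. b \<in> Basis \<Longrightarrow> smooth_on S (\<lambda>x. f x \<bullet> b)"
  shows "smooth_on S f"
proof -
  have "smooth_on S (\<lambda>x. \<Sum>b\<in>Basis. (f x \<bullet> b) *\<^sub>R b)"
    by (intro smooth_on_sum smooth_on_bilinear[OF bounded_bilinear_scaleR] smooth_on_const assms)
  then show ?thesis by (simp add: euclidean_representation)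
qed

lemma smooth_on_vec:
  fixes f :: "'a::real_normed_vector \<Rightarrow> 'b::euclidean_space ^ 'n"
  assumes "open S" "\<And>i. smooth_on S (\<lambda>x. f x $ i)"
  shows "smooth_on S f"
proof (rule smooth_on_euclidean_componentwise[OF assms(1)])
  fix b :: "'b ^ 'n" assume "b \<in> Basis"
  then obtain i e where "b = axis i e" by (auto simp: Basis_vec_def)
  moreover have "smooth_on S (\<lambda>x. f x $ i \<bullet> e)"
    by (rule smooth_on_bounded_linear[OF bounded_linear_inner_left assms])
  ultimately show "smooth_on S (\<lambda>x. f x \<bullet> b)" by (simp add: inner_axis)
qed

lemma smooth_on_vec_nth:
  fixes f :: "'a::real_normed_vector \<Rightarrow> 'b::real_normed_vector ^ 'n"
  shows "open S \<Longrightarrow> smooth_on S f \<Longrightarrow> smooth_on S (\<lambda>x. f x $ i)"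
  by (rule smooth_on_bounded_linear[OF bounded_linear_vec_nth])

lemma smooth_on_Pair:
  fixes f :: "'a::real_normed_vector \<Rightarrow> 'b::euclidean_space" and g :: "'a \<Rightarrow> 'c::euclidean_space"
  assumes "open S" "smooth_on S f" "smooth_on S g"
  shows "smooth_on S (\<lambda>x. (f x, g x))"
proof -
  have "smooth_on S (\<lambda>x. (f x, 0) + (0, g x))"
    using assms by (intro smooth_on_add smooth_on_bounded_linear[where L="\<lambda>v. (v, 0)"]
        smooth_on_bounded_linear[where L="\<lambda>v. (0, v)"] bounded_linear_intros)
  then show ?thesis by simp
qed

text \<open>Symmetry of second derivatives: both orders of differentiation are the limit of the same second
  difference quotient.\<close>

abbreviation dir_deriv2 ::
  "('a::real_normed_vector \<Rightarrow> 'b::real_normed_vector) \<Rightarrow> 'a \<Rightarrow> 'a \<Rightarrow> 'a \<Rightarrow> 'b" where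
  "dir_deriv2 f x v w \<equiv> dir_deriv (\<lambda>y. dir_deriv f y v) x w"

lemma has_real_derivative_along_line:
  fixes f :: "'a::real_normed_vector \<Rightarrow> real"
  assumes "open S" "smooth_on S f" "x + r *\<^sub>R v \<in> S"
  shows "((\<lambda>r. f (x + r *\<^sub>R v)) has_real_derivative dir_deriv f (x + r *\<^sub>R v) v) (at r)"
  unfolding has_real_derivative_iff_has_vector_derivative
  by (rule has_vector_derivative_chain[OF smooth_on_has_derivative[OF assms(2,1,3)] has_vector_derivative_line])

lemma second_difference_mean_value:
  fixes f :: "'a::real_normed_vector \<Rightarrow> real"
  assumes S: "open S" and f: "smooth_on S f" and "s > 0"
    and sub: "\<And>p q. 0 \<le> p \<Longrightarrow> p \<le> s \<Longrightarrow> 0 \<le> q \<Longrightarrow> q \<le> s \<Longrightarrow> x + p *\<^sub>R v + q *\<^sub>R w \<in> S"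
  obtains p q where "0 \<le> p" "p \<le> s" "0 \<le> q" "q \<le> s"
    "f (x + s *\<^sub>R v + s *\<^sub>R w) - f (x + s *\<^sub>R v) - f (x + s *\<^sub>R w) + f x
      = s * s * dir_deriv2 f (x + p *\<^sub>R v + q *\<^sub>R w) v w"
proof -
  have deriv_v: "((\<lambda>r. f (x + r *\<^sub>R v + s *\<^sub>R w) - f (x + r *\<^sub>R v)) has_real_derivative
      dir_deriv f (x + r *\<^sub>R v + s *\<^sub>R w) v - dir_deriv f (x + r *\<^sub>R v) v) (at r)"
    if "0 \<le> r" "r \<le> s" for r
    using has_real_derivative_along_line[OF S f, of "x + s *\<^sub>R w" r v]
      has_real_derivative_along_line[OF S f, of x r v] sub[of r s] sub[of r 0] that \<open>s > 0\<close>
    by (intro DERIV_diff) (simp_all add: algebra_simps)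
  obtain p where p: "0 < p" "p < s"
    and diff_v: "(f (x + s *\<^sub>R v + s *\<^sub>R w) - f (x + s *\<^sub>R v)) - (f (x + 0 *\<^sub>R v + s *\<^sub>R w) - f (x + 0 *\<^sub>R v))
       = (s - 0) * (dir_deriv f (x + p *\<^sub>R v + s *\<^sub>R w) v - dir_deriv f (x + p *\<^sub>R v) v)"
    using MVT2[OF \<open>s > 0\<close> deriv_v] by blast
  have deriv_w: "((\<lambda>r. dir_deriv f (x + p *\<^sub>R v + r *\<^sub>R w) v) has_real_derivative
      dir_deriv2 f (x + p *\<^sub>R v + r *\<^sub>R w) v w) (at r)"
    if "0 \<le> r" "r \<le> s" for r
    using has_real_derivative_along_line[OF S smooth_on_dir_deriv[OF f], of "x + p *\<^sub>R v" r w v] sub[of p r] that p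
    by simp
  obtain q where q: "0 < q" "q < s"
    and diff_w: "dir_deriv f (x + p *\<^sub>R v + s *\<^sub>R w) v - dir_deriv f (x + p *\<^sub>R v + 0 *\<^sub>R w) v
       = (s - 0) * dir_deriv2 f (x + p *\<^sub>R v + q *\<^sub>R w) v w"
    using MVT2[OF \<open>s > 0\<close> deriv_w] by blast
  show thesis
    by (rule that[of p q]) (use p q diff_v diff_w in \<open>auto simp: algebra_simps\<close>)
qed

lemma small_combination_in_ball:
  fixes v w :: "'a::real_normed_vector"
  assumes "d > 0" "0 \<le> p" "p \<le> s" "0 \<le> q" "q \<le> s" "s * (norm v + norm w + 1) < d"
  shows "x + p *\<^sub>R v + q *\<^sub>R w \<in> ball x d"
proof -
  have "norm (p *\<^sub>R v + q *\<^sub>R w) \<le> p * norm v + q * norm w"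
    using norm_triangle_ineq[of "p *\<^sub>R v" "q *\<^sub>R w"] assms by simp
  also have "\<dots> \<le> s * norm v + s * norm w" using assms by (intro add_mono mult_right_mono) auto
  also have "\<dots> < d" using assms by (simp add: distrib_left)
  finally show ?thesis unfolding mem_ball dist_commute[of x] by (simp add: dist_norm add.assoc)
qed

lemma second_difference_quotient_tendsto:
  fixes f :: "'a::real_normed_vector \<Rightarrow> real"
  assumes S: "open S" and f: "smooth_on S f" and x: "x \<in> S"
  shows "((\<lambda>s. (f (x + s *\<^sub>R v + s *\<^sub>R w) - f (x + s *\<^sub>R v) - f (x + s *\<^sub>R w) + f x) / (s * s))
    \<longlongrightarrow> dir_deriv2 f x v w) (at_right 0)"
proof (rule tendstoI)
  fix e :: real assume "e > 0"
  have "isCont (\<lambda>y. dir_deriv2 f y v w) x"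
    using smooth_on_imp_continuous_on[OF smooth_on_dir_deriv[OF smooth_on_dir_deriv[OF f]]] S x
      continuous_on_eq_continuous_at by blast
  then obtain d1 where d1: "d1 > 0" "\<And>y. dist y x < d1 \<Longrightarrow> dist (dir_deriv2 f y v w) (dir_deriv2 f x v w) < e"
    using \<open>e > 0\<close> unfolding continuous_at_eps_delta by blast
  obtain d2 where d2: "d2 > 0" "ball x d2 \<subseteq> S" using S x openE by blast
  define d where "d = min d1 d2"
  have d: "d > 0" using d1(1) d2(1) by (simp add: d_def)
  have "\<forall>\<^sub>F s in at_right 0. s < d / (norm v + norm w + 1)"
    by (rule order_tendstoD(2)[OF tendsto_ident_at]) (use d in \<open>simp add: add_nonneg_pos\<close>)
  then show "\<forall>\<^sub>F s in at_right 0. dist ((f (x + s *\<^sub>R v + s *\<^sub>R w) - f (x + s *\<^sub>R v) - f (x + s *\<^sub>R w) + f x) / (s * s))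
      (dir_deriv2 f x v w) < e"
    using eventually_at_right_less[of 0]
  proof eventually_elim
    case (elim s)
    then have "s * (norm v + norm w + 1) < d" by (simp add: pos_less_divide_eq add_nonneg_pos)
    then have near: "x + p *\<^sub>R v + q *\<^sub>R w \<in> ball x d" if "0 \<le> p" "p \<le> s" "0 \<le> q" "q \<le> s" for p q
      using small_combination_in_ball[OF d] that by blast
    then have "x + p *\<^sub>R v + q *\<^sub>R w \<in> S" if "0 \<le> p" "p \<le> s" "0 \<le> q" "q \<le> s" for p q
      using d2(2) that by (auto simp: d_def)
    then obtain p q where pq: "0 \<le> p" "p \<le> s" "0 \<le> q" "q \<le> s"
      and "f (x + s *\<^sub>R v + s *\<^sub>R w) - f (x + s *\<^sub>R v) - f (x + s *\<^sub>R w) + f x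
        = s * s * dir_deriv2 f (x + p *\<^sub>R v + q *\<^sub>R w) v w"
      using second_difference_mean_value[OF S f elim(2)] by metis
    moreover have "dist (x + p *\<^sub>R v + q *\<^sub>R w) x < d1" using near[OF pq] by (simp add: d_def dist_commute)
    ultimately show ?case using elim(2) d1(2) by simp
  qed
qed

lemma dir_deriv_commute_real:
  fixes f :: "'a::real_normed_vector \<Rightarrow> real"
  assumes "open S" "smooth_on S f" "x \<in> S"
  shows "dir_deriv2 f x v w = dir_deriv2 f x w v"
proof (rule tendsto_unique[OF trivial_limit_at_right_real])
  show "((\<lambda>s. (f (x + s *\<^sub>R v + s *\<^sub>R w) - f (x + s *\<^sub>R v) - f (x + s *\<^sub>R w) + f x) / (s * s))
    \<longlongrightarrow> dir_deriv2 f x v w) (at_right 0)"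
    by (rule second_difference_quotient_tendsto[OF assms])
  have "x + s *\<^sub>R v + s *\<^sub>R w = x + s *\<^sub>R w + s *\<^sub>R v" for s by (simp add: add_ac)
  then show "((\<lambda>s. (f (x + s *\<^sub>R v + s *\<^sub>R w) - f (x + s *\<^sub>R v) - f (x + s *\<^sub>R w) + f x) / (s * s))
    \<longlongrightarrow> dir_deriv2 f x w v) (at_right 0)"
    using second_difference_quotient_tendsto[OF assms, of w v] by (simp add: algebra_simps)
qed

lemma dir_deriv_commute:
  fixes f :: "'a::real_normed_vector \<Rightarrow> 'b::euclidean_space"
  assumes S: "open S" and f: "smooth_on S f" and x: "x \<in> S"
  shows "dir_deriv2 f x v w = dir_deriv2 f x w v"
proof (rule euclidean_eqI)
  fix b :: 'b assume "b \<in> Basis"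
  have inner_b: "bounded_linear (\<lambda>z::'b. z \<bullet> b)" by (rule bounded_linear_inner_left)
  have component: "dir_deriv2 f x v w \<bullet> b = dir_deriv2 (\<lambda>z. f z \<bullet> b) x v w" for v w
  proof -
    have "dir_deriv2 f x v w \<bullet> b = dir_deriv (\<lambda>y. dir_deriv f y v \<bullet> b) x w"
      by (rule dir_deriv_bounded_linear[OF inner_b, symmetric])
         (rule smooth_on_has_derivative[OF smooth_on_dir_deriv[OF f] S x])
    also have "\<dots> = dir_deriv2 (\<lambda>z. f z \<bullet> b) x v w"
      by (intro dir_deriv_cong[OF S x] dir_deriv_bounded_linear[OF inner_b smooth_on_has_derivative[OF f S], symmetric])
    finally show ?thesis .
  qed
  show "dir_deriv2 f x v w \<bullet> b = dir_deriv2 f x w v \<bullet> b"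
    unfolding component by (rule dir_deriv_commute_real[OF S smooth_on_bounded_linear[OF inner_b S f] x])
qed

section \<open>Fields of linear maps\<close>

lemma smooth_on_linear_family:
  fixes L :: "'a::real_normed_vector \<Rightarrow> 'e::euclidean_space \<Rightarrow> 'b::real_normed_vector"
  assumes "open S" "\<And>x. x \<in> S \<Longrightarrow> linear (L x)" "\<And>v. smooth_on S (\<lambda>x. L x v)" "smooth_on S w"
  shows "smooth_on S (\<lambda>x. L x (w x))"
proof -
  have "smooth_on S (\<lambda>x. \<Sum>b\<in>Basis. (w x \<bullet> b) *\<^sub>R L x b)"
    by (intro smooth_on_sum smooth_on_bilinear[OF bounded_bilinear_scaleR]
        smooth_on_bounded_linear[OF bounded_linear_inner_left] assms)
  then show ?thesis
    by (rule smooth_on_cong[OF _ assms(1)]) (rule linear_Basis_expansion[OF assms(2), symmetric])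
qed

lemma smooth_on_bilinear_family:
  fixes B :: "'a::real_normed_vector \<Rightarrow> 'd::euclidean_space \<Rightarrow> 'e::euclidean_space \<Rightarrow> 'b::real_normed_vector"
  assumes "open S" "\<And>x b. x \<in> S \<Longrightarrow> linear (\<lambda>a. B x a b)" "\<And>x a. x \<in> S \<Longrightarrow> linear (B x a)"
    and "\<And>a b. smooth_on S (\<lambda>x. B x a b)" "smooth_on S v" "smooth_on S w"
  shows "smooth_on S (\<lambda>x. B x (v x) (w x))"
proof -
  have "smooth_on S (\<lambda>x. B x a (w x))" for a
    by (rule smooth_on_linear_family[of S "\<lambda>x. B x a", OF assms(1,3,4,6)])
  from smooth_on_linear_family[of S "\<lambda>x a. B x a (w x)", OF assms(1,2) this assms(5)] show ?thesis .
qed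

lemma linear_dir_deriv_family:
  fixes L :: "'a::real_normed_vector \<Rightarrow> 'e::real_vector \<Rightarrow> 'b::real_normed_vector"
  assumes S: "open S" "x \<in> S" and linear: "\<And>y. y \<in> S \<Longrightarrow> linear (L y)"
    and deriv: "\<And>v. ((\<lambda>y. L y v) has_derivative L' v) (at x)"
  shows "linear (\<lambda>v. dir_deriv (\<lambda>y. L y v) x u)"
proof (rule linearI)
  fix a b c
  have "dir_deriv (\<lambda>y. L y (a + b)) x u = dir_deriv (\<lambda>y. L y a + L y b) x u"
    by (rule dir_deriv_cong[OF S]) (rule linear_add[OF linear])
  then show "dir_deriv (\<lambda>y. L y (a + b)) x u = dir_deriv (\<lambda>y. L y a) x u + dir_deriv (\<lambda>y. L y b) x u"
    by (simp add: dir_deriv_at[OF has_derivative_add[OF deriv deriv]] dir_deriv_at[OF deriv])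
  have "dir_deriv (\<lambda>y. L y (c *\<^sub>R a)) x u = dir_deriv (\<lambda>y. c *\<^sub>R L y a) x u"
    by (rule dir_deriv_cong[OF S]) (rule linear_cmul[OF linear])
  then show "dir_deriv (\<lambda>y. L y (c *\<^sub>R a)) x u = c *\<^sub>R dir_deriv (\<lambda>y. L y a) x u"
    by (simp add: dir_deriv_at[OF has_derivative_scaleR_right[OF deriv]] dir_deriv_at[OF deriv])
qed

lemma has_vector_derivative_linear_family:
  fixes L :: "real \<Rightarrow> 'e::euclidean_space \<Rightarrow> 'b::real_normed_vector"
  assumes I: "open I" "t \<in> I" and linear: "\<And>s. s \<in> I \<Longrightarrow> linear (L s)"
    and L': "\<And>v. ((\<lambda>s. L s v) has_vector_derivative L' v) (at t)"
    and w: "(w has_vector_derivative w') (at t)"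
  shows "((\<lambda>s. L s (w s)) has_vector_derivative L' (w t) + L t w') (at t)"
proof -
  have "dir_deriv (\<lambda>s. L s v) t 1 = L' v" for v
    by (simp add: dir_deriv_at[OF L'[unfolded has_vector_derivative_def]])
  then have "linear L'"
    using linear_dir_deriv_family[of I t L _ 1, OF I linear L'[unfolded has_vector_derivative_def]] by simp
  have "((\<lambda>s. \<Sum>b\<in>Basis. (w s \<bullet> b) *\<^sub>R L s b) has_vector_derivative
      (\<Sum>b\<in>Basis. (w t \<bullet> b) *\<^sub>R L' b + (w' \<bullet> b) *\<^sub>R L t b)) (at t)"
    by (intro has_vector_derivative_sum bounded_bilinear.has_vector_derivative[OF bounded_bilinear_scaleR]
        bounded_linear.has_vector_derivative[OF bounded_linear_inner_left] w L')
  then have "((\<lambda>s. \<Sum>b\<in>Basis. (w s \<bullet> b) *\<^sub>R L s b) has_vector_derivative L' (w t) + L t w') (at t)"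
    by (simp only: sum.distrib linear_Basis_expansion[OF \<open>linear L'\<close>, symmetric]
        linear_Basis_expansion[OF linear[OF I(2)], symmetric])
  then show ?thesis
    by (rule has_vector_derivative_transform_within_open[OF _ I])
       (rule linear_Basis_expansion[OF linear, symmetric])
qed

section \<open>Smooth curves and iterated derivatives\<close>

lemma has_vector_derivative_shift_iff:
  "((\<lambda>s. h (t + s)) has_vector_derivative D) (at s) \<longleftrightarrow> (h has_vector_derivative D) (at (t + s))"
proof -
  have shift: "((\<lambda>s. f (r + s)) has_vector_derivative D) (at s)"
    if "(f has_vector_derivative D) (at (r + s))" for f :: "real \<Rightarrow> 'a" and r s
    using vector_diff_chain_at[of "\<lambda>s. r + s" 1 s f D] that
      has_vector_derivative_add[OF has_vector_derivative_const has_vector_derivative_id, of r "at s"]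
    by (simp add: o_def)
  from shift[of h t s] shift[of "\<lambda>s. h (t + s)" "-t" "t + s"] show ?thesis by auto
qed

lemma has_vector_derivative_scale:
  assumes "(h has_vector_derivative h') (at (s * t))"
  shows "((\<lambda>t. h (s * t)) has_vector_derivative s *\<^sub>R h') (at t)"
  using vector_diff_chain_at[of "\<lambda>t. s * t" s t h h'] assms
     has_vector_derivative_mult_right[OF has_vector_derivative_id, of s "at t"] by (simp add: o_def)

lemma has_vector_derivative_Pair_iff:
  "((\<lambda>t. (f t, g t)) has_vector_derivative (a, b)) (at t) \<longleftrightarrow>
    (f has_vector_derivative a) (at t) \<and> (g has_vector_derivative b) (at t)"
  using bounded_linear.has_vector_derivative[OF bounded_linear_fst, of "\<lambda>t. (f t, g t)" "(a, b)" "at t"]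
    bounded_linear.has_vector_derivative[OF bounded_linear_snd, of "\<lambda>t. (f t, g t)" "(a, b)" "at t"]
  by (auto intro: has_vector_derivative_Pair)

abbreviation vderiv :: "(real \<Rightarrow> 'b::real_normed_vector) \<Rightarrow> real \<Rightarrow> 'b" where
  "vderiv h \<equiv> (\<lambda>t. vector_derivative h (at t))"

lemma vderiv_shift: "vderiv (\<lambda>s. h (t + s)) s = vderiv h (t + s)"
  by (simp add: vector_derivative_def has_vector_derivative_shift_iff)

lemma vderiv_eq_dir_deriv: "vderiv h t = dir_deriv h t 1"
  using vderiv_shift[of h t 0] by (simp add: dir_deriv_def)

lemma smooth_on_vderiv: "smooth_on I h \<Longrightarrow> smooth_on I (vderiv h)"
  unfolding vderiv_eq_dir_deriv by (rule smooth_on_dir_deriv)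

lemma smooth_on_has_vector_derivative:
  assumes "smooth_on I h" "open I" "t \<in> I"
  shows "(h has_vector_derivative vderiv h t) (at t)"
  using smooth_on_has_derivative[OF assms]
  unfolding has_vector_derivative_def vderiv_eq_dir_deriv
  by (simp flip: linear_cmul[OF smooth_on_linear_dir_deriv[OF assms]])

lemma Ck_on_Suc_has_vector_derivativeI:
  assumes "open I" "\<And>t. t \<in> I \<Longrightarrow> (h has_vector_derivative h' t) (at t)" "Ck_on k I h'"
  shows "Ck_on (Suc k) I h"
  using assms unfolding has_vector_derivative_def
  by (intro Ck_on_SucI[where f'="\<lambda>t r. r *\<^sub>R h' t"] Ck_on_bounded_linear[OF bounded_linear_scaleR_right])

lemma smooth_on_bootstrap:
  assumes "open I" "\<And>t. t \<in> I \<Longrightarrow> (z has_vector_derivative z' t) (at t)"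
    and "\<And>k. Ck_on k I z \<Longrightarrow> Ck_on k I z'"
  shows "smooth_on I z"
  unfolding smooth_on_def
proof
  fix k show "Ck_on k I z"
  proof (induction k)
    case 0
    show ?case
      using assms(1,2) by (auto intro!: continuous_at_imp_continuous_on has_vector_derivative_continuous)
  next
    case (Suc k)
    show ?case by (rule Ck_on_Suc_has_vector_derivativeI[OF assms(1,2) assms(3)[OF Suc]])
  qed
qed

definition nderiv :: "nat \<Rightarrow> (real \<Rightarrow> 'b::real_normed_vector) \<Rightarrow> real \<Rightarrow> 'b" where
  "nderiv k h = (vderiv ^^ k) h"

lemma nderiv_0 [simp]: "nderiv 0 h = h"
  by (simp add: nderiv_def)

lemma nderiv_Suc: "nderiv (Suc k) h = vderiv (nderiv k h)"
  by (simp add: nderiv_def)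

lemma nderiv_Suc_vderiv: "nderiv (Suc k) h = nderiv k (vderiv h)"
  unfolding nderiv_def funpow_Suc_right by simp

lemma smooth_on_nderiv: "smooth_on I h \<Longrightarrow> smooth_on I (nderiv k h)"
  by (induction k) (auto simp: nderiv_Suc smooth_on_vderiv)

lemma has_vector_derivative_nderiv:
  "smooth_on I h \<Longrightarrow> open I \<Longrightarrow> t \<in> I \<Longrightarrow> (nderiv k h has_vector_derivative nderiv (Suc k) h t) (at t)"
  unfolding nderiv_Suc by (rule smooth_on_has_vector_derivative[OF smooth_on_nderiv])

lemma nderiv_const: "nderiv (Suc k) (\<lambda>t. a) = (\<lambda>t. 0)"
  by (induction k) (simp_all add: nderiv_Suc)

lemma nderiv_shift: "nderiv k (\<lambda>s. h (t + s)) s = nderiv k h (t + s)"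
proof (induction k arbitrary: s)
  case (Suc k)
  then have "nderiv k (\<lambda>s. h (t + s)) = (\<lambda>s. nderiv k h (t + s))" by blast
  then show ?case by (simp add: nderiv_Suc vderiv_shift)
qed simp

lemma nderiv_cong:
  assumes "open I" "\<And>t. t \<in> I \<Longrightarrow> f t = g t" "t \<in> I"
  shows "nderiv k f t = nderiv k g t"
  using assms(3)
proof (induction k arbitrary: t)
  case 0
  then show ?case using assms(2) by simp
next
  case (Suc k)
  have "\<forall>\<^sub>F s in nhds t. s \<in> I" using assms(1) Suc.prems by (rule eventually_nhds_in_open)
  then have "\<forall>\<^sub>F s in nhds t. nderiv k f s = nderiv k g s" by (rule eventually_mono) (rule Suc.IH)
  then show ?case unfolding nderiv_Suc by (intro vector_derivative_cong_eq) auto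
qed

lemma nderiv_SucI:
  assumes "open I" "t \<in> I" "\<And>s. s \<in> I \<Longrightarrow> nderiv k f s = g s" "(g has_vector_derivative D) (at t)"
  shows "nderiv (Suc k) f t = D"
  unfolding nderiv_Suc
  by (rule vector_derivative_at)
     (rule has_vector_derivative_transform_within_open[OF assms(4,1,2)], simp add: assms(3))

lemma nderiv_add:
  assumes "open I" "smooth_on I f" "smooth_on I g" "t \<in> I"
  shows "nderiv k (\<lambda>t. f t + g t) t = nderiv k f t + nderiv k g t"
  using assms(4)
proof (induction k arbitrary: t)
  case (Suc k)
  show ?case
    by (rule nderiv_SucI[OF assms(1) Suc.prems Suc.IH])
       (assumption, intro has_vector_derivative_add has_vector_derivative_nderiv[OF _ assms(1)] assms Suc.prems)
qed simp

lemma nderiv_bounded_linear: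
  assumes "open I" "bounded_linear L" "smooth_on I f" "t \<in> I"
  shows "nderiv k (\<lambda>t. L (f t)) t = L (nderiv k f t)"
  using assms(4)
proof (induction k arbitrary: t)
  case (Suc k)
  show ?case
    by (rule nderiv_SucI[OF assms(1) Suc.prems Suc.IH])
       (assumption, intro bounded_linear.has_vector_derivative[OF assms(2)]
          has_vector_derivative_nderiv[OF _ assms(1)] assms Suc.prems)
qed simp

lemma nderiv_uminus:
  assumes "open I" "smooth_on I f" "- t \<in> I"
  shows "nderiv k (\<lambda>t. f (- t)) t = (- 1) ^ k *\<^sub>R nderiv k f (- t)"
  using assms(3)
proof (induction k arbitrary: t)
  case (Suc k)
  have "open (uminus -` I)" by (intro open_vimage assms(1) continuous_intros)
  moreover have "((\<lambda>t. (- 1) ^ k *\<^sub>R nderiv k f (- t)) has_vector_derivative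
      (- 1) ^ k *\<^sub>R (- 1) *\<^sub>R nderiv (Suc k) f (- t)) (at t)"
    using has_vector_derivative_scale[of "nderiv k f" _ "-1" t]
      has_vector_derivative_nderiv[OF assms(2,1) Suc.prems, of k]
    by (intro bounded_linear.has_vector_derivative[OF bounded_linear_scaleR_right]) simp
  ultimately show ?case
    using nderiv_SucI[of "uminus -` I" t k "\<lambda>t. f (- t)", OF _ _ Suc.IH] Suc.prems by auto
qed simp

lemma nderiv_odd_even_function:
  fixes h :: "real \<Rightarrow> 'b::real_normed_vector"
  assumes "open I" "0 \<in> I" "smooth_on I h" "\<And>s. s \<in> I \<Longrightarrow> h (- s) = h s" "odd k"
  shows "nderiv k h 0 = 0"
proof -
  have "nderiv k h 0 = nderiv k (\<lambda>s. h (- s)) 0"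
    by (rule nderiv_cong[OF assms(1) _ assms(2)]) (simp add: assms(4))
  also have "\<dots> = - nderiv k h 0"
    using nderiv_uminus[OF assms(1,3), of 0 k] assms(2,5) by simp
  finally have "nderiv k h 0 + nderiv k h 0 = 0" by (simp only: eq_neg_iff_add_eq_0)
  then show ?thesis by (simp flip: scaleR_2)
qed

lemma nderiv_bilinear:
  assumes "bounded_bilinear p" "open I" "smooth_on I f" "smooth_on I g" "t \<in> I"
  shows "nderiv k (\<lambda>t. p (f t) (g t)) t
    = (\<Sum>i\<le>k. of_nat (k choose i) *\<^sub>R p (nderiv i f t) (nderiv (k - i) g t))"
  using assms(3-)
proof (induction k arbitrary: f g t)
  case (Suc k)
  let ?P = "\<lambda>i j. p (nderiv i f t) (nderiv j g t)"
  note f' = smooth_on_vderiv[OF Suc.prems(1)] and g' = smooth_on_vderiv[OF Suc.prems(2)]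
  have "nderiv (Suc k) (\<lambda>t. p (f t) (g t)) t = nderiv k (\<lambda>t. p (f t) (vderiv g t) + p (vderiv f t) (g t)) t"
    unfolding nderiv_Suc_vderiv
    by (rule nderiv_cong[OF assms(2) _ Suc.prems(3)])
       (intro vector_derivative_at bounded_bilinear.has_vector_derivative[OF assms(1)]
          smooth_on_has_vector_derivative[OF Suc.prems(1) assms(2)]
          smooth_on_has_vector_derivative[OF Suc.prems(2) assms(2)])
  also have "\<dots> = nderiv k (\<lambda>t. p (f t) (vderiv g t)) t + nderiv k (\<lambda>t. p (vderiv f t) (g t)) t"
    by (intro nderiv_add[OF assms(2)] smooth_on_bilinear[OF assms(1,2)] f' g' Suc.prems)
  also have "\<dots> = (\<Sum>i\<le>k. of_nat (k choose i) *\<^sub>R ?P i (Suc k - i)) + (\<Sum>i\<le>k. of_nat (k choose i) *\<^sub>R ?P (Suc i) (k - i))"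
    by (simp add: Suc.IH Suc.prems f' g' Suc_diff_le flip: nderiv_Suc_vderiv)
  also have "(\<Sum>i\<le>k. of_nat (k choose i) *\<^sub>R ?P i (Suc k - i)) = (\<Sum>i\<le>Suc k. of_nat (k choose i) *\<^sub>R ?P i (Suc k - i))"
    by simp
  also have "\<dots> = ?P 0 (Suc k) + (\<Sum>i\<le>k. of_nat (k choose Suc i) *\<^sub>R ?P (Suc i) (k - i))"
    by (subst sum.atMost_Suc_shift) simp
  finally show ?case
    unfolding sum.atMost_Suc_shift by (simp add: sum.distrib[symmetric] scaleR_add_left[symmetric] add.commute)
qed simp

lemma nderiv_scaleR_id:
  assumes "open I" "smooth_on I f" "s \<in> I"
  shows "nderiv (Suc k) (\<lambda>s. s *\<^sub>R f s) s = s *\<^sub>R nderiv (Suc k) f s + real (Suc k) *\<^sub>R nderiv k f s"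
  using assms(3)
proof (induction k arbitrary: s)
  case 0
  have "((\<lambda>s. s *\<^sub>R f s) has_vector_derivative s *\<^sub>R nderiv (Suc 0) f s + 1 *\<^sub>R f s) (at s)"
    using has_vector_derivative_nderiv[OF assms(2,1) 0, of 0]
    by (intro has_vector_derivative_scaleR DERIV_ident) simp
  from nderiv_SucI[OF assms(1) 0 _ this] show ?case by simp
next
  case (Suc k)
  have "((\<lambda>s. s *\<^sub>R nderiv (Suc k) f s + real (Suc k) *\<^sub>R nderiv k f s) has_vector_derivative
     (s *\<^sub>R nderiv (Suc (Suc k)) f s + 1 *\<^sub>R nderiv (Suc k) f s) + real (Suc k) *\<^sub>R nderiv (Suc k) f s) (at s)"
    by (intro has_vector_derivative_add has_vector_derivative_scaleR DERIV_ident
        bounded_linear.has_vector_derivative[OF bounded_linear_scaleR_right]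
        has_vector_derivative_nderiv[OF assms(2,1) Suc.prems])
  from nderiv_SucI[OF assms(1) Suc.prems Suc.IH this] show ?case by (simp add: algebra_simps scaleR_2)
qed

lemma dir_deriv_funpow_eq_nderiv:
  "((\<lambda>h x. dir_deriv h x \<xi>) ^^ k) f (t *\<^sub>R \<xi>) = nderiv k (\<lambda>t. f (t *\<^sub>R \<xi>)) t"
proof (induction k arbitrary: t)
  case (Suc k)
  have "((\<lambda>h x. dir_deriv h x \<xi>) ^^ Suc k) f (t *\<^sub>R \<xi>) = vderiv (\<lambda>s. nderiv k (\<lambda>t. f (t *\<^sub>R \<xi>)) (t + s)) 0"
    unfolding funpow.simps o_def by (subst dir_deriv_def) (simp only: scaleR_add_left[symmetric] Suc)
  then show ?case by (simp add: nderiv_Suc vderiv_shift)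
qed simp

lemma taylor_term_eq_nderiv: "taylor_term k f \<xi> = nderiv k (\<lambda>t. f (t *\<^sub>R \<xi>)) 0 / fact k"
  using dir_deriv_funpow_eq_nderiv[where t=0 and f=f and k=k and \<xi>=\<xi>] by (simp add: taylor_term_def)

lemma convex_scale_mem:
  fixes I :: "real set"
  assumes "convex I" "0 \<in> I" "t \<in> I" "s \<in> {0..1}"
  shows "s * t \<in> I"
  using convexD_alt[OF assms(1-3), of s] assms(4) by simp

lemma integral_moment_has_vector_derivative:
  fixes f :: "real \<Rightarrow> 'b::banach"
  assumes I: "open I" "convex I" "0 \<in> I" and t: "t \<in> I"
    and f: "\<And>t. t \<in> I \<Longrightarrow> (f has_vector_derivative f' t) (at t)" and f': "continuous_on I f'"
  shows "((\<lambda>t. integral {0..1} (\<lambda>s. s ^ k *\<^sub>R f (s * t))) has_vector_derivative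
    integral {0..1} (\<lambda>s. s ^ Suc k *\<^sub>R f' (s * t))) (at t)"
proof -
  have cont_f: "continuous_on I f"
    using f by (auto intro!: continuous_at_imp_continuous_on has_vector_derivative_continuous)
  note scaled = convex_scale_mem[OF I(2,3)]
  have "((\<lambda>t. integral (cbox 0 1) (\<lambda>s. s ^ k *\<^sub>R f (s * t))) has_vector_derivative
      integral (cbox 0 1) (\<lambda>s. s ^ Suc k *\<^sub>R f' (s * t))) (at t within I)"
  proof (rule leibniz_rule_vector_derivative[OF _ _ _ t I(2)])
    fix t s :: real assume "t \<in> I" "s \<in> cbox 0 1"
    then have "((\<lambda>t. f (s * t)) has_vector_derivative s *\<^sub>R f' (s * t)) (at t)"
      using scaled f by (intro has_vector_derivative_scale) auto
    from bounded_linear.has_vector_derivative[OF bounded_linear_scaleR_right[of "s ^ k"] this]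
    show "((\<lambda>t. s ^ k *\<^sub>R f (s * t)) has_vector_derivative s ^ Suc k *\<^sub>R f' (s * t)) (at t within I)"
      by (simp add: mult.commute has_vector_derivative_at_within)
  next
    fix t assume "t \<in> I"
    then show "(\<lambda>s. s ^ k *\<^sub>R f (s * t)) integrable_on cbox 0 1"
      using scaled by (intro integrable_continuous continuous_intros continuous_on_compose2[OF cont_f]) auto
  next
    show "continuous_on (I \<times> cbox 0 1) (\<lambda>(t, s). s ^ Suc k *\<^sub>R f' (s * t))"
      unfolding split_def using scaled
      by (intro continuous_intros continuous_on_compose2[OF f']) auto
  qed
  then show ?thesis unfolding has_vector_derivative_within_open[OF t I(1)] by simp
qed

lemma smooth_on_integral_moment:
  fixes f :: "real \<Rightarrow> 'b::banach"
  assumes I: "open I" "convex I" "0 \<in> I" and f: "smooth_on I f"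
  shows "smooth_on I (\<lambda>t. integral {0..1} (\<lambda>s. s ^ k *\<^sub>R f (s * t)))"
proof -
  have deriv: "((\<lambda>t. integral {0..1} (\<lambda>s. s ^ k *\<^sub>R f (s * t))) has_vector_derivative
      integral {0..1} (\<lambda>s. s ^ Suc k *\<^sub>R vderiv f (s * t))) (at t)"
    if "smooth_on I f" "t \<in> I" for k t and f :: "real \<Rightarrow> 'b"
    by (rule integral_moment_has_vector_derivative[OF I that(2) smooth_on_has_vector_derivative[OF that(1) I(1)]
          smooth_on_imp_continuous_on[OF smooth_on_vderiv[OF that(1)]]])
  have "Ck_on j I (\<lambda>t. integral {0..1} (\<lambda>s. s ^ k *\<^sub>R f (s * t)))" if "smooth_on I f"
    for j k and f :: "real \<Rightarrow> 'b"
    using that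
  proof (induction j arbitrary: k f)
    case 0
    then show ?case
      using deriv by (auto intro!: continuous_at_imp_continuous_on has_vector_derivative_continuous)
  next
    case (Suc j)
    show ?case
      by (rule Ck_on_Suc_has_vector_derivativeI[OF I(1) deriv[OF Suc.prems] Suc.IH[OF smooth_on_vderiv[OF Suc.prems]]])
  qed
  then show ?thesis using f by (simp add: smooth_on_def)
qed

lemma smooth_on_divide_by_time:
  fixes A :: "real \<Rightarrow> 'b::banach"
  assumes I: "open I" "convex I" "0 \<in> I" and A: "smooth_on I A" and A0: "A 0 = 0"
  obtains B where "smooth_on I B" "\<And>t. t \<in> I \<Longrightarrow> A t = t *\<^sub>R B t"
proof
  show "smooth_on I (\<lambda>t. integral {0..1} (\<lambda>s. s ^ 0 *\<^sub>R vderiv A (s * t)))"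
    by (rule smooth_on_integral_moment[OF I smooth_on_vderiv[OF A]])
  fix t assume t: "t \<in> I"
  have "((\<lambda>s. t *\<^sub>R vderiv A (s * t)) has_integral A (1 * t) - A (0 * t)) {0..1}"
  proof (rule fundamental_theorem_of_calculus)
    fix s :: real assume "s \<in> {0..1}"
    then have "(A has_vector_derivative vderiv A (t * s)) (at (t * s))"
      using smooth_on_has_vector_derivative[OF A I(1) convex_scale_mem[OF I(2,3) t]] by (simp add: mult.commute)
    from has_vector_derivative_scale[OF this]
    show "((\<lambda>s. A (s * t)) has_vector_derivative t *\<^sub>R vderiv A (s * t)) (at s within {0..1})"
      by (simp add: mult.commute has_vector_derivative_at_within)
  qed simp
  from integral_unique[OF this] show "A t = t *\<^sub>R integral {0..1} (\<lambda>s. s ^ 0 *\<^sub>R vderiv A (s * t))"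
    by (simp add: A0)
qed

section \<open>Ordinary differential equations on short time intervals\<close>

lemma vector_differentiable_bound:
  fixes h :: "real \<Rightarrow> 'b::real_normed_vector"
  assumes "convex S" "a \<in> S" "b \<in> S"
    and "\<And>s. s \<in> S \<Longrightarrow> (h has_vector_derivative h' s) (at s within S)"
    and "\<And>s. s \<in> S \<Longrightarrow> norm (h' s) \<le> B"
  shows "norm (h b - h a) \<le> B * \<bar>b - a\<bar>"
proof -
  have "norm (h b - h a) \<le> B * norm (b - a)"
  proof (rule differentiable_bound[OF assms(1) _ _ assms(3,2)])
    show "(h has_derivative (\<lambda>r. r *\<^sub>R h' s)) (at s within S)" if "s \<in> S" for s
      using assms(4)[OF that] by (simp add: has_vector_derivative_def)
    show "onorm (\<lambda>r. r *\<^sub>R h' s) \<le> B" if "s \<in> S" for s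
      using assms(5)[OF that] by (intro onorm_le) (simp add: mult.commute[of B] mult_left_mono)
  qed
  then show ?thesis by simp
qed

lemma picard_operator:
  fixes f :: "real \<Rightarrow> 'e::euclidean_space \<Rightarrow> 'e"
  assumes "0 < d" and cont: "continuous_on ({-d..d} \<times> UNIV) (\<lambda>(t, z). f t z)"
  obtains T :: "(real \<Rightarrow>\<^sub>C 'e) \<Rightarrow> real \<Rightarrow>\<^sub>C 'e" where "\<And>z. T z 0 = z0"
    "\<And>z t. t \<in> {-d..d} \<Longrightarrow> (T z has_vector_derivative f t (z t)) (at t within {-d..d})"
    "\<And>z t. T z t = T z (clamp (-d) d t)"
proof -
  have "\<exists>w :: real \<Rightarrow>\<^sub>C 'e. w 0 = z0 \<and>
      (\<forall>t\<in>{-d..d}. (w has_vector_derivative f t (z t)) (at t within {-d..d})) \<and> (\<forall>t. w t = w (clamp (-d) d t))"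
    for z :: "real \<Rightarrow>\<^sub>C 'e"
  proof -
    define F where "F t = z0 + integral {-d..t} (\<lambda>s. f s (z s)) - integral {-d..0} (\<lambda>s. f s (z s))" for t
    have "continuous_on {-d..d} (\<lambda>s. (s, z s))"
      by (intro continuous_intros continuous_on_subset[OF continuous_on_apply_bcontfun]) auto
    then have "continuous_on {-d..d} (\<lambda>s. f s (z s))"
      using continuous_on_compose2[OF cont] by fastforce
    then have F': "(F has_vector_derivative f t (z t)) (at t within {-d..d})" if "t \<in> {-d..d}" for t
      unfolding F_def using that integral_has_vector_derivative[of "-d" d]
      by (auto intro!: derivative_eq_intros)
    have "continuous_on (cbox (-d) d) F"
      unfolding cbox_interval by (rule continuous_on_vector_derivative[OF F'])
    then obtain w :: "real \<Rightarrow>\<^sub>C 'e" where w: "\<And>t. t \<in> cbox (-d) d \<Longrightarrow> w t = F t" "\<And>t. w t = F (clamp (-d) d t)"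
      by (rule continuous_on_cbox_bcontfunE) blast
    have "(w has_vector_derivative f t (z t)) (at t within {-d..d})" if "t \<in> {-d..d}" for t
      by (rule has_vector_derivative_transform[OF that _ F'[OF that]]) (simp add: w(1))
    moreover have "clamp (-d) d t \<in> cbox (-d) d" for t
      using \<open>0 < d\<close> by (intro clamp_in_interval) simp
    ultimately show ?thesis using w \<open>0 < d\<close> by (intro exI[of _ w]) (auto simp: F_def)
  qed
  then show thesis using that by metis
qed

lemma picard_existence:
  fixes f :: "real \<Rightarrow> 'e::euclidean_space \<Rightarrow> 'e"
  assumes d: "0 < d" and L: "0 \<le> L" "d * L < 1"
    and cont: "continuous_on ({-d..d} \<times> UNIV) (\<lambda>(t, z). f t z)"
    and lipschitz: "\<And>t z w. t \<in> {-d..d} \<Longrightarrow> norm (f t z - f t w) \<le> L * norm (z - w)"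
  shows "\<exists>z. z 0 = z0 \<and> (\<forall>t\<in>{-d<..<d}. (z has_vector_derivative f t (z t)) (at t))"
proof -
  obtain T :: "(real \<Rightarrow>\<^sub>C 'e) \<Rightarrow> real \<Rightarrow>\<^sub>C 'e" where T0: "\<And>z. T z 0 = z0"
    and T': "\<And>z t. t \<in> {-d..d} \<Longrightarrow> (T z has_vector_derivative f t (z t)) (at t within {-d..d})"
    and T_clamp: "\<And>z t. T z t = T z (clamp (-d) d t)"
    using picard_operator[OF d cont] by metis
  have "\<exists>!z. T z = z"
  proof (rule banach_fix_type[of "d * L"])
    show "\<forall>z w. dist (T z) (T w) \<le> d * L * dist z w"
    proof (intro allI dist_bound)
      fix z w :: "real \<Rightarrow>\<^sub>C 'e" and t
      define s where "s = clamp (-d) d t"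
      have "s \<in> cbox (-d) d" unfolding s_def using d by (intro clamp_in_interval) simp
      then have s: "s \<in> {-d..d}" by simp
      have "norm ((T z s - T w s) - (T z 0 - T w 0)) \<le> L * dist z w * \<bar>s - 0\<bar>"
      proof (rule vector_differentiable_bound[OF convex_real_interval(5) _ s, where h'="\<lambda>r. f r (z r) - f r (w r)"])
        fix r assume r: "r \<in> {-d..d}"
        show "((\<lambda>r. T z r - T w r) has_vector_derivative f r (z r) - f r (w r)) (at r within {-d..d})"
          by (intro has_vector_derivative_diff T' r)
        show "norm (f r (z r) - f r (w r)) \<le> L * dist z w"
          using lipschitz[OF r, of "z r" "w r"] mult_left_mono[OF dist_bounded[of z r w] L(1)]
          by (simp add: dist_norm)
      qed (use d in auto)
      also have "\<dots> \<le> L * dist z w * d"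
        using s L(1) by (intro mult_left_mono) auto
      finally show "dist (T z t) (T w t) \<le> d * L * dist z w"
        by (simp add: T0 dist_norm T_clamp[of _ t] s_def[symmetric] mult_ac)
    qed
  qed (use d L in auto)
  then obtain z where z: "T z = z" by auto
  have "(apply_bcontfun z has_vector_derivative f t (z t)) (at t)" if "t \<in> {-d<..<d}" for t
    using T'[of t z] that at_within_interior[of t "{-d..d}"] by (simp add: z interior_atLeastAtMost_real)
  then show ?thesis using T0[of z] by (intro exI[of _ "apply_bcontfun z"]) (simp add: z)
qed

text \<open>On a time interval this short, taking suprema replaces Gronwall's inequality.\<close>

lemma short_time_bound:
  fixes h :: "real \<Rightarrow> 'b::real_normed_vector"
  assumes h: "\<And>t. t \<in> {-d<..<d} \<Longrightarrow> (h has_vector_derivative h' t) (at t)" and h0: "h 0 = 0"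
    and h': "\<And>t. t \<in> {-d<..<d} \<Longrightarrow> norm (h' t) \<le> L * norm (h t) + e"
    and L: "0 \<le> L" "d * L \<le> 1/2" and e: "0 \<le> e" and t: "t \<in> {-d<..<d}"
  shows "norm (h t) \<le> 2 * d * e"
proof -
  define S where "S = {-\<bar>t\<bar>..\<bar>t\<bar>}"
  have S: "S \<subseteq> {-d<..<d}" "0 \<in> S" "t \<in> S" "S \<noteq> {}" "compact S" "convex S" using t by (auto simp: S_def)
  have h_S: "(h has_vector_derivative h' s) (at s within S)" if "s \<in> S" for s
    using has_vector_derivative_at_within[OF h] S(1) that by blast
  have "continuous_on S (\<lambda>s. norm (h s))"
    by (intro continuous_on_norm continuous_on_vector_derivative[OF h_S])
  from continuous_attains_sup[OF S(5,4) this]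
  obtain s where s: "s \<in> S" and max: "\<And>r. r \<in> S \<Longrightarrow> norm (h r) \<le> norm (h s)" by blast
  have h'_S: "norm (h' r) \<le> L * norm (h s) + e" if "r \<in> S" for r
    using h'[of r] mult_left_mono[OF max[OF that] L(1)] that S(1) by fastforce
  have "norm (h s - h 0) \<le> (L * norm (h s) + e) * \<bar>s - 0\<bar>"
    by (rule vector_differentiable_bound[OF S(6,2) s h_S h'_S])
  also have "\<dots> \<le> (L * norm (h s) + e) * d"
    using s S(1) L(1) e by (intro mult_left_mono) (auto simp: abs_le_iff)
  also have "\<dots> = (d * L) * norm (h s) + d * e" by (simp add: algebra_simps)
  also have "\<dots> \<le> 1/2 * norm (h s) + d * e"
    using L(2) by (intro add_right_mono mult_right_mono) auto
  finally have "norm (h s) \<le> 2 * d * e" by (simp add: h0)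
  with max[OF S(3)] show ?thesis by linarith
qed

lemma linear_ode_existence:
  fixes p :: "'a::real_normed_vector \<Rightarrow> 'e::euclidean_space \<Rightarrow> 'e"
  assumes p: "bounded_bilinear p" and N: "continuous_on {-d<..<d} N" and d: "d > 0"
  obtains d' Z where "d' > 0" "d' \<le> d" "\<And>z0. Z z0 0 = z0"
    "\<And>z0 t. t \<in> {-d'<..<d'} \<Longrightarrow> (Z z0 has_vector_derivative p (N t) (Z z0 t)) (at t)"
proof -
  have cont_N: "continuous_on {-(d/2)..d/2} N" by (rule continuous_on_subset[OF N]) (use d in auto)
  obtain B where B: "B \<ge> 0" "\<And>t. t \<in> {-(d/2)..d/2} \<Longrightarrow> norm (N t) \<le> B"
    by (rule continuous_on_compact_bound[OF compact_Icc cont_N]) blast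
  obtain K where K: "\<And>a b. norm (p a b) \<le> norm a * norm b * K" "K > 0"
    using bounded_bilinear.pos_bounded[OF p] by blast
  define L where "L = B * K"
  have L: "L \<ge> 0" using B K by (simp add: L_def)
  define d' where "d' = min (d/2) (1 / (2 * (L + 1)))"
  have d': "d' > 0" "d' \<le> d/2" using d L by (auto simp: d'_def)
  have "d' * L \<le> 1 / (2 * (L + 1)) * L" using L by (intro mult_right_mono) (auto simp: d'_def)
  also have "\<dots> < 1" using L by (simp add: field_simps)
  finally have short: "d' * L < 1" .
  have "continuous_on ({-d'..d'} \<times> UNIV) (\<lambda>x. N (fst x))"
    by (rule continuous_on_compose2[OF cont_N]) (use d' in \<open>auto intro!: continuous_intros\<close>)
  then have cont: "continuous_on ({-d'..d'} \<times> UNIV) (\<lambda>(t, z). p (N t) z)"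
    unfolding split_def by (intro bounded_bilinear.continuous_on[OF p] continuous_intros)
  have lipschitz: "norm (p (N t) z - p (N t) w) \<le> L * norm (z - w)" if "t \<in> {-d'..d'}" for t z w
  proof -
    have "norm (p (N t) z - p (N t) w) \<le> norm (N t) * norm (z - w) * K"
      unfolding bounded_bilinear.diff_right[OF p, symmetric] by (rule K)
    also have "\<dots> \<le> B * norm (z - w) * K"
      using B(2)[of t] that d' K by (intro mult_right_mono) auto
    finally show ?thesis by (simp add: L_def mult_ac)
  qed
  have "\<exists>Z. Z 0 = z0 \<and> (\<forall>t\<in>{-d'<..<d'}. (Z has_vector_derivative p (N t) (Z t)) (at t))" for z0
    by (rule picard_existence[OF d'(1) L short cont lipschitz])
  then obtain Z where "\<And>z0. Z z0 0 = z0"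
    "\<And>z0 t. t \<in> {-d'<..<d'} \<Longrightarrow> (Z z0 has_vector_derivative p (N t) (Z z0 t)) (at t)"
    by metis
  with d' d show thesis by (intro that[of d' Z]) auto
qed

definition integral_curve ::
  "('e::real_normed_vector \<Rightarrow> 'e) \<Rightarrow> 'e set \<Rightarrow> real set \<Rightarrow> (real \<Rightarrow> 'e) \<Rightarrow> bool" where
  "integral_curve f W I z \<longleftrightarrow> (\<forall>t\<in>I. z t \<in> W \<and> (z has_vector_derivative f (z t)) (at t))"

lemma integral_curveD:
  assumes "integral_curve f W I z" "t \<in> I"
  shows "z t \<in> W" "(z has_vector_derivative f (z t)) (at t)"
  using assms by (auto simp: integral_curve_def)

lemma integral_curve_mono: "integral_curve f W I z \<Longrightarrow> J \<subseteq> I \<Longrightarrow> W \<subseteq> V \<Longrightarrow> integral_curve f V J z"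
  by (auto simp: integral_curve_def)

lemma continuous_on_integral_curve:
  assumes "integral_curve f W I z"
  shows "continuous_on I z"
  by (rule continuous_on_vector_derivative[OF has_vector_derivative_at_within[OF integral_curveD(2)[OF assms]]])

lemma smooth_on_integral_curve:
  fixes f :: "'e::euclidean_space \<Rightarrow> 'e"
  assumes "open W" "smooth_on W f" "open I" and z: "integral_curve f W I z"
  shows "smooth_on I z"
proof (rule smooth_on_bootstrap[OF assms(3) integral_curveD(2)[OF z]])
  fix k assume "Ck_on k I z"
  then show "Ck_on k I (\<lambda>t. f (z t))"
    using assms(2) integral_curveD(1)[OF z]
    by (intro Ck_on_compose[OF assms(1,3), where f=f and g=z]) (auto simp: smooth_on_def)
qed

locale C1_vector_field =
  fixes f :: "'e::euclidean_space \<Rightarrow> 'e" and f' :: "'e \<Rightarrow> 'e \<Rightarrow>\<^sub>L 'e" and W :: "'e set"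
  assumes open_domain: "open W"
    and has_derivative: "x \<in> W \<Longrightarrow> (f has_derivative f' x) (at x)"
    and continuous_derivative: "continuous_on W f'"
begin

lemma continuous_on_field: "continuous_on W f"
  by (intro continuous_at_imp_continuous_on ballI has_derivative_continuous[OF has_derivative])

end

lemma smooth_on_C1_vector_field:
  fixes f :: "'e::euclidean_space \<Rightarrow> 'e"
  assumes "open W" "smooth_on W f"
  shows "C1_vector_field f (\<lambda>x. Blinfun (dir_deriv f x)) W"
proof
  have blinfun_apply: "blinfun_apply (Blinfun (dir_deriv f x)) = dir_deriv f x" if "x \<in> W" for x
    using has_derivative_bounded_linear[OF smooth_on_has_derivative[OF assms(2,1) that]]
    by (rule bounded_linear_Blinfun_apply)
  show "(f has_derivative blinfun_apply (Blinfun (dir_deriv f x))) (at x)" if "x \<in> W" for x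
    using smooth_on_has_derivative[OF assms(2,1) that] by (simp add: blinfun_apply[OF that])
  show "continuous_on W (\<lambda>x. Blinfun (dir_deriv f x))"
    using smooth_on_imp_continuous_on[OF smooth_on_dir_deriv[OF assms(2)]]
    by (intro continuous_on_blinfun_componentwise) (simp add: blinfun_apply cong: continuous_on_cong)
qed (rule assms(1))

locale C1_vector_field_short_time = C1_vector_field f f' W
  for f :: "'e::euclidean_space \<Rightarrow> 'e" and f' W +
  fixes K :: "'e set" and L d :: real
  assumes compact: "compact K" and convex: "convex K" and subset: "K \<subseteq> W"
    and L_nonneg: "0 \<le> L" and derivative_bound: "x \<in> K \<Longrightarrow> norm (f' x) \<le> L"
    and d_pos: "0 < d" and short_time: "d * L \<le> 1/2"
begin

lemma lipschitz: "x \<in> K \<Longrightarrow> y \<in> K \<Longrightarrow> norm (f x - f y) \<le> L * norm (x - y)"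
  using subset derivative_bound
  by (intro differentiable_bound[OF convex, where f'="\<lambda>x. blinfun_apply (f' x)"])
     (auto simp: norm_blinfun.rep_eq[symmetric] intro: has_derivative_at_withinI has_derivative)

lemma uniform_linearization:
  assumes "e > 0"
  obtains \<delta> where "\<delta> > 0"
    "\<And>x y. x \<in> K \<Longrightarrow> y \<in> K \<Longrightarrow> norm (y - x) < \<delta> \<Longrightarrow> norm (f y - f x - f' x (y - x)) \<le> e * norm (y - x)"
proof -
  have "uniformly_continuous_on K f'"
    using continuous_on_subset[OF continuous_derivative subset] compact by (rule compact_uniformly_continuous)
  then obtain \<delta> where \<delta>: "\<delta> > 0" "\<And>x y. x \<in> K \<Longrightarrow> y \<in> K \<Longrightarrow> dist y x < \<delta> \<Longrightarrow> dist (f' y) (f' x) < e"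
    using \<open>e > 0\<close> unfolding uniformly_continuous_on_def by blast
  have "norm (f y - f x - f' x (y - x)) \<le> e * norm (y - x)"
    if x: "x \<in> K" and y: "y \<in> K" and xy: "norm (y - x) < \<delta>" for x y
  proof -
    have segment: "closed_segment x y \<subseteq> K" using x y convex closed_segment_subset by blast
    have "norm (f y - f x - f' x (y - x)) \<le> norm (y - x) * e"
    proof (rule differentiable_bound_linearization[where S="closed_segment x y" and f'="\<lambda>x. blinfun_apply (f' x)"])
      show "x + t *\<^sub>R (y - x) \<in> closed_segment x y" if "t \<in> {0..1}" for t
        using that unfolding closed_segment_def by (auto simp: algebra_simps intro!: exI[of _ t])
      show "(f has_derivative f' z) (at z within closed_segment x y)" if "z \<in> closed_segment x y" for z
        using has_derivative segment subset that has_derivative_at_withinI by blast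
      show "onorm (blinfun_apply (f' z) - blinfun_apply (f' x)) \<le> e" if "z \<in> closed_segment x y" for z
      proof -
        have "dist z x < \<delta>" using segment_bound1[OF that] xy by (simp add: dist_norm)
        then have "norm (f' z - f' x) \<le> e" using \<delta>(2) segment that x by (force simp: dist_norm)
        then show ?thesis by (simp add: norm_blinfun.rep_eq minus_blinfun.rep_eq fun_diff_def)
      qed
    qed simp
    then show ?thesis by (simp add: mult.commute)
  qed
  with \<delta>(1) that show thesis by blast
qed

lemma integral_curve_exists:
  assumes "cball q r \<subseteq> K" "0 \<le> r" and B: "\<And>x. x \<in> K \<Longrightarrow> norm (f x) \<le> B" and "d * B \<le> r"
  shows "\<exists>z. z 0 = q \<and> integral_curve f K {-d<..<d} z"
proof -
  define g where "g x = f (closest_point K x)" for x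
  have K: "closed K" "K \<noteq> {}" using assms(1,2) compact by (auto intro: compact_imp_closed)
  have in_K: "closest_point K x \<in> K" for x by (rule closest_point_in_set[OF K])
  have "norm (g x - g y) \<le> L * norm (x - y)" for x y
  proof -
    have "norm (g x - g y) \<le> L * dist (closest_point K x) (closest_point K y)"
      unfolding g_def dist_norm by (rule lipschitz[OF in_K in_K])
    also have "\<dots> \<le> L * norm (x - y)"
      using closest_point_lipschitz[OF convex K, of x y] L_nonneg by (auto simp: dist_norm intro: mult_left_mono)
    finally show ?thesis .
  qed
  moreover have "continuous_on UNIV g"
    unfolding g_def
    by (rule continuous_on_compose2[OF continuous_on_field continuous_on_closest_point[OF convex K]])
       (use in_K subset in auto)
  then have "continuous_on ({-d..d} \<times> UNIV) (\<lambda>(t :: real, z). g z)"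
    unfolding split_def by (rule continuous_on_compose2) (auto intro!: continuous_intros)
  ultimately obtain z where z: "z 0 = q" "\<And>t. t \<in> {-d<..<d} \<Longrightarrow> (z has_vector_derivative g (z t)) (at t)"
    using picard_existence[OF d_pos L_nonneg, of "\<lambda>_. g" q] short_time by auto
  have "z t \<in> K" if t: "t \<in> {-d<..<d}" for t
  proof -
    have "norm (z t - z 0) \<le> B * \<bar>t - 0\<bar>"
      using z(2) B[OF in_K] t
      by (intro vector_differentiable_bound[of "{-d<..<d}"]) (auto simp: g_def intro: has_vector_derivative_at_within)
    also have "\<dots> \<le> B * d"
      using t order_trans[OF norm_ge_zero B[OF in_K]] by (intro mult_left_mono) auto
    finally show ?thesis using assms(1,4) z(1) by (auto simp: dist_norm norm_minus_commute mult.commute)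
  qed
  then have "integral_curve f K {-d<..<d} z"
    using z(2) closest_point_self unfolding integral_curve_def g_def by metis
  with z(1) show ?thesis by blast
qed

lemma integral_curve_distance:
  assumes z: "integral_curve f K {-d<..<d} z" and w: "integral_curve f K {-d<..<d} w" and t: "t \<in> {-d<..<d}"
  shows "norm (w t - z t) \<le> 2 * norm (w 0 - z 0)"
proof -
  let ?c = "w 0 - z 0"
  have "norm (w t - z t - ?c) \<le> 2 * d * (L * norm ?c)"
  proof (rule short_time_bound[where h'="\<lambda>s. f (w s) - f (z s)", OF _ _ _ L_nonneg short_time _ t])
    fix s assume s: "s \<in> {-d<..<d}"
    show "((\<lambda>s. w s - z s - ?c) has_vector_derivative f (w s) - f (z s)) (at s)"
      by (auto intro!: derivative_eq_intros integral_curveD(2)[OF z s] integral_curveD(2)[OF w s])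
    have "norm (f (w s) - f (z s)) \<le> L * norm (w s - z s)"
      by (rule lipschitz[OF integral_curveD(1)[OF w s] integral_curveD(1)[OF z s]])
    also have "\<dots> \<le> L * (norm (w s - z s - ?c) + norm ?c)"
      using norm_triangle_ineq[of "w s - z s - ?c" ?c] L_nonneg by (intro mult_left_mono) auto
    finally show "norm (f (w s) - f (z s)) \<le> L * norm (w s - z s - ?c) + L * norm ?c"
      by (simp add: distrib_left)
  qed (use L_nonneg in auto)
  also have "\<dots> = 2 * (d * L) * norm ?c" by simp
  also have "\<dots> \<le> 1 * norm ?c" using short_time by (intro mult_right_mono) auto
  finally show ?thesis using norm_triangle_ineq[of "w t - z t - ?c" ?c] by simp
qed

lemma variational_remainder:
  assumes z: "integral_curve f K {-d<..<d} z" and w: "integral_curve f K {-d<..<d} w"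
    and Z: "Z 0 = u" "\<And>t. t \<in> {-d<..<d} \<Longrightarrow> (Z has_vector_derivative f' (z t) (Z t)) (at t)"
    and start: "w 0 = z 0 + \<sigma> *\<^sub>R u" and small: "2 * (\<bar>\<sigma>\<bar> * norm u) < \<delta>"
    and linearization: "\<And>x y. x \<in> K \<Longrightarrow> y \<in> K \<Longrightarrow> norm (y - x) < \<delta> \<Longrightarrow>
      norm (f y - f x - f' x (y - x)) \<le> e * norm (y - x)"
    and e: "0 \<le> e" and t: "t \<in> {-d<..<d}"
  shows "norm (w t - z t - \<sigma> *\<^sub>R Z t) \<le> 4 * d * e * (\<bar>\<sigma>\<bar> * norm u)"
proof -
  have "norm (w t - z t - \<sigma> *\<^sub>R Z t) \<le> 2 * d * (e * (2 * (\<bar>\<sigma>\<bar> * norm u)))"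
  proof (rule short_time_bound[where h'="\<lambda>s. f (w s) - f (z s) - \<sigma> *\<^sub>R f' (z s) (Z s)",
        OF _ _ _ L_nonneg short_time _ t])
    fix s assume s: "s \<in> {-d<..<d}"
    note z_K = integral_curveD(1)[OF z s] and w_K = integral_curveD(1)[OF w s]
    show "((\<lambda>s. w s - z s - \<sigma> *\<^sub>R Z s) has_vector_derivative f (w s) - f (z s) - \<sigma> *\<^sub>R f' (z s) (Z s)) (at s)"
      by (intro has_vector_derivative_diff integral_curveD(2)[OF z s] integral_curveD(2)[OF w s]
          bounded_linear.has_vector_derivative[OF bounded_linear_scaleR_right] Z(2)[OF s])
    have close: "norm (w s - z s) \<le> 2 * (\<bar>\<sigma>\<bar> * norm u)"
      using integral_curve_distance[OF z w s] by (simp add: start)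
    have "f (w s) - f (z s) - \<sigma> *\<^sub>R f' (z s) (Z s) =
        (f (w s) - f (z s) - f' (z s) (w s - z s)) + f' (z s) (w s - z s - \<sigma> *\<^sub>R Z s)"
      by (simp add: blinfun.diff_right blinfun.scaleR_right)
    also have "norm \<dots> \<le> e * norm (w s - z s) + norm (f' (z s)) * norm (w s - z s - \<sigma> *\<^sub>R Z s)"
      using close small by (intro norm_triangle_mono linearization norm_blinfun z_K w_K) simp
    also have "\<dots> \<le> e * (2 * (\<bar>\<sigma>\<bar> * norm u)) + L * norm (w s - z s - \<sigma> *\<^sub>R Z s)"
      using close e derivative_bound[OF z_K] by (intro add_mono mult_left_mono mult_right_mono) auto
    finally show "norm (f (w s) - f (z s) - \<sigma> *\<^sub>R f' (z s) (Z s))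
        \<le> L * norm (w s - z s - \<sigma> *\<^sub>R Z s) + e * (2 * (\<bar>\<sigma>\<bar> * norm u))"
      by simp
  qed (use e in \<open>auto simp: start Z(1)\<close>)
  then show ?thesis by simp
qed

lemma integral_curve_has_derivative_initial_value:
  assumes \<eta>: "\<eta> > 0" and w: "\<And>\<sigma>. \<bar>\<sigma>\<bar> < \<eta> \<Longrightarrow> integral_curve f K {-d<..<d} (w \<sigma>)"
    and start: "\<And>\<sigma>. \<bar>\<sigma>\<bar> < \<eta> \<Longrightarrow> w \<sigma> 0 = p + \<sigma> *\<^sub>R u"
    and Z: "Z 0 = u" "\<And>t. t \<in> {-d<..<d} \<Longrightarrow> (Z has_vector_derivative f' (w 0 t) (Z t)) (at t)"
    and t: "t \<in> {-d<..<d}"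
  shows "((\<lambda>\<sigma>. w \<sigma> t) has_vector_derivative Z t) (at 0)"
  unfolding has_vector_derivative_def has_derivative_at_alt
proof (intro conjI allI impI bounded_linear_scaleR_left)
  fix e :: real assume "e > 0"
  define n where "n = norm u + 1"
  have n: "n > 0" "norm u \<le> n" by (auto simp: n_def add_nonneg_pos)
  have "e / (4 * d * n) > 0" using \<open>e > 0\<close> d_pos n by simp
  then obtain \<delta> where \<delta>: "\<delta> > 0" "\<And>x y. x \<in> K \<Longrightarrow> y \<in> K \<Longrightarrow> norm (y - x) < \<delta> \<Longrightarrow>
      norm (f y - f x - f' x (y - x)) \<le> e / (4 * d * n) * norm (y - x)"
    using uniform_linearization by blast
  have "norm (w \<sigma> t - w 0 t - (\<sigma> - 0) *\<^sub>R Z t) \<le> e * norm (\<sigma> - 0)"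
    if "norm (\<sigma> - 0) < min \<eta> (\<delta> / (2 * n))" for \<sigma>
  proof -
    have \<sigma>: "\<bar>\<sigma>\<bar> < \<eta>" "2 * (\<bar>\<sigma>\<bar> * n) < \<delta>" using that n by (auto simp: field_simps)
    have "norm (w \<sigma> t - w 0 t - \<sigma> *\<^sub>R Z t) \<le> 4 * d * (e / (4 * d * n)) * (\<bar>\<sigma>\<bar> * norm u)"
    proof (rule variational_remainder[OF w w Z _ _ \<delta>(2) _ t])
      show "2 * (\<bar>\<sigma>\<bar> * norm u) < \<delta>" using \<sigma>(2) mult_left_mono[OF n(2), of "\<bar>\<sigma>\<bar>"] by simp
    qed (use \<eta> \<sigma> start[of \<sigma>] start[of 0] \<open>e / (4 * d * n) > 0\<close> in auto)
    also have "\<dots> = e * \<bar>\<sigma>\<bar> * (norm u / n)" using d_pos by simp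
    also have "\<dots> \<le> e * \<bar>\<sigma>\<bar> * 1" using \<open>e > 0\<close> n by (intro mult_left_mono) auto
    finally show ?thesis by simp
  qed
  moreover have "0 < min \<eta> (\<delta> / (2 * n))" using \<eta> \<delta>(1) n by simp
  ultimately show "\<exists>\<eta>>0. \<forall>\<sigma>. norm (\<sigma> - 0) < \<eta> \<longrightarrow>
      norm (w \<sigma> t - w 0 t - (\<sigma> - 0) *\<^sub>R Z t) \<le> e * norm (\<sigma> - 0)" by blast
qed

lemma flow_has_derivative_initial_value:
  assumes e: "0 < e" and start: "\<And>q. q \<in> ball p e \<Longrightarrow> \<Phi> q 0 = q"
    and flow: "\<And>q. q \<in> ball p e \<Longrightarrow> integral_curve f K {-d<..<d} (\<Phi> q)"
    and Z: "Z 0 = u" "\<And>t. t \<in> {-d<..<d} \<Longrightarrow> (Z has_vector_derivative f' (\<Phi> p t) (Z t)) (at t)"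
    and t: "t \<in> {-d<..<d}"
  shows "((\<lambda>\<sigma>. \<Phi> (p + \<sigma> *\<^sub>R u) t) has_vector_derivative Z t) (at 0)"
proof (rule integral_curve_has_derivative_initial_value[where w="\<lambda>\<sigma>. \<Phi> (p + \<sigma> *\<^sub>R u)" and Z=Z, OF _ _ _ Z(1) _ t])
  show "0 < e / (norm u + 1)" using e by (simp add: add_nonneg_pos)
  fix \<sigma> assume "\<bar>\<sigma>\<bar> < e / (norm u + 1)"
  then have "\<bar>\<sigma>\<bar> * (norm u + 1) < e" by (simp add: pos_less_divide_eq add_nonneg_pos)
  then have "p + \<sigma> *\<^sub>R u \<in> ball p e" by (simp add: dist_norm distrib_left)
  then show "integral_curve f K {-d<..<d} (\<Phi> (p + \<sigma> *\<^sub>R u))" "\<Phi> (p + \<sigma> *\<^sub>R u) 0 = p + \<sigma> *\<^sub>R u"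
    using flow start by auto
qed (use Z(2) in auto)

lemma shorter_time: "0 < d' \<Longrightarrow> d' \<le> d \<Longrightarrow> C1_vector_field_short_time f f' W K L d'"
  using mult_right_mono[of d' d L] L_nonneg short_time
  by unfold_locales (auto simp: compact convex subset derivative_bound)

end

context C1_vector_field
begin

lemma compact_neighbourhood:
  assumes "p \<in> W"
  obtains r L where "r > 0" "\<And>d. 0 < d \<Longrightarrow> d * L \<le> 1/2 \<Longrightarrow> C1_vector_field_short_time f f' W (cball p r) L d" "0 \<le> L"
proof -
  obtain r where r: "r > 0" "cball p r \<subseteq> W" using open_domain assms open_contains_cball by blast
  obtain L where L: "0 \<le> L" "\<And>x. x \<in> cball p r \<Longrightarrow> norm (f' x) \<le> L"
    by (rule continuous_on_compact_bound[OF compact_cball continuous_on_subset[OF continuous_derivative r(2)]]) blast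
  have "C1_vector_field_short_time f f' W (cball p r) L d" if "0 < d" "d * L \<le> 1/2" for d
    by unfold_locales (use r L that in auto)
  with r(1) show thesis using L(1) by (rule that)
qed

lemma integral_curves_eq_near:
  assumes I: "open I" "t \<in> I" and z: "integral_curve f W I z" and w: "integral_curve f W I w" and eq: "z t = w t"
  shows "\<forall>\<^sub>F s in nhds t. z s = w s"
proof -
  obtain r L where r: "r > 0" "0 \<le> L"
    and short: "\<And>d. 0 < d \<Longrightarrow> d * L \<le> 1/2 \<Longrightarrow> C1_vector_field_short_time f f' W (cball (z t) r) L d"
    using compact_neighbourhood[OF integral_curveD(1)[OF z I(2)]] by metis
  have in_ball: "\<forall>\<^sub>F s in nhds t. v s \<in> cball (z t) r" if "integral_curve f W I v" "v t = z t" for v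
  proof -
    have "isCont v t" using has_vector_derivative_continuous integral_curveD(2)[OF that(1) I(2)] by blast
    then have "(v \<longlongrightarrow> v t) (nhds t)" by (simp add: continuous_at tendsto_at_iff_tendsto_nhds)
    then have "\<forall>\<^sub>F s in nhds t. v s \<in> ball (z t) r"
      by (rule topological_tendstoD) (use r that(2) in auto)
    then show ?thesis by (rule eventually_mono) auto
  qed
  have "\<forall>\<^sub>F s in nhds t. s \<in> I \<and> z s \<in> cball (z t) r \<and> w s \<in> cball (z t) r"
    using in_ball[OF z] in_ball[OF w] eq eventually_nhds_in_open[OF I] by (simp add: eventually_conj_iff)
  then obtain e where e: "e > 0"
    "\<And>s. dist s t < e \<Longrightarrow> s \<in> I \<and> z s \<in> cball (z t) r \<and> w s \<in> cball (z t) r"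
    unfolding eventually_nhds_metric by blast
  define d where "d = min e (1 / (2 * (L + 1)))"
  have d: "0 < d" "d \<le> e" using e(1) r(2) by (auto simp: d_def)
  have "d * L \<le> 1 / (2 * (L + 1)) * L" using r(2) by (intro mult_right_mono) (auto simp: d_def)
  also have "\<dots> \<le> 1/2" using r(2) by (simp add: field_simps)
  finally interpret C1_vector_field_short_time f f' W "cball (z t) r" L d by (rule short[OF d(1)])
  have shifted: "integral_curve f (cball (z t) r) {-d<..<d} (\<lambda>s. v (t + s))"
    if "integral_curve f W I v" "\<And>s. dist s t < e \<Longrightarrow> v s \<in> cball (z t) r" for v
  proof -
    have "dist (t + s) t < e" if "s \<in> {-d<..<d}" for s using that d(2) by (auto simp: dist_real_def)
    then show ?thesis using that e(2) by (simp add: integral_curve_def has_vector_derivative_shift_iff)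
  qed
  have "z s = w s" if "dist s t < d" for s
    using integral_curve_distance[OF shifted[OF z] shifted[OF w], of "s - t"] e(2) that eq
    by (force simp: dist_real_def abs_less_iff)
  with d(1) show ?thesis unfolding eventually_nhds_metric by blast
qed

lemma integral_curves_eq:
  assumes I: "open I" "connected I" and z: "integral_curve f W I z" and w: "integral_curve f W I w"
    and "t0 \<in> I" "z t0 = w t0" "t \<in> I"
  shows "z t = w t"
proof -
  have "\<forall>\<^sub>F s in at t within I. (z t = w t) = (z s = w s)" if t: "t \<in> I" for t
  proof (cases "z t = w t")
    case True
    then have "\<forall>\<^sub>F s in nhds t. (z t = w t) = (z s = w s)"
      using integral_curves_eq_near[OF I(1) t z w] by simp
    then show ?thesis by (simp add: eventually_at_filter eventually_mono)
  next
    case False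
    have "((\<lambda>s. z s - w s) \<longlongrightarrow> z t - w t) (at t within I)"
      using continuous_on_integral_curve[OF z] continuous_on_integral_curve[OF w] t
      by (intro tendsto_diff) (auto simp: continuous_on_def)
    then have "\<forall>\<^sub>F s in at t within I. z s - w s \<noteq> 0"
      using False by (intro tendsto_imp_eventually_ne) auto
    then show ?thesis using False by (auto elim: eventually_mono)
  qed
  then show ?thesis
    using connected_local_const[OF I(2) assms(5,7), of "\<lambda>s. z s = w s"] assms(6) by blast
qed

lemma local_flow_in_compact:
  assumes p: "p \<in> W"
  obtains r L d \<Phi> where "C1_vector_field_short_time f f' W (cball p r) L d" "0 < r"
    "\<And>q. q \<in> ball p (r/2) \<Longrightarrow> \<Phi> q 0 = q"
    "\<And>q. q \<in> ball p (r/2) \<Longrightarrow> integral_curve f (cball p r) {-d<..<d} (\<Phi> q)"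
proof -
  obtain r L where r: "r > 0" and L: "0 \<le> L"
    and short: "\<And>d. 0 < d \<Longrightarrow> d * L \<le> 1/2 \<Longrightarrow> C1_vector_field_short_time f f' W (cball p r) L d"
    using compact_neighbourhood[OF p] by metis
  interpret C1_vector_field_short_time f f' W "cball p r" L "1 / (2 * (L + 1))"
    by (rule short) (use L in \<open>auto simp: field_simps\<close>)
  obtain B where B: "0 \<le> B" "\<And>x. x \<in> cball p r \<Longrightarrow> norm (f x) \<le> B"
    by (rule continuous_on_compact_bound[OF compact continuous_on_subset[OF continuous_on_field subset]]) blast
  define d where "d = min (1 / (2 * (L + 1))) (r / (2 * (B + 1)))"
  interpret flow: C1_vector_field_short_time f f' W "cball p r" L d
    by (rule shorter_time) (use r L B(1) in \<open>auto simp: d_def\<close>)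
  have "d * B \<le> r / (2 * (B + 1)) * B" using B(1) by (intro mult_right_mono) (auto simp: d_def)
  also have "\<dots> \<le> r / 2" using r B(1) by (simp add: field_simps)
  finally have "d * B \<le> r / 2" .
  moreover have "cball q (r/2) \<subseteq> cball p r" if "q \<in> ball p (r/2)" for q
    using that by (intro cball_subset_cball_iff[THEN iffD2]) (auto simp: dist_commute)
  ultimately have "\<exists>z. z 0 = q \<and> integral_curve f (cball p r) {-d<..<d} z" if "q \<in> ball p (r/2)" for q
    using flow.integral_curve_exists[of q "r/2" B] B(2) r that by auto
  then obtain \<Phi> where "\<And>q. q \<in> ball p (r/2) \<Longrightarrow> \<Phi> q 0 = q"
    "\<And>q. q \<in> ball p (r/2) \<Longrightarrow> integral_curve f (cball p r) {-d<..<d} (\<Phi> q)"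
    by metis
  with flow.C1_vector_field_short_time_axioms r show thesis by (rule that)
qed

lemma local_flow:
  assumes "p \<in> W"
  obtains d e \<Phi> Z where "d > 0" "e > 0"
    "\<And>q. q \<in> ball p e \<Longrightarrow> \<Phi> q 0 = q"
    "\<And>q. q \<in> ball p e \<Longrightarrow> integral_curve f W {-d<..<d} (\<Phi> q)"
    "\<And>u. Z u 0 = u"
    "\<And>u t. t \<in> {-d<..<d} \<Longrightarrow> (Z u has_vector_derivative f' (\<Phi> p t) (Z u t)) (at t)"
    "\<And>u t. t \<in> {-d<..<d} \<Longrightarrow> ((\<lambda>\<sigma>. \<Phi> (p + \<sigma> *\<^sub>R u) t) has_vector_derivative Z u t) (at 0)"
proof -
  obtain r L d0 \<Phi> where short: "C1_vector_field_short_time f f' W (cball p r) L d0" and r: "0 < r"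
    and start: "\<And>q. q \<in> ball p (r/2) \<Longrightarrow> \<Phi> q 0 = q"
    and curves: "\<And>q. q \<in> ball p (r/2) \<Longrightarrow> integral_curve f (cball p r) {-d0<..<d0} (\<Phi> q)"
    using local_flow_in_compact[OF assms] by metis
  interpret flow: C1_vector_field_short_time f f' W "cball p r" L d0 by (rule short)
  have curve_p: "integral_curve f W {-d0<..<d0} (\<Phi> p)"
    by (rule integral_curve_mono[OF curves _ flow.subset]) (use r in auto)
  have "continuous_on {-d0<..<d0} (\<lambda>t. f' (\<Phi> p t))"
    by (rule continuous_on_compose2[OF continuous_derivative continuous_on_integral_curve[OF curve_p]])
       (use integral_curveD(1)[OF curve_p] in blast)
  then obtain d Z where d: "d > 0" "d \<le> d0" and Z: "\<And>u. Z u 0 = u"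
    "\<And>u t. t \<in> {-d<..<d} \<Longrightarrow> (Z u has_vector_derivative f' (\<Phi> p t) (Z u t)) (at t)"
    using linear_ode_existence[OF bounded_bilinear_blinfun_apply _ flow.d_pos] by blast
  interpret C1_vector_field_short_time f f' W "cball p r" L d by (rule flow.shorter_time[OF d])
  have curves_d: "integral_curve f (cball p r) {-d<..<d} (\<Phi> q)" if "q \<in> ball p (r/2)" for q
    by (rule integral_curve_mono[OF curves[OF that]]) (use d in auto)
  show thesis
    by (rule that[OF d(1) half_gt_zero[OF r] start integral_curve_mono[OF curves_d order_refl subset] Z
          flow_has_derivative_initial_value[OF half_gt_zero[OF r] start curves_d Z]])
qed

end

section \<open>Matrix-valued functions\<close>

lemma bounded_bilinear_matrix_mult:
  "bounded_bilinear ((**) :: real^'n^'m \<Rightarrow> real^'p^'n \<Rightarrow> real^'p^'m)"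
  unfolding bilinear_conv_bounded_bilinear[symmetric]
  by (auto simp: bilinear_def linear_iff matrix_matrix_mult_def vec_eq_iff sum.distrib algebra_simps sum_distrib_left)

lemma bounded_bilinear_matrix_vector_mult:
  "bounded_bilinear ((*v) :: real^'n^'m \<Rightarrow> real^'n \<Rightarrow> real^'m)"
  unfolding bilinear_conv_bounded_bilinear[symmetric]
  by (auto simp: bilinear_def linear_iff matrix_vector_mult_def vec_eq_iff sum.distrib algebra_simps sum_distrib_left)

lemma bounded_linear_trace: "bounded_linear (trace :: real^'n^'n \<Rightarrow> real)"
  unfolding linear_conv_bounded_linear[symmetric]
  by (auto simp: linear_iff trace_def sum.distrib sum_distrib_left)

lemmas matrix_mult_linear_simps =
  bounded_bilinear.add_left[OF bounded_bilinear_matrix_mult]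
  bounded_bilinear.add_right[OF bounded_bilinear_matrix_mult]
  bounded_bilinear.diff_left[OF bounded_bilinear_matrix_mult]
  bounded_bilinear.diff_right[OF bounded_bilinear_matrix_mult]
  bounded_bilinear.minus_left[OF bounded_bilinear_matrix_mult]
  bounded_bilinear.minus_right[OF bounded_bilinear_matrix_mult]
  bounded_bilinear.scaleR_left[OF bounded_bilinear_matrix_mult]
  bounded_bilinear.scaleR_right[OF bounded_bilinear_matrix_mult]

lemmas trace_linear_simps =
  linear_add[OF bounded_linear.linear[OF bounded_linear_trace]]
  linear_diff[OF bounded_linear.linear[OF bounded_linear_trace]]
  linear_neg[OF bounded_linear.linear[OF bounded_linear_trace]]
  linear_cmul[OF bounded_linear.linear[OF bounded_linear_trace]]
  linear_0[OF bounded_linear.linear[OF bounded_linear_trace]]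

lemma bounded_bilinear_minus_matrix_mult:
  "bounded_bilinear (\<lambda>A B. - (A ** B) :: real^'p^'m)"
  for A :: "real^'n^'m" and B :: "real^'p^'n"
  unfolding bilinear_conv_bounded_bilinear[symmetric]
  by (auto simp: bilinear_def linear_iff matrix_mult_linear_simps)

lemmas has_vector_derivative_matrix_mult =
  bounded_bilinear.has_vector_derivative[OF bounded_bilinear_matrix_mult]

lemmas has_vector_derivative_matrix_vector_mult =
  bounded_bilinear.has_vector_derivative[OF bounded_bilinear_matrix_vector_mult]

lemmas has_vector_derivative_trace =
  bounded_linear.has_vector_derivative[OF bounded_linear_trace]

lemmas smooth_on_matrix_mult = smooth_on_bilinear[OF bounded_bilinear_matrix_mult]

lemma matrix_vector_mult_matrix:
  fixes f :: "real^'n \<Rightarrow> real^'m"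
  shows "linear f \<Longrightarrow> matrix f *v v = f v"
  by (simp add: matrix_works linear_matrix_vector_mul_eq)

lemma smooth_on_matrix:
  fixes L :: "'a::real_normed_vector \<Rightarrow> real^'n \<Rightarrow> real^'m"
  assumes "open S" "\<And>v. smooth_on S (\<lambda>x. L x v)"
  shows "smooth_on S (\<lambda>x. matrix (L x))"
  unfolding matrix_def
  by (intro smooth_on_vec assms(1)) (simp add: smooth_on_vec_nth[OF assms])

lemma has_vector_derivative_columns:
  fixes f :: "'n::finite \<Rightarrow> real \<Rightarrow> real^'m"
  assumes "\<And>j. (f j has_vector_derivative f' j) F"
  shows "((\<lambda>t. (\<chi> i j. f j t $ i) :: real^'n^'m) has_vector_derivative (\<chi> i j. f' j $ i)) F"
proof -
  let ?col = "\<lambda>j (v::real^'m). (\<chi> i k. if k = j then v $ i else 0) :: real^'n^'m"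
  have bounded_linear_col: "bounded_linear (?col j)" for j
    unfolding linear_conv_bounded_linear[symmetric] by (auto simp: linear_iff vec_eq_iff)
  have sum_col: "(\<Sum>j\<in>UNIV. ?col j (h j)) = (\<chi> i j. h j $ i)" for h
    by (simp add: vec_eq_iff sum.delta)
  have "((\<lambda>t. \<Sum>j\<in>UNIV. ?col j (f j t)) has_vector_derivative (\<Sum>j\<in>UNIV. ?col j (f' j))) F"
    by (intro has_vector_derivative_sum bounded_linear.has_vector_derivative[OF bounded_linear_col] assms)
  then show ?thesis unfolding sum_col .
qed

lemma det_nonzero_iff_ker:
  fixes A :: "real^'n^'n"
  shows "det A \<noteq> 0 \<longleftrightarrow> (\<forall>v. A *v v = 0 \<longrightarrow> v = 0)"
  by (simp add: invertible_det_nz[symmetric] invertible_left_inverse matrix_left_invertible_ker)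

lemma matrix_inv_mult:
  fixes A :: "real^'n^'n"
  assumes "det A \<noteq> 0"
  shows "A ** matrix_inv A = mat 1" "matrix_inv A ** A = mat 1"
proof -
  have "\<exists>A'. A ** A' = mat 1 \<and> A' ** A = mat 1"
    using assms by (simp add: invertible_det_nz[symmetric] invertible_def)
  from someI_ex[OF this] show "A ** matrix_inv A = mat 1" "matrix_inv A ** A = mat 1"
    unfolding matrix_inv_def by auto
qed

lemma det_matrix_inv:
  fixes A :: "real^'n^'n"
  assumes "det A \<noteq> 0"
  shows "det (matrix_inv A) = 1 / det A"
  using matrix_inv_mult(1)[OF assms] assms by (metis det_I det_mul nonzero_eq_divide_eq mult.commute)

lemma matrix_inv_nth:
  fixes A :: "real^'n^'n"
  assumes "det A \<noteq> 0"
  shows "matrix_inv A $ k $ l = det (\<chi> i j. if j = k then axis l 1 $ i else A $ i $ j) / det A"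
proof -
  have "A *v (matrix_inv A *v axis l 1) = axis l 1"
    by (simp add: matrix_vector_mul_assoc matrix_inv_mult assms)
  then have "matrix_inv A *v axis l 1 = (\<chi> k. det (\<chi> i j. if j = k then axis l 1 $ i else A $ i $ j) / det A)"
    using cramer[OF assms] by blast
  then show ?thesis by (simp add: matrix_vector_mult_basis column_def vec_eq_iff)
qed

lemma smooth_on_det:
  fixes F :: "'a::real_normed_vector \<Rightarrow> real ^ 'n ^ 'n"
  assumes "open S" "\<And>i j. smooth_on S (\<lambda>x. F x $ i $ j)"
  shows "smooth_on S (\<lambda>x. det (F x))"
  unfolding det_def by (intro smooth_on_sum smooth_on_mult smooth_on_const smooth_on_prod assms)

lemma smooth_on_matrix_inv:
  fixes F :: "'a::real_normed_vector \<Rightarrow> real ^ 'n ^ 'n"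
  assumes "open S" "smooth_on S F" "\<And>x. x \<in> S \<Longrightarrow> det (F x) \<noteq> 0"
  shows "smooth_on S (\<lambda>x. matrix_inv (F x))"
proof (intro smooth_on_vec assms(1))
  fix k l
  have entry: "smooth_on S (\<lambda>x. F x $ i $ j)" for i j
    by (intro smooth_on_vec_nth assms)
  have "smooth_on S (\<lambda>x. det ((\<chi> i j. if j = k then axis l 1 $ i else F x $ i $ j) :: real^'n^'n) * inverse (det (F x)))"
  proof (intro smooth_on_mult smooth_on_inverse smooth_on_det entry assms)
    fix i j
    show "smooth_on S (\<lambda>x. (\<chi> i j. if j = k then axis l 1 $ i else F x $ i $ j) $ i $ j)"
      by (cases "j = k") (simp_all add: smooth_on_const assms(1) entry)
  qed
  then show "smooth_on S (\<lambda>x. matrix_inv (F x) $ k $ l)"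
    by (rule smooth_on_cong[OF _ assms(1)]) (simp add: matrix_inv_nth assms(3) divide_inverse)
qed

lemma prod_mat_1_permutation:
  fixes p :: "'n::finite \<Rightarrow> 'n"
  assumes p: "p permutes UNIV" "p \<noteq> id"
  shows "(\<Prod>j\<in>UNIV - {i}. (mat 1 :: 'a::comm_ring_1^'n^'n) $ j $ p j) = 0"
proof -
  have "\<exists>j. j \<noteq> i \<and> p j \<noteq> j"
  proof (rule ccontr)
    assume "\<nexists>j. j \<noteq> i \<and> p j \<noteq> j"
    then have fixes_rest: "\<And>j. j \<noteq> i \<Longrightarrow> p j = j" by blast
    then have "p i = i" using permutes_inj[OF p(1)] by (metis injD)
    with fixes_rest have "p = id" by (metis eq_id_iff)
    with p(2) show False by simp
  qed
  then obtain j where "j \<noteq> i" "p j \<noteq> j" by blast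
  then show ?thesis by (intro prod_zero) (auto simp: mat_def intro!: bexI[of _ j])
qed

lemma det_derivative_at_mat1:
  fixes F :: "real \<Rightarrow> real^'n^'n"
  assumes F: "(F has_vector_derivative X) (at t)" and F1: "F t = mat 1"
  shows "((\<lambda>s. det (F s)) has_vector_derivative trace X) (at t)"
proof -
  let ?d = "\<lambda>p. of_int (sign p) * (\<Sum>i\<in>UNIV. X $ i $ p i * (\<Prod>j\<in>UNIV - {i}. F t $ j $ p j))"
  have entry: "((\<lambda>s. F s $ i $ j) has_real_derivative X $ i $ j) (at t)" for i j
    unfolding has_real_derivative_iff_has_vector_derivative
    by (intro bounded_linear.has_vector_derivative[OF bounded_linear_vec_nth] F)
  have "((\<lambda>s. det (F s)) has_real_derivative (\<Sum>p | p permutes (UNIV :: 'n set). ?d p)) (at t)"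
    unfolding det_def by (intro DERIV_sum DERIV_cmult has_field_derivative_prod entry)
  also have "(\<Sum>p | p permutes (UNIV :: 'n set). ?d p)
     = (\<Sum>p\<in>{p. p permutes (UNIV :: 'n set)}. if p = id then trace X else 0)"
  proof (rule sum.cong[OF refl])
    fix p :: "'n \<Rightarrow> 'n" assume "p \<in> {p. p permutes UNIV}"
    then show "?d p = (if p = id then trace X else 0)"
      unfolding F1 by (cases "p = id") (simp_all add: prod_mat_1_permutation, simp add: mat_def trace_def)
  qed
  also have "\<dots> = trace X" by (simp add: sum.delta permutes_id finite_permutations)
  finally show ?thesis unfolding has_real_derivative_iff_has_vector_derivative .
qed

lemma det_derivative:
  fixes F :: "real \<Rightarrow> real^'n^'n"
  assumes F: "(F has_vector_derivative X) (at t)" and nonzero: "det (F t) \<noteq> 0"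
  shows "((\<lambda>s. det (F s)) has_vector_derivative det (F t) * trace (X ** matrix_inv (F t))) (at t)"
proof -
  let ?G = "\<lambda>s. F s ** matrix_inv (F t)"
  have "bounded_linear (\<lambda>A. A ** matrix_inv (F t))"
    by (rule bounded_bilinear.bounded_linear_left[OF bounded_bilinear_matrix_mult])
  from bounded_linear.has_vector_derivative[OF this F]
  have "((\<lambda>s. det (?G s)) has_vector_derivative trace (X ** matrix_inv (F t))) (at t)"
    by (rule det_derivative_at_mat1) (rule matrix_inv_mult(1)[OF nonzero])
  then have "((\<lambda>s. det (F t) * det (?G s)) has_vector_derivative det (F t) * trace (X ** matrix_inv (F t))) (at t)"
    by (rule bounded_linear.has_vector_derivative[OF bounded_linear_mult_right])
  moreover have "det (F t) * det (?G s) = det (F s)" for s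
    using nonzero by (simp add: det_mul det_matrix_inv)
  ultimately show ?thesis by simp
qed

lemma matrix_inv_derivative:
  fixes F :: "real \<Rightarrow> real^'n^'n"
  assumes I: "open I" "t \<in> I" and F: "smooth_on I F" and nonzero: "\<And>t. t \<in> I \<Longrightarrow> det (F t) \<noteq> 0"
    and X: "(F has_vector_derivative X) (at t)"
  shows "((\<lambda>s. matrix_inv (F s)) has_vector_derivative - (matrix_inv (F t) ** X ** matrix_inv (F t))) (at t)"
proof -
  obtain Y where Y: "((\<lambda>s. matrix_inv (F s)) has_vector_derivative Y) (at t)"
    using smooth_on_has_vector_derivative[OF smooth_on_matrix_inv[OF I(1) F nonzero] I] by blast
  have "((\<lambda>s. F s ** matrix_inv (F s)) has_vector_derivative 0) (at t)"
    by (rule has_vector_derivative_transform_within_open[OF has_vector_derivative_const[of "mat 1"] I])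
       (simp add: matrix_inv_mult nonzero)
  then have "F t ** Y + X ** matrix_inv (F t) = 0"
    by (rule vector_derivative_unique_at[OF has_vector_derivative_matrix_mult[OF X Y]])
  then have "matrix_inv (F t) ** (F t ** Y + X ** matrix_inv (F t)) = 0"
    by simp
  then have "Y + matrix_inv (F t) ** X ** matrix_inv (F t) = 0"
    by (simp add: matrix_mult_linear_simps matrix_mul_assoc matrix_inv_mult nonzero I)
  then have "Y = - (matrix_inv (F t) ** X ** matrix_inv (F t))" by (simp add: eq_neg_iff_add_eq_0)
  with Y show ?thesis by simp
qed

section \<open>The Levi-Civita connection in a chart\<close>

lemma ginner_linear_left: "linear (\<lambda>v. ginner G x v w)"
  by (rule linearI) (auto simp: ginner_def inner_add_left)

lemma ginner_linear_right: "linear (ginner G x v)"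
  by (rule linearI) (auto simp: ginner_def inner_add_right matrix_vector_right_distrib matrix_vector_mult_scaleR)

lemmas ginner_simps =
  linear_add[OF ginner_linear_left] linear_add[OF ginner_linear_right]
  linear_diff[OF ginner_linear_left] linear_neg[OF ginner_linear_left] linear_neg[OF ginner_linear_right]
  linear_cmul[OF ginner_linear_left] linear_cmul[OF ginner_linear_right]
  linear_0[OF ginner_linear_left] linear_0[OF ginner_linear_right]

lemma bounded_linear_ginner: "bounded_linear (\<lambda>A. v \<bullet> (A *v w :: real^'n))"
  by (intro bounded_linear_compose[OF bounded_linear_inner_right]
      bounded_bilinear.bounded_linear_left[OF bounded_bilinear_matrix_vector_mult])

lemma inner_vec_lambda_linear:
  fixes f :: "real^'n \<Rightarrow> real"
  assumes "linear f"
  shows "u \<bullet> (\<chi> l. f (axis l 1)) = f u"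
proof -
  have "f u = f (\<Sum>l\<in>UNIV. (u $ l) *\<^sub>R axis l 1)"
    using basis_expansion[of u] by (simp add: scalar_mult_eq_scaleR)
  also have "\<dots> = (\<Sum>l\<in>UNIV. u $ l * f (axis l 1))"
    by (simp add: linear_sum[OF assms] linear_cmul[OF assms])
  finally show ?thesis by (simp add: inner_vec_def)
qed

definition chart_geodesic ::
  "(real^'n) set \<Rightarrow> (real^'n \<Rightarrow> real^'n^'n) \<Rightarrow> real set \<Rightarrow> (real \<Rightarrow> real^'n) \<Rightarrow> (real \<Rightarrow> real^'n::finite) \<Rightarrow> bool" where
  "chart_geodesic U G I x y \<longleftrightarrow> (\<forall>t\<in>I. x t \<in> U \<and> (x has_vector_derivative y t) (at t) \<and>
     (y has_vector_derivative - christoffel G (x t) (y t) (y t)) (at t))"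

lemma chart_geodesicD:
  assumes "chart_geodesic U G I x y" "t \<in> I"
  shows "x t \<in> U" "(x has_vector_derivative y t) (at t)"
    "(y has_vector_derivative - christoffel G (x t) (y t) (y t)) (at t)"
  using assms by (auto simp: chart_geodesic_def)

lemma chart_geodesic_subset: "chart_geodesic U G I x y \<Longrightarrow> J \<subseteq> I \<Longrightarrow> chart_geodesic U G J x y"
  by (auto simp: chart_geodesic_def)

lemma chart_geodesic_shift:
  "chart_geodesic U G I x y \<Longrightarrow> (\<And>s. s \<in> J \<Longrightarrow> t + s \<in> I) \<Longrightarrow>
    chart_geodesic U G J (\<lambda>s. x (t + s)) (\<lambda>s. y (t + s))"
  by (simp add: chart_geodesic_def has_vector_derivative_shift_iff)

locale chart_metric =
  fixes U :: "(real^'n::finite) set" and G :: "real^'n \<Rightarrow> real^'n^'n"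
  assumes openU: "open U" and smoothG: "smooth_on U G"
    and symG: "x \<in> U \<Longrightarrow> ginner G x v w = ginner G x w v"
    and posG: "x \<in> U \<Longrightarrow> v \<noteq> 0 \<Longrightarrow> ginner G x v v > 0"
begin

abbreviation "g \<equiv> ginner G"
abbreviation "\<Gamma> \<equiv> christoffel G"

definition dg :: "real^'n \<Rightarrow> real^'n \<Rightarrow> real^'n \<Rightarrow> real^'n \<Rightarrow> real" where
  "dg x u v w = dir_deriv (\<lambda>y. g y v w) x u"

definition d\<Gamma> :: "real^'n \<Rightarrow> real^'n \<Rightarrow> real^'n \<Rightarrow> real^'n \<Rightarrow> real^'n" where
  "d\<Gamma> x u v w = dir_deriv (\<lambda>y. \<Gamma> y v w) x u"

lemma det_G_nonzero:
  assumes "x \<in> U"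
  shows "det (G x) \<noteq> 0"
  unfolding det_nonzero_iff_ker using posG[OF assms] by (force simp: ginner_def)

lemma g_nondegenerate:
  assumes "x \<in> U" "\<And>u. g x a u = g x b u"
  shows "a = b"
proof (rule ccontr)
  assume "a \<noteq> b"
  then have "g x (a - b) (a - b) > 0" using posG assms(1) by simp
  moreover have "g x (a - b) (a - b) = 0" using assms(2)[of "a - b"] by (simp add: ginner_simps)
  ultimately show False by simp
qed

lemma smooth_g: "smooth_on U (\<lambda>x. g x v w)"
  unfolding ginner_def by (rule smooth_on_bounded_linear[OF bounded_linear_ginner openU smoothG])

lemma dg_eq: "x \<in> U \<Longrightarrow> dg x u v w = v \<bullet> (dir_deriv G x u *v w)"
  unfolding dg_def ginner_def
  by (rule dir_deriv_bounded_linear[OF bounded_linear_ginner smooth_on_has_derivative[OF smoothG openU]])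

lemma dg_linear:
  assumes "x \<in> U"
  shows "linear (\<lambda>u. dg x u v w)" "linear (\<lambda>v. dg x u v w)" "linear (\<lambda>w. dg x u v w)"
proof -
  show "linear (\<lambda>u. dg x u v w)" unfolding dg_def by (rule smooth_on_linear_dir_deriv[OF smooth_g openU assms])
  show "linear (\<lambda>v. dg x u v w)" "linear (\<lambda>w. dg x u v w)"
    unfolding dg_eq[OF assms]
    by (auto intro!: linearI simp: inner_add_left inner_add_right matrix_vector_right_distrib matrix_vector_mult_scaleR)
qed

lemma dg_sym: "x \<in> U \<Longrightarrow> dg x u v w = dg x u w v"
  unfolding dg_def by (rule dir_deriv_cong[OF openU]) (auto intro: symG)

lemma dg_simps:
  assumes "x \<in> U"
  shows "dg x (a + b) v w = dg x a v w + dg x b v w" "dg x u (a + b) w = dg x u a w + dg x u b w"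
    "dg x u v (a + b) = dg x u v a + dg x u v b" "dg x (r *\<^sub>R a) v w = r * dg x a v w"
    "dg x u (r *\<^sub>R a) w = r * dg x u a w" "dg x u v (r *\<^sub>R a) = r * dg x u v a"
  by (simp_all add: linear_add[OF dg_linear(1)[OF assms]] linear_add[OF dg_linear(2)[OF assms]]
      linear_add[OF dg_linear(3)[OF assms]] linear_cmul[OF dg_linear(1)[OF assms]]
      linear_cmul[OF dg_linear(2)[OF assms]] linear_cmul[OF dg_linear(3)[OF assms]])

lemma g_christoffel:
  assumes x: "x \<in> U"
  shows "g x (\<Gamma> x v w) u = (dg x v w u + dg x w v u - dg x u v w) / 2"
proof -
  let ?h = "\<lambda>u. (dg x v w u + dg x w v u - dg x u v w) / 2"
  have lin: "linear ?h"
    by (rule linearI) (simp_all add: dg_simps[OF x] algebra_simps add_divide_distrib diff_divide_distrib)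
  have "G x *v \<Gamma> x v w = (\<chi> l. ?h (axis l 1))"
    unfolding christoffel_def dg_def by (simp add: matrix_vector_mul_assoc matrix_inv_mult det_G_nonzero[OF x])
  then have "g x u (\<Gamma> x v w) = ?h u" by (simp add: ginner_def inner_vec_lambda_linear[OF lin])
  then show ?thesis using symG[OF x] by metis
qed

lemma christoffel_eqI:
  assumes "x \<in> U" "\<And>u. g x z u = (dg x v w u + dg x w v u - dg x u v w) / 2"
  shows "\<Gamma> x v w = z"
  by (rule g_nondegenerate[OF assms(1)]) (simp only: g_christoffel[OF assms(1)] assms(2))

lemma christoffel_sym: "x \<in> U \<Longrightarrow> \<Gamma> x v w = \<Gamma> x w v"
  by (rule christoffel_eqI) (auto simp only: g_christoffel dg_sym[of x _ w v] add.commute)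

lemma christoffel_linear_right: "x \<in> U \<Longrightarrow> linear (\<Gamma> x v)"
  by (rule linearI; rule christoffel_eqI)
     (simp_all add: g_christoffel ginner_simps dg_simps algebra_simps add_divide_distrib diff_divide_distrib)

lemma christoffel_linear_left: "x \<in> U \<Longrightarrow> linear (\<lambda>v. \<Gamma> x v w)"
  by (subst christoffel_sym) (auto intro: christoffel_linear_right)

lemmas christoffel_simps =
  linear_add[OF christoffel_linear_left] linear_add[OF christoffel_linear_right]
  linear_cmul[OF christoffel_linear_left] linear_cmul[OF christoffel_linear_right]
  linear_neg[OF christoffel_linear_left] linear_neg[OF christoffel_linear_right]
  linear_0[OF christoffel_linear_left] linear_0[OF christoffel_linear_right]
  linear_diff[OF christoffel_linear_left] linear_diff[OF christoffel_linear_right]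

lemma metric_compatible:
  assumes x: "x \<in> U"
  shows "dg x u v w = g x (\<Gamma> x u v) w + g x v (\<Gamma> x u w)"
  unfolding symG[OF x, of v "\<Gamma> x u w"] g_christoffel[OF x]
  using dg_sym[OF x, of u v w] dg_sym[OF x, of v u w] dg_sym[OF x, of w u v] by (simp add: field_simps)

lemma smooth_christoffel: "smooth_on U (\<lambda>x. \<Gamma> x v w)"
proof -
  have "smooth_on U (\<lambda>x. \<chi> l. (dir_deriv (\<lambda>y. g y w (axis l 1)) x v
      + dir_deriv (\<lambda>y. g y v (axis l 1)) x w - dir_deriv (\<lambda>y. g y v w) x (axis l 1)) / 2)"
  proof (rule smooth_on_vec[OF openU])
    fix l
    have "smooth_on U (\<lambda>x. (1/2) * (dir_deriv (\<lambda>y. g y w (axis l 1)) x v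
        + dir_deriv (\<lambda>y. g y v (axis l 1)) x w - dir_deriv (\<lambda>y. g y v w) x (axis l 1)))"
      by (intro smooth_on_mult smooth_on_const smooth_on_diff smooth_on_add smooth_on_dir_deriv smooth_g openU)
    then show "smooth_on U (\<lambda>x. (\<chi> l. (dir_deriv (\<lambda>y. g y w (axis l 1)) x v
        + dir_deriv (\<lambda>y. g y v (axis l 1)) x w - dir_deriv (\<lambda>y. g y v w) x (axis l 1)) / 2) $ l)"
      by simp
  qed
  then show ?thesis
    unfolding christoffel_def
    by (intro smooth_on_bilinear[OF bounded_bilinear_matrix_vector_mult openU] smooth_on_matrix_inv[OF openU smoothG]
        det_G_nonzero)
qed

lemma smooth_christoffel_fields:
  assumes "open S" "x ` S \<subseteq> U" "smooth_on S x" "smooth_on S v" "smooth_on S w"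
  shows "smooth_on S (\<lambda>s. \<Gamma> (x s) (v s) (w s))"
  by (rule smooth_on_bilinear_family[of S "\<lambda>s. \<Gamma> (x s)", OF assms(1) christoffel_linear_left
        christoffel_linear_right smooth_on_compose[OF smooth_christoffel assms(3) openU assms(1,2)] assms(4,5)])
     (use assms(2) in auto)

lemma dchristoffel_sym: "x \<in> U \<Longrightarrow> d\<Gamma> x u v w = d\<Gamma> x u w v"
  unfolding d\<Gamma>_def by (rule dir_deriv_cong[OF openU]) (auto intro: christoffel_sym)

lemma dchristoffel_linear:
  assumes x: "x \<in> U"
  shows "linear (\<lambda>u. d\<Gamma> x u v w)" "linear (\<lambda>v. d\<Gamma> x u v w)" "linear (\<lambda>w. d\<Gamma> x u v w)"
proof -
  note deriv = smooth_on_has_derivative[OF smooth_christoffel openU x]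
  show "linear (\<lambda>u. d\<Gamma> x u v w)" unfolding d\<Gamma>_def by (rule smooth_on_linear_dir_deriv[OF smooth_christoffel openU x])
  show "linear (\<lambda>v. d\<Gamma> x u v w)"
    unfolding d\<Gamma>_def by (rule linear_dir_deriv_family[OF openU x christoffel_linear_left deriv])
  show "linear (\<lambda>w. d\<Gamma> x u v w)"
    unfolding d\<Gamma>_def by (rule linear_dir_deriv_family[OF openU x christoffel_linear_right deriv])
qed

lemmas dchristoffel_simps =
  linear_add[OF dchristoffel_linear(1)] linear_add[OF dchristoffel_linear(2)] linear_add[OF dchristoffel_linear(3)]
  linear_cmul[OF dchristoffel_linear(1)] linear_cmul[OF dchristoffel_linear(2)] linear_cmul[OF dchristoffel_linear(3)]

lemma christoffel_along:
  assumes I: "open I" "t \<in> I" and xU: "\<And>s. s \<in> I \<Longrightarrow> x s \<in> U"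
    and x: "(x has_vector_derivative x') (at t)"
    and v: "(v has_vector_derivative v') (at t)" and w: "(w has_vector_derivative w') (at t)"
  shows "((\<lambda>s. \<Gamma> (x s) (v s) (w s)) has_vector_derivative
     d\<Gamma> (x t) x' (v t) (w t) + \<Gamma> (x t) (v t) w' + \<Gamma> (x t) v' (w t)) (at t)"
proof -
  have "((\<lambda>s. \<Gamma> (x s) a b) has_vector_derivative d\<Gamma> (x t) x' a b) (at t)" for a b
    unfolding d\<Gamma>_def
    by (rule has_vector_derivative_chain[of "\<lambda>y. \<Gamma> y a b" _ x,
          OF smooth_on_has_derivative[OF smooth_christoffel openU xU[OF I(2)]] x])
  from has_vector_derivative_linear_family[OF I christoffel_linear_right[OF xU] this w]
  have "((\<lambda>s. \<Gamma> (x s) a (w s)) has_vector_derivative d\<Gamma> (x t) x' a (w t) + \<Gamma> (x t) a w') (at t)" for a .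
  from has_vector_derivative_linear_family[OF I christoffel_linear_left[OF xU] this v] show ?thesis .
qed

lemma g_along:
  assumes xt: "x t \<in> U"
    and x: "(x has_vector_derivative x') (at t)"
    and v: "(v has_vector_derivative v') (at t)" and w: "(w has_vector_derivative w') (at t)"
  shows "((\<lambda>s. g (x s) (v s) (w s)) has_vector_derivative
     dg (x t) x' (v t) (w t) + g (x t) v' (w t) + g (x t) (v t) w') (at t)"
proof -
  have "((\<lambda>s. G (x s)) has_vector_derivative dir_deriv G (x t) x') (at t)"
    by (rule has_vector_derivative_chain[of G _ x, OF smooth_on_has_derivative[OF smoothG openU xt] x])
  then have "((\<lambda>s. v s \<bullet> (G (x s) *v w s)) has_vector_derivative
     v t \<bullet> (G (x t) *v w' + dir_deriv G (x t) x' *v w t) + v' \<bullet> (G (x t) *v w t)) (at t)"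
    by (intro bounded_bilinear.has_vector_derivative[OF bounded_bilinear_inner]
       has_vector_derivative_matrix_vector_mult v w)
  then show ?thesis unfolding dg_eq[OF xt] unfolding ginner_def by (simp add: inner_add_right algebra_simps)
qed

section \<open>Curvature and covariant derivatives of tensors along geodesics\<close>

definition curvature :: "real^'n \<Rightarrow> real^'n \<Rightarrow> real^'n \<Rightarrow> real^'n \<Rightarrow> real^'n" where
  "curvature x u v w = d\<Gamma> x u v w + \<Gamma> x u (\<Gamma> x v w) - d\<Gamma> x v u w - \<Gamma> x v (\<Gamma> x u w)"

lemma curvature_op_const:
  assumes "x \<in> U"
  shows "curvature_op G (\<lambda>_. u) (\<lambda>_. v) (\<lambda>_. w) x = curvature x u v w"
  by (simp add: curvature_op_def nabla_def[abs_def] lie_bracket_def[abs_def] curvature_def d\<Gamma>_def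
      christoffel_simps[OF assms])

lemma curvature_linear:
  assumes x: "x \<in> U"
  shows "linear (\<lambda>u. curvature x u v w)" "linear (\<lambda>v. curvature x u v w)" "linear (\<lambda>w. curvature x u v w)"
  unfolding curvature_def
  by (rule linearI; simp add: dchristoffel_simps[OF x] christoffel_simps[OF x] algebra_simps)+

lemma smooth_curvature: "smooth_on U (\<lambda>x. curvature x u v w)"
  unfolding curvature_def d\<Gamma>_def
  by (intro smooth_on_diff smooth_on_add smooth_on_dir_deriv smooth_christoffel_fields[where x="\<lambda>x. x"]
      smooth_christoffel smooth_on_const smooth_on_id openU) auto

lemma smooth_curvature_fields:
  assumes "open S" "x ` S \<subseteq> U" "smooth_on S x" "smooth_on S v" "smooth_on S w"
  shows "smooth_on S (\<lambda>s. curvature (x s) u (v s) (w s))"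
  by (rule smooth_on_bilinear_family[of S "\<lambda>s. curvature (x s) u", OF assms(1) curvature_linear(2)
        curvature_linear(3) smooth_on_compose[OF smooth_curvature assms(3) openU assms(1,2)] assms(4,5)])
     (use assms(2) in auto)

definition tensor_field :: "nat \<Rightarrow> (real^'n \<Rightarrow> (real^'n) list \<Rightarrow> real) \<Rightarrow> bool" where
  "tensor_field r T \<longleftrightarrow> (\<forall>vs. length vs = r \<longrightarrow> smooth_on U (\<lambda>x. T x vs)) \<and>
     (\<forall>x\<in>U. \<forall>vs i. length vs = r \<longrightarrow> i < r \<longrightarrow> linear (\<lambda>v. T x (vs[i := v])))"

lemma tensor_fieldD:
  assumes "tensor_field r T" "length vs = r"
  shows "smooth_on U (\<lambda>x. T x vs)" "x \<in> U \<Longrightarrow> i < r \<Longrightarrow> linear (\<lambda>v. T x (vs[i := v]))"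
  using assms by (auto simp: tensor_field_def)

lemma riemann_tensor_eq:
  "x \<in> U \<Longrightarrow> riemann_tensor G x vs = g x (curvature x (vs ! 0) (vs ! 1) (vs ! 2)) (vs ! 3)"
  by (simp add: riemann_tensor_def curvature_op_const)

lemma tensor_field_riemann: "tensor_field 4 (riemann_tensor G)"
  unfolding tensor_field_def
proof (intro conjI allI impI ballI)
  fix vs :: "(real^'n) list"
  have "smooth_on U (\<lambda>x. curvature x (vs ! 0) (vs ! 1) (vs ! 2) \<bullet> (G x *v (vs ! 3)))"
    by (intro smooth_on_bilinear[OF bounded_bilinear_inner] smooth_curvature openU
        smooth_on_bounded_linear[OF bounded_bilinear.bounded_linear_left[OF bounded_bilinear_matrix_vector_mult]]
        smoothG)
  then show "smooth_on U (\<lambda>x. riemann_tensor G x vs)"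
    by (rule smooth_on_cong[OF _ openU]) (simp add: riemann_tensor_eq ginner_def)
next
  fix x and i :: nat and vs :: "(real^'n) list" assume x: "x \<in> U" and "length vs = 4" and "i < 4"
  then consider "i = 0" | "i = 1" | "i = 2" | "i = 3" by linarith
  then show "linear (\<lambda>v. riemann_tensor G x (vs[i := v]))"
    using \<open>length vs = 4\<close> ginner_linear_right
      linear_compose[OF curvature_linear(1)[OF x] ginner_linear_left]
      linear_compose[OF curvature_linear(2)[OF x] ginner_linear_left]
      linear_compose[OF curvature_linear(3)[OF x] ginner_linear_left]
    by cases (simp_all add: riemann_tensor_eq[OF x] o_def)
qed

lemma cov_deriv_append:
  "cov_deriv G T x (ws @ [u]) = dir_deriv (\<lambda>y. T y ws) x u - (\<Sum>i<length ws. T x (ws[i := \<Gamma> x u (ws ! i)]))"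
  by (simp add: cov_deriv_def)

lemma smooth_cov_deriv:
  assumes T: "tensor_field r T" and ws: "length ws = r"
  shows "smooth_on U (\<lambda>x. cov_deriv G T x (ws @ [u]))"
proof -
  have "smooth_on U (\<lambda>x. T x (ws[i := \<Gamma> x u (ws ! i)]))" if "i < r" for i
    by (rule smooth_on_linear_family[of U "\<lambda>x v. T x (ws[i := v])", OF openU tensor_fieldD(2)[OF T ws _ that]
          tensor_fieldD(1)[OF T] smooth_christoffel]) (use ws in simp_all)
  then show ?thesis
    unfolding cov_deriv_append using ws
    by (intro smooth_on_diff smooth_on_sum smooth_on_dir_deriv openU tensor_fieldD(1)[OF T]) auto
qed

lemma cov_deriv_linear_direction:
  assumes T: "tensor_field r T" and ws: "length ws = r" and x: "x \<in> U"
  shows "linear (\<lambda>u. cov_deriv G T x (ws @ [u]))"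
proof -
  have "linear (\<lambda>u. T x (ws[i := \<Gamma> x u (ws ! i)]))" if "i < r" for i
    using linear_compose[OF christoffel_linear_left[OF x] tensor_fieldD(2)[OF T ws x that]] by (simp add: o_def)
  then show ?thesis
    unfolding cov_deriv_append using ws
    by (intro linear_compose_sub linear_compose_sum ballI
        smooth_on_linear_dir_deriv[OF tensor_fieldD(1)[OF T] openU x]) auto
qed

lemma cov_deriv_linear_slot:
  assumes T: "tensor_field r T" and ws: "length ws = r" and x: "x \<in> U" and i: "i < r"
  shows "linear (\<lambda>v. cov_deriv G T x (ws[i := v] @ [u]))"
proof -
  have "linear (\<lambda>v. dir_deriv (\<lambda>y. T y (ws[i := v])) x u)"
    by (rule linear_dir_deriv_family[OF openU x tensor_fieldD(2)[OF T ws _ i]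
          smooth_on_has_derivative[OF tensor_fieldD(1)[OF T] openU x]]) (use ws in simp_all)
  moreover have "linear (\<lambda>v. T x (ws[i := v, j := \<Gamma> x u (ws[i := v] ! j)]))" if "j < r" for j
  proof (cases "j = i")
    case True
    then show ?thesis
      using linear_compose[OF christoffel_linear_right[OF x] tensor_fieldD(2)[OF T ws x i]] ws i by (simp add: o_def)
  next
    case False
    then have "(\<lambda>v. T x (ws[i := v, j := \<Gamma> x u (ws[i := v] ! j)])) = (\<lambda>v. T x (ws[j := \<Gamma> x u (ws ! j), i := v]))"
      by (auto simp: list_update_swap)
    then show ?thesis using tensor_fieldD(2)[OF T _ x i, of "ws[j := \<Gamma> x u (ws ! j)]"] ws by simp
  qed
  ultimately show ?thesis
    unfolding cov_deriv_append length_list_update ws by (intro linear_compose_sub linear_compose_sum ballI) simp_all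
qed

lemma tensor_field_cov_deriv:
  assumes T: "tensor_field r T"
  shows "tensor_field (Suc r) (cov_deriv G T)"
  unfolding tensor_field_def
proof (intro conjI allI impI ballI)
  fix vs :: "(real^'n) list" assume "length vs = Suc r"
  then obtain ws u where vs: "vs = ws @ [u]" and ws: "length ws = r"
    by (metis length_Suc_conv_rev)
  show "smooth_on U (\<lambda>x. cov_deriv G T x vs)"
    unfolding vs by (rule smooth_cov_deriv[OF T ws])
  fix x i assume x: "x \<in> U" and "i < Suc r"
  then show "linear (\<lambda>v. cov_deriv G T x (vs[i := v]))"
    using cov_deriv_linear_direction[OF T ws x] cov_deriv_linear_slot[OF T ws x]
    by (cases "i = r") (simp_all add: vs list_update_append ws)
qed

text \<open>The vectors are replaced by the moving ones \<open>Ws\<close> one slot at a time.\<close>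

lemma tensor_along:
  assumes T: "tensor_field r T" and I: "open I" "t \<in> I" and xU: "\<And>s. s \<in> I \<Longrightarrow> x s \<in> U"
    and x: "(x has_vector_derivative x') (at t)"
    and len: "length Ws = r" "length Ws' = r"
    and W: "\<And>i. i < r \<Longrightarrow> (Ws ! i has_vector_derivative Ws' ! i) (at t)"
  shows "((\<lambda>s. T (x s) (map (\<lambda>W. W s) Ws)) has_vector_derivative
     dir_deriv (\<lambda>y. T y (map (\<lambda>W. W t) Ws)) (x t) x'
       + (\<Sum>i<r. T (x t) ((map (\<lambda>W. W t) Ws)[i := Ws' ! i]))) (at t)"
proof -
  define L where "L j vs s = map (\<lambda>W. W s) (take j Ws) @ drop j vs" for j vs s
  have "((\<lambda>s. T (x s) (L j vs s)) has_vector_derivative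
     dir_deriv (\<lambda>y. T y (L j vs t)) (x t) x' + (\<Sum>i<j. T (x t) ((L j vs t)[i := Ws' ! i]))) (at t)"
    if "j \<le> r" "length vs = r" for j vs
    using that
  proof (induction j arbitrary: vs)
    case 0
    from has_vector_derivative_chain[of "\<lambda>y. T y vs" _ x,
        OF smooth_on_has_derivative[OF tensor_fieldD(1)[OF T 0(2)] openU xU[OF I(2)]] x]
    show ?case by (simp add: L_def)
  next
    case (Suc j)
    then have j: "j < r" by simp
    have len_L: "length (L j vs s) = r" for s using Suc.prems len by (simp add: L_def)
    have L_update: "(L j vs s)[j := v] = L j (vs[j := v]) s" for v s
      using Suc.prems len by (simp add: L_def list_update_append drop_update_swap)
    have L_Suc: "L (Suc j) vs s = (L j vs s)[j := (Ws ! j) s]" for s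
      using Suc.prems len by (simp add: L_def take_Suc_conv_app_nth list_update_append Cons_nth_drop_Suc[symmetric])
    have IH: "((\<lambda>s. T (x s) ((L j vs s)[j := v])) has_vector_derivative
       dir_deriv (\<lambda>y. T y ((L j vs t)[j := v])) (x t) x'
         + (\<Sum>i<j. T (x t) ((L j vs t)[j := v, i := Ws' ! i]))) (at t)" for v
      unfolding L_update using Suc.IH[of "vs[j := v]"] Suc.prems by simp
    have linear: "linear (\<lambda>v. T (x s) ((L j vs s)[j := v]))" if "s \<in> I" for s
      by (rule tensor_fieldD(2)[OF T len_L xU[OF that] j])
    from has_vector_derivative_linear_family[OF I linear IH W[OF j]] show ?case
      by (simp add: L_Suc add.assoc)
  qed
  from this[of r "replicate r 0"] show ?thesis using len by (simp add: L_def)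
qed

lemma tensor_along_parallel:
  assumes T: "tensor_field r T" and I: "open I" "t \<in> I" and xU: "\<And>s. s \<in> I \<Longrightarrow> x s \<in> U"
    and x: "(x has_vector_derivative x') (at t)" and len: "length Ws = r"
    and W: "\<And>W. W \<in> set Ws \<Longrightarrow> (W has_vector_derivative - \<Gamma> (x t) x' (W t)) (at t)"
  shows "((\<lambda>s. T (x s) (map (\<lambda>W. W s) Ws)) has_vector_derivative
     cov_deriv G T (x t) (map (\<lambda>W. W t) Ws @ [x'])) (at t)"
proof -
  let ?ws = "map (\<lambda>W. W t) Ws"
  have "T (x t) (?ws[i := - \<Gamma> (x t) x' (?ws ! i)]) = - T (x t) (?ws[i := \<Gamma> (x t) x' (?ws ! i)])" if "i < r" for i
    using linear_neg[OF tensor_fieldD(2)[OF T _ xU[OF I(2)] that], of ?ws] len by simp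
  then have "(\<Sum>i<r. T (x t) (?ws[i := (map (\<lambda>W. - \<Gamma> (x t) x' (W t)) Ws) ! i]))
      = - (\<Sum>i<r. T (x t) (?ws[i := \<Gamma> (x t) x' (?ws ! i)]))"
    using len by (simp add: sum_negf[symmetric])
  then show ?thesis
    using tensor_along[OF T I xU x len, of "map (\<lambda>W. - \<Gamma> (x t) x' (W t)) Ws"] W len
    by (simp add: cov_deriv_append)
qed

section \<open>The geodesic vector field\<close>

lemma chart_geodesic_scale:
  assumes "chart_geodesic U G I x y"
  shows "chart_geodesic U G ((*) s -` I) (\<lambda>t. x (s * t)) (\<lambda>t. s *\<^sub>R y (s * t))"
  unfolding chart_geodesic_def
proof (intro ballI conjI)
  fix t assume "t \<in> (*) s -` I"
  then have st: "s * t \<in> I" by simp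
  note geodesic = chart_geodesicD[OF assms st]
  show "x (s * t) \<in> U" by (rule geodesic(1))
  show "((\<lambda>t. x (s * t)) has_vector_derivative s *\<^sub>R y (s * t)) (at t)"
    by (rule has_vector_derivative_scale[OF geodesic(2)])
  show "((\<lambda>t. s *\<^sub>R y (s * t)) has_vector_derivative
      - \<Gamma> (x (s * t)) (s *\<^sub>R y (s * t)) (s *\<^sub>R y (s * t))) (at t)"
    using bounded_linear.has_vector_derivative[OF bounded_linear_scaleR_right
        has_vector_derivative_scale[OF geodesic(3)], of s]
    by (simp add: christoffel_simps[OF geodesic(1)])
qed

definition geodesic_field :: "(real^'n) \<times> (real^'n) \<Rightarrow> (real^'n) \<times> (real^'n)" where
  "geodesic_field z = (snd z, - \<Gamma> (fst z) (snd z) (snd z))"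

lemma open_tangent_domain: "open (U \<times> (UNIV :: (real^'n) set))"
  by (simp add: open_Times openU)

lemma smooth_geodesic_field: "smooth_on (U \<times> UNIV) geodesic_field"
proof -
  note proj = smooth_on_bounded_linear[OF _ open_tangent_domain smooth_on_id[OF open_tangent_domain]]
  have "smooth_on (U \<times> UNIV) (\<lambda>z. (snd z, - \<Gamma> (fst z) (snd z) (snd z)))"
    by (intro smooth_on_Pair smooth_on_minus smooth_christoffel_fields proj bounded_linear_fst bounded_linear_snd
        open_tangent_domain) auto
  then show ?thesis by (simp add: geodesic_field_def[abs_def])
qed

lemma C1_geodesic_field:
  "C1_vector_field geodesic_field (\<lambda>z. Blinfun (dir_deriv geodesic_field z)) (U \<times> UNIV)"
  by (rule smooth_on_C1_vector_field[OF open_tangent_domain smooth_geodesic_field])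

lemma Blinfun_dir_deriv_geodesic_field:
  "z \<in> U \<times> UNIV \<Longrightarrow> blinfun_apply (Blinfun (dir_deriv geodesic_field z)) = dir_deriv geodesic_field z"
  using smooth_on_has_derivative[OF smooth_geodesic_field open_tangent_domain]
  by (intro bounded_linear_Blinfun_apply has_derivative_bounded_linear)

lemma integral_curve_geodesic_field_iff:
  "integral_curve geodesic_field (U \<times> UNIV) I (\<lambda>t. (x t, y t)) \<longleftrightarrow> chart_geodesic U G I x y"
  by (auto simp: integral_curve_def chart_geodesic_def geodesic_field_def has_vector_derivative_Pair_iff)

lemma smooth_on_chart_geodesic:
  assumes "open I" "chart_geodesic U G I x y"
  shows "smooth_on I x" "smooth_on I y"
proof -
  have "smooth_on I (\<lambda>t. (x t, y t))"
    by (rule smooth_on_integral_curve[OF open_tangent_domain smooth_geodesic_field assms(1)])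
       (simp add: integral_curve_geodesic_field_iff assms(2))
  from smooth_on_bounded_linear[OF bounded_linear_fst assms(1) this]
    smooth_on_bounded_linear[OF bounded_linear_snd assms(1) this]
  show "smooth_on I x" "smooth_on I y" by simp_all
qed

lemma chart_geodesics_eq_near:
  assumes I: "open I" "t \<in> I" and xy: "chart_geodesic U G I x y" "chart_geodesic U G I x' y'"
    and eq: "x t = x' t" "y t = y' t"
  shows "\<forall>\<^sub>F s in nhds t. x s = x' s \<and> y s = y' s"
  using C1_vector_field.integral_curves_eq_near[OF C1_geodesic_field I, of "\<lambda>s. (x s, y s)" "\<lambda>s. (x' s, y' s)"]
    xy eq by (simp add: integral_curve_geodesic_field_iff)

lemma chart_geodesics_eq:
  assumes I: "open I" "connected I" and xy: "chart_geodesic U G I x y" "chart_geodesic U G I x' y'"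
    and eq: "t0 \<in> I" "x t0 = x' t0" "y t0 = y' t0" and t: "t \<in> I"
  shows "x t = x' t" "y t = y' t"
  using C1_vector_field.integral_curves_eq[OF C1_geodesic_field I _ _ eq(1) _ t,
      of "\<lambda>s. (x s, y s)" "\<lambda>s. (x' s, y' s)"] xy eq
  by (simp_all add: integral_curve_geodesic_field_iff)

lemma dir_deriv_geodesic_field:
  assumes x: "x \<in> U"
  shows "dir_deriv geodesic_field (x, y) (a, b) = (b, - (d\<Gamma> x a y y + 2 *\<^sub>R \<Gamma> x y b))"
proof (rule dir_deriv_at_line)
  define I where "I = (\<lambda>s::real. x + s *\<^sub>R a) -` U"
  have I: "open I" "0 \<in> I" using x by (auto simp: I_def intro!: open_vimage openU continuous_intros)
  note line = has_vector_derivative_line[of _ _ 0]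
  have "((\<lambda>s. - \<Gamma> (x + s *\<^sub>R a) (y + s *\<^sub>R b) (y + s *\<^sub>R b)) has_vector_derivative
      - (d\<Gamma> x a y y + \<Gamma> x y b + \<Gamma> x b y)) (at 0)"
    using christoffel_along[OF I _ line line line, of x a y b y b] by (auto simp: I_def intro!: derivative_eq_intros)
  from has_vector_derivative_Pair[OF line[of y b] this]
  show "((\<lambda>s. geodesic_field ((x, y) + s *\<^sub>R (a, b))) has_vector_derivative
      (b, - (d\<Gamma> x a y y + 2 *\<^sub>R \<Gamma> x y b))) (at 0)"
    using christoffel_sym[OF x, of b y] by (simp add: geodesic_field_def scaleR_2 add.assoc)
qed

text \<open>The linearized geodesic equation; \<open>b\<close> is the derivative of the components of \<open>a\<close>, not the covariant
  derivative of \<open>a\<close>.\<close>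

definition jacobi_field ::
  "real set \<Rightarrow> (real \<Rightarrow> real^'n) \<Rightarrow> (real \<Rightarrow> real^'n) \<Rightarrow> (real \<Rightarrow> real^'n) \<Rightarrow> (real \<Rightarrow> real^'n) \<Rightarrow> bool" where
  "jacobi_field I x y a b \<longleftrightarrow> (\<forall>t\<in>I. (a has_vector_derivative b t) (at t) \<and>
     (b has_vector_derivative - (d\<Gamma> (x t) (a t) (y t) (y t) + 2 *\<^sub>R \<Gamma> (x t) (y t) (b t))) (at t))"

lemma jacobi_fieldD:
  assumes "jacobi_field I x y a b" "t \<in> I"
  shows "(a has_vector_derivative b t) (at t)"
    "(b has_vector_derivative - (d\<Gamma> (x t) (a t) (y t) (y t) + 2 *\<^sub>R \<Gamma> (x t) (y t) (b t))) (at t)"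
  using assms by (auto simp: jacobi_field_def)

lemma jacobi_field_cong:
  assumes ab: "jacobi_field I x y a b" and J: "J \<subseteq> I"
    and eq: "\<And>t. t \<in> J \<Longrightarrow> x t = x' t" "\<And>t. t \<in> J \<Longrightarrow> y t = y' t"
  shows "jacobi_field J x' y' a b"
  unfolding jacobi_field_def
proof
  fix t assume t: "t \<in> J"
  then have "t \<in> I" using J by blast
  from jacobi_fieldD[OF ab this]
  show "(a has_vector_derivative b t) (at t) \<and>
      (b has_vector_derivative - (d\<Gamma> (x' t) (a t) (y' t) (y' t) + 2 *\<^sub>R \<Gamma> (x' t) (y' t) (b t))) (at t)"
    unfolding eq[OF t] by blast
qed

lemma linearized_geodesic_field_iff_jacobi_field:
  assumes "\<And>t. t \<in> I \<Longrightarrow> x t \<in> U"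
  shows "(\<forall>t\<in>I. ((\<lambda>t. (a t, b t)) has_vector_derivative
      Blinfun (dir_deriv geodesic_field (x t, y t)) (a t, b t)) (at t)) \<longleftrightarrow> jacobi_field I x y a b"
  unfolding jacobi_field_def
  by (intro ball_cong refl)
     (simp add: Blinfun_dir_deriv_geodesic_field dir_deriv_geodesic_field has_vector_derivative_Pair_iff assms)

lemma local_geodesic_flow:
  assumes "x0 \<in> U"
  obtains d e X Y a b where "d > 0" "e > 0"
    "\<And>\<eta>. \<eta> \<in> ball \<xi> e \<Longrightarrow> X \<eta> 0 = x0" "\<And>\<eta>. \<eta> \<in> ball \<xi> e \<Longrightarrow> Y \<eta> 0 = \<eta>"
    "\<And>\<eta>. \<eta> \<in> ball \<xi> e \<Longrightarrow> chart_geodesic U G {-d<..<d} (X \<eta>) (Y \<eta>)"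
    "\<And>u. a u 0 = 0" "\<And>u. b u 0 = u" "\<And>u. jacobi_field {-d<..<d} (X \<xi>) (Y \<xi>) (a u) (b u)"
    "\<And>u t. t \<in> {-d<..<d} \<Longrightarrow> ((\<lambda>\<sigma>. X (\<xi> + \<sigma> *\<^sub>R u) t) has_vector_derivative a u t) (at 0)"
proof -
  interpret C1_vector_field geodesic_field "\<lambda>z. Blinfun (dir_deriv geodesic_field z)" "U \<times> UNIV"
    by (rule C1_geodesic_field)
  have "(x0, \<xi>) \<in> U \<times> UNIV" using assms by simp
  then obtain d e \<Phi> Z where de: "d > 0" "e > 0" and start: "\<And>q. q \<in> ball (x0, \<xi>) e \<Longrightarrow> \<Phi> q 0 = q"
    and curve: "\<And>q. q \<in> ball (x0, \<xi>) e \<Longrightarrow> integral_curve geodesic_field (U \<times> UNIV) {-d<..<d} (\<Phi> q)"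
    and Z: "\<And>u. Z u 0 = u" "\<And>u t. t \<in> {-d<..<d} \<Longrightarrow>
      (Z u has_vector_derivative Blinfun (dir_deriv geodesic_field (\<Phi> (x0, \<xi>) t)) (Z u t)) (at t)"
      "\<And>u t. t \<in> {-d<..<d} \<Longrightarrow> ((\<lambda>\<sigma>. \<Phi> ((x0, \<xi>) + \<sigma> *\<^sub>R u) t) has_vector_derivative Z u t) (at 0)"
    by (rule local_flow) blast
  define X where "X \<eta> t = fst (\<Phi> (x0, \<eta>) t)" for \<eta> t
  define Y where "Y \<eta> t = snd (\<Phi> (x0, \<eta>) t)" for \<eta> t
  define a where "a u t = fst (Z (0, u) t)" for u t
  define b where "b u t = snd (Z (0, u) t)" for u t
  have \<Phi>_eq: "\<Phi> (x0, \<eta>) = (\<lambda>t. (X \<eta> t, Y \<eta> t))" and Z_eq: "Z (0, u) = (\<lambda>t. (a u t, b u t))" for \<eta> u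
    by (simp_all add: X_def Y_def a_def b_def)
  have near: "(x0, \<eta>) \<in> ball (x0, \<xi>) e" if "\<eta> \<in> ball \<xi> e" for \<eta>
    using that by (simp add: dist_prod_def)
  have geodesic: "chart_geodesic U G {-d<..<d} (X \<eta>) (Y \<eta>)" if "\<eta> \<in> ball \<xi> e" for \<eta>
    using curve[OF near[OF that]] by (simp only: \<Phi>_eq integral_curve_geodesic_field_iff)
  have jacobi: "jacobi_field {-d<..<d} (X \<xi>) (Y \<xi>) (a u) (b u)" for u
    using Z(2)[of _ "(0, u)"] chart_geodesicD(1)[OF geodesic] de
    by (intro linearized_geodesic_field_iff_jacobi_field[THEN iffD1]) (auto simp: \<Phi>_eq Z_eq)
  have variation: "((\<lambda>\<sigma>. X (\<xi> + \<sigma> *\<^sub>R u) t) has_vector_derivative a u t) (at 0)" if "t \<in> {-d<..<d}" for u t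
    using bounded_linear.has_vector_derivative[OF bounded_linear_fst Z(3)[OF that, of "(0, u)"]]
    by (simp add: \<Phi>_eq Z_eq)
  show thesis
    by (rule that[OF de _ _ geodesic _ _ jacobi variation])
       (use start[OF near] Z(1)[of "(0, _)"] in \<open>simp_all add: \<Phi>_eq Z_eq\<close>)
qed

end

section \<open>Change of charts and the exponential map\<close>

locale chart_isometry =
  source: chart_metric U1 G1 + target: chart_metric U2 G2
  for U1 :: "(real^'n::finite) set" and G1 and U2 :: "(real^'n) set" and G2 +
  fixes D :: "(real^'n) set" and T :: "real^'n \<Rightarrow> real^'n"
  assumes open_D: "open D" and D_subset: "D \<subseteq> U1"
    and smooth_T: "smooth_on D T" and T_image: "T ` D \<subseteq> U2"
    and isometry: "x \<in> D \<Longrightarrow> ginner G2 (T x) (dir_deriv T x v) (dir_deriv T x w) = ginner G1 x v w"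
begin

lemma linear_dT: "x \<in> D \<Longrightarrow> linear (dir_deriv T x)"
  by (rule smooth_on_linear_dir_deriv[OF smooth_T open_D])

lemma surj_dT:
  assumes x: "x \<in> D"
  shows "surj (dir_deriv T x)"
proof -
  have "a = 0" if "dir_deriv T x a = 0" for a
    using isometry[OF x, of a a] source.posG[of x a] D_subset x that by (fastforce simp: ginner_simps)
  then show ?thesis
    using linear_injective_0[OF linear_dT[OF x]] linear_injective_imp_surjective[OF linear_dT[OF x]] by blast
qed

lemma dg_transformation:
  assumes x: "x \<in> D"
  shows "source.dg x u v w = target.dg (T x) (dir_deriv T x u) (dir_deriv T x v) (dir_deriv T x w)
    + ginner G2 (T x) (dir_deriv2 T x v u) (dir_deriv T x w) + ginner G2 (T x) (dir_deriv T x v) (dir_deriv2 T x w u)"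
proof -
  define I where "I = (\<lambda>s::real. x + s *\<^sub>R u) -` D"
  have I: "open I" "0 \<in> I" using x by (auto simp: I_def intro!: open_vimage open_D continuous_intros)
  have along_line: "((\<lambda>s. h (x + s *\<^sub>R u)) has_vector_derivative dir_deriv h x u) (at 0)"
    if "smooth_on D h" for h :: "real^'n \<Rightarrow> real^'n"
    by (rule has_vector_derivative_chain[OF _ has_vector_derivative_line])
       (use smooth_on_has_derivative[OF that open_D x] in simp)
  have "((\<lambda>s. ginner G2 (T (x + s *\<^sub>R u)) (dir_deriv T (x + s *\<^sub>R u) v) (dir_deriv T (x + s *\<^sub>R u) w))
      has_vector_derivative
      target.dg (T x) (dir_deriv T x u) (dir_deriv T x v) (dir_deriv T x w)
      + ginner G2 (T x) (dir_deriv2 T x v u) (dir_deriv T x w)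
      + ginner G2 (T x) (dir_deriv T x v) (dir_deriv2 T x w u)) (at 0)"
    using target.g_along[of "\<lambda>s. T (x + s *\<^sub>R u)" 0, OF _ along_line[OF smooth_T]
        along_line[OF smooth_on_dir_deriv[OF smooth_T]] along_line[OF smooth_on_dir_deriv[OF smooth_T]]] x T_image
    by auto
  then have "((\<lambda>s. ginner G1 (x + s *\<^sub>R u) v w) has_vector_derivative
      target.dg (T x) (dir_deriv T x u) (dir_deriv T x v) (dir_deriv T x w)
      + ginner G2 (T x) (dir_deriv2 T x v u) (dir_deriv T x w)
      + ginner G2 (T x) (dir_deriv T x v) (dir_deriv2 T x w u)) (at 0)"
    by (rule has_vector_derivative_transform_within_open[OF _ I]) (simp add: I_def isometry)
  then show ?thesis unfolding source.dg_def by (rule dir_deriv_at_line)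
qed

text \<open>Symmetry of the second derivative of \<open>T\<close> makes its unwanted terms cancel in Koszul's formula.\<close>

lemma christoffel_transformation:
  assumes x: "x \<in> D"
  shows "dir_deriv2 T x v v + christoffel G2 (T x) (dir_deriv T x v) (dir_deriv T x v)
     = dir_deriv T x (christoffel G1 x v v)"
proof (rule target.g_nondegenerate)
  let ?L = "dir_deriv T x"
  show Tx: "T x \<in> U2" using T_image x by blast
  have xU: "x \<in> U1" using D_subset x by blast
  have sym: "dir_deriv2 T x v w = dir_deriv2 T x w v" for w
    by (rule dir_deriv_commute[OF open_D smooth_T x])
  fix a
  obtain w where a: "a = ?L w" using surj_dT[OF x] by blast
  have "ginner G2 (T x) (dir_deriv2 T x v v + christoffel G2 (T x) (?L v) (?L v)) a
     = ginner G2 (T x) (dir_deriv2 T x v v) (?L w) + target.dg (T x) (?L v) (?L v) (?L w)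
       - target.dg (T x) (?L w) (?L v) (?L v) / 2"
    by (simp add: a ginner_simps target.g_christoffel[OF Tx])
  also have "\<dots> = ginner G1 x (christoffel G1 x v v) w"
    unfolding source.g_christoffel[OF xU] dg_transformation[OF x]
    using sym[of w] target.symG[OF Tx, of "dir_deriv2 T x v w" "?L v"] by (simp add: field_simps)
  also have "\<dots> = ginner G2 (T x) (?L (christoffel G1 x v v)) a" unfolding a by (rule isometry[OF x, symmetric])
  finally show "ginner G2 (T x) (dir_deriv2 T x v v + christoffel G2 (T x) (?L v) (?L v)) a
     = ginner G2 (T x) (?L (christoffel G1 x v v)) a" .
qed

lemma chart_geodesic_image:
  assumes J: "open J" and xy: "chart_geodesic U1 G1 J x y" and xD: "\<And>t. t \<in> J \<Longrightarrow> x t \<in> D"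
  shows "chart_geodesic U2 G2 J (\<lambda>t. T (x t)) (\<lambda>t. dir_deriv T (x t) (y t))"
  unfolding chart_geodesic_def
proof (intro ballI conjI)
  fix t assume t: "t \<in> J"
  note x' = chart_geodesicD(2)[OF xy t] and y' = chart_geodesicD(3)[OF xy t]
  have along_x: "((\<lambda>s. h (x s)) has_vector_derivative dir_deriv h (x t) (y t)) (at t)"
    if "smooth_on D h" for h :: "real^'n \<Rightarrow> real^'n"
    by (rule has_vector_derivative_chain[OF smooth_on_has_derivative[OF that open_D xD[OF t]] x'])
  show "T (x t) \<in> U2" using T_image xD[OF t] by blast
  show "((\<lambda>t. T (x t)) has_vector_derivative dir_deriv T (x t) (y t)) (at t)"
    by (rule along_x[OF smooth_T])
  have "dir_deriv2 T (x t) (y t) (y t) + dir_deriv T (x t) (- christoffel G1 (x t) (y t) (y t))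
     = - christoffel G2 (T (x t)) (dir_deriv T (x t) (y t)) (dir_deriv T (x t) (y t))"
    using christoffel_transformation[OF xD[OF t], of "y t"]
    by (simp add: linear_neg[OF linear_dT[OF xD[OF t]]] algebra_simps)
  then show "((\<lambda>t. dir_deriv T (x t) (y t)) has_vector_derivative
     - christoffel G2 (T (x t)) (dir_deriv T (x t) (y t)) (dir_deriv T (x t) (y t))) (at t)"
    using has_vector_derivative_linear_family[OF J t linear_dT[OF xD] along_x[OF smooth_on_dir_deriv[OF smooth_T]] y']
    by simp
qed

end

abbreviation cinv :: "('a, 'n::finite) chart \<Rightarrow> real^'n \<Rightarrow> 'a" where
  "cinv c \<equiv> inv_into (cdom c) (cmap c)"

locale riemannian_chart =
  fixes M :: "('a, 'n::finite, 'z) manifold_scheme" and c :: "('a, 'n) chart"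
  assumes riemannian: "riemannian_manifold M" and in_atlas: "c \<in> atlas M"
begin

lemma smooth_manifold: "smooth_manifold M"
  using riemannian by (simp add: riemannian_manifold_def)

lemma openin_cdom: "openin (mtop M) (cdom c)"
  using smooth_manifold in_atlas by (simp add: smooth_manifold_def)

lemma cdom_subset: "cdom c \<subseteq> topspace (mtop M)"
  by (rule openin_subset[OF openin_cdom])

lemma open_cmap_image: "open (cmap c ` cdom c)"
  using smooth_manifold in_atlas by (simp add: smooth_manifold_def)

lemma homeomorphic_map_cmap:
  "homeomorphic_map (subtopology (mtop M) (cdom c)) (top_of_set (cmap c ` cdom c)) (cmap c)"
  using smooth_manifold in_atlas by (simp add: smooth_manifold_def)

lemma inj_on_cmap: "inj_on (cmap c) (cdom c)"
  using homeomorphic_imp_injective_map[OF homeomorphic_map_cmap]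
  by (simp add: inf.absorb2[OF cdom_subset])

lemma cinv_cmap: "p \<in> cdom c \<Longrightarrow> cinv c (cmap c p) = p"
  by (rule inv_into_f_f[OF inj_on_cmap])

lemma continuous_map_cinv: "continuous_map (top_of_set (cmap c ` cdom c)) (mtop M) (cinv c)"
proof -
  obtain f where f: "homeomorphic_maps (subtopology (mtop M) (cdom c)) (top_of_set (cmap c ` cdom c)) (cmap c) f"
    using homeomorphic_map_cmap homeomorphic_map_maps by blast
  have "f y = cinv c y" if "y \<in> cmap c ` cdom c" for y
    using f that cinv_cmap cdom_subset by (auto simp: homeomorphic_maps_def topspace_subtopology_subset)
  moreover have "continuous_map (top_of_set (cmap c ` cdom c)) (mtop M) f"
    using f continuous_map_into_fulltopology unfolding homeomorphic_maps_def by blast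
  ultimately show ?thesis by (auto intro: continuous_map_eq)
qed

lemma open_cmap_image_openin:
  assumes "openin (mtop M) S" "S \<subseteq> cdom c"
  shows "open (cmap c ` S)"
proof -
  have "openin (subtopology (mtop M) (cdom c)) S" using assms by (simp add: openin_open_subtopology openin_cdom)
  then have "openin (top_of_set (cmap c ` cdom c)) (cmap c ` S)"
    using homeomorphic_imp_open_map[OF homeomorphic_map_cmap] unfolding open_map_def by blast
  then show ?thesis using open_cmap_image openin_open_trans by blast
qed

end

sublocale riemannian_chart \<subseteq> chart_metric "cmap c ` cdom c" "gmat M c"
  using riemannian in_atlas open_cmap_image
  by unfold_locales (auto simp: riemannian_manifold_def)

lemma transition_chart_isometry:
  assumes "riemannian_manifold M" "c \<in> atlas M" "d \<in> atlas M"
  shows "chart_isometry (cmap c ` cdom c) (gmat M c) (cmap d ` cdom d) (gmat M d)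
    (cmap c ` (cdom c \<inter> cdom d)) (transition c d)"
proof -
  interpret c: riemannian_chart M c by unfold_locales (rule assms)+
  interpret d: riemannian_chart M d by unfold_locales (rule assms)+
  have T: "transition c d (cmap c p) = cmap d p" if "p \<in> cdom c" for p
    using c.cinv_cmap[OF that] by (simp add: transition_def)
  show ?thesis
  proof unfold_locales
    show "open (cmap c ` (cdom c \<inter> cdom d))"
      by (rule c.open_cmap_image_openin) (auto intro: c.openin_cdom d.openin_cdom)
    show "smooth_on (cmap c ` (cdom c \<inter> cdom d)) (transition c d)"
      using c.smooth_manifold assms(2,3) by (simp add: smooth_manifold_def)
    show "ginner (gmat M d) (transition c d x) (dir_deriv (transition c d) x v) (dir_deriv (transition c d) x w)
        = ginner (gmat M c) x v w" if x: "x \<in> cmap c ` (cdom c \<inter> cdom d)" for x v w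
    proof -
      obtain p where p: "p \<in> cdom c \<inter> cdom d" "x = cmap c p" using x by blast
      then have "ginner (gmat M d) (cmap d p)
            (dir_deriv (transition c d) (cmap c p) v) (dir_deriv (transition c d) (cmap c p) w)
          = ginner (gmat M c) (cmap c p) v w"
        using assms unfolding riemannian_manifold_def by blast
      then show ?thesis using p T by simp
    qed
  qed (use T in auto)
qed

lemma open_preimage_continuous_map:
  assumes "continuous_map (top_of_set I) X f" "open I" "openin X S"
  shows "open {t \<in> I. f t \<in> S}"
  using openin_continuous_map_preimage[OF assms(1,3)] assms(2) openin_open_trans by auto

context riemannian_chart
begin

lemma geodesic_on_chart_geodesic:
  assumes I: "open I" "is_interval I" and xy: "chart_geodesic (cmap c ` cdom c) (gmat M c) I x y"
  shows "geodesic_on M I (\<lambda>t. cinv c (x t))"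
  unfolding geodesic_on_def
proof (intro conjI ballI I)
  let ?\<gamma> = "\<lambda>t. cinv c (x t)"
  note xU = chart_geodesicD(1)[OF xy]
  have "continuous_on I x" by (rule smooth_on_imp_continuous_on[OF smooth_on_chart_geodesic(1)[OF I(1) xy]])
  then have "continuous_map (top_of_set I) (top_of_set (cmap c ` cdom c)) x"
    using xU by (auto simp: continuous_map_in_subtopology)
  then show continuous: "continuous_map (top_of_set I) (mtop M) ?\<gamma>"
    using continuous_map_compose[OF _ continuous_map_cinv] unfolding o_def by blast
  fix d assume d: "d \<in> atlas M"
  interpret d: riemannian_chart M d by unfold_locales (rule riemannian d)+
  interpret transition: chart_isometry "cmap c ` cdom c" "gmat M c" "cmap d ` cdom d" "gmat M d"
    "cmap c ` (cdom c \<inter> cdom d)" "transition c d"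
    by (rule transition_chart_isometry[OF riemannian in_atlas d])
  define J where "J = {t \<in> I. ?\<gamma> t \<in> cdom d}"
  have J: "open J" unfolding J_def by (rule open_preimage_continuous_map[OF continuous I(1) d.openin_cdom])
  have x_domain: "x t \<in> cmap c ` (cdom c \<inter> cdom d)" if "t \<in> J" for t
    using xU[of t] that by (force simp: J_def cinv_cmap)
  have "chart_geodesic (cmap c ` cdom c) (gmat M c) J x y"
    by (rule chart_geodesic_subset[OF xy]) (auto simp: J_def)
  from transition.chart_geodesic_image[OF J this x_domain]
  show "\<exists>v. \<forall>t\<in>I. ?\<gamma> t \<in> cdom d \<longrightarrow>
       ((cmap d \<circ> ?\<gamma>) has_vector_derivative v t) (at t) \<and>
       (v has_vector_derivative - christoffel (gmat M d) (cmap d (?\<gamma> t)) (v t) (v t)) (at t)"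
    by (intro exI[of _ "\<lambda>t. dir_deriv (transition c d) (x t) (y t)"])
       (auto simp: chart_geodesic_def J_def transition_def o_def)
qed

lemma geodesic_on_obtain_chart_geodesic:
  assumes "geodesic_on M J \<beta>"
  obtains v where "chart_geodesic (cmap c ` cdom c) (gmat M c) {t \<in> J. \<beta> t \<in> cdom c} (cmap c \<circ> \<beta>) v"
proof -
  obtain v where "\<forall>t\<in>J. \<beta> t \<in> cdom c \<longrightarrow> ((cmap c \<circ> \<beta>) has_vector_derivative v t) (at t) \<and>
      (v has_vector_derivative - christoffel (gmat M c) (cmap c (\<beta> t)) (v t) (v t)) (at t)"
    using assms in_atlas unfolding geodesic_on_def by blast
  then show thesis by (intro that[of v]) (auto simp: chart_geodesic_def)
qed

lemma geodesic_on_eq_near: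
  assumes I: "open I" "t \<in> I" and xy: "chart_geodesic (cmap c ` cdom c) (gmat M c) I x y"
    and \<beta>: "geodesic_on M J \<beta>" "t \<in> J"
    and v: "chart_geodesic (cmap c ` cdom c) (gmat M c) {t \<in> J. \<beta> t \<in> cdom c} (cmap c \<circ> \<beta>) v"
    and eq: "\<beta> t = cinv c (x t)" "v t = y t"
  shows "\<forall>\<^sub>F s in nhds t. \<beta> s = cinv c (x s) \<and> v s = y s"
proof -
  let ?I = "I \<inter> {t \<in> J. \<beta> t \<in> cdom c}"
  have "open J" "continuous_map (top_of_set J) (mtop M) \<beta>" using \<beta>(1) by (auto simp: geodesic_on_def)
  then have open_I: "open ?I" using open_preimage_continuous_map[OF _ _ openin_cdom] I(1) by blast
  have t: "t \<in> ?I" and xt: "cmap c (\<beta> t) = x t"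
    using chart_geodesicD(1)[OF xy I(2)] I(2) \<beta>(2) by (auto simp: eq inv_into_into f_inv_into_f)
  have "\<forall>\<^sub>F s in nhds t. (cmap c \<circ> \<beta>) s = x s \<and> v s = y s"
    by (rule chart_geodesics_eq_near[OF open_I t chart_geodesic_subset[OF v] chart_geodesic_subset[OF xy]])
       (use xt eq in auto)
  then show ?thesis
    using eventually_nhds_in_open[OF open_I t] by eventually_elim (auto dest!: cinv_cmap)
qed

lemma geodesic_unique:
  assumes I: "open I" "is_interval I" and xy: "chart_geodesic (cmap c ` cdom c) (gmat M c) I x y"
    and \<beta>: "geodesic_on M J \<beta>" and K: "connected K" "K \<subseteq> I" "K \<subseteq> J" "t0 \<in> K" "t \<in> K"
    and start: "\<beta> t0 = cinv c (x t0)" "((cmap c \<circ> \<beta>) has_vector_derivative y t0) (at t0)"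
  shows "\<beta> t = cinv c (x t)"
proof -
  obtain v where v: "chart_geodesic (cmap c ` cdom c) (gmat M c) {t \<in> J. \<beta> t \<in> cdom c} (cmap c \<circ> \<beta>) v"
    by (rule geodesic_on_obtain_chart_geodesic[OF \<beta>])
  define E where "E = {t \<in> K. \<beta> t = cinv c (x t)}"
  define S where "S = {t \<in> E. v t - y t = 0}"
  have E: "t \<in> I" "t \<in> {t \<in> J. \<beta> t \<in> cdom c}" if "t \<in> E" for t
    using that K(2,3) chart_geodesicD(1)[OF xy, of t] by (auto simp: E_def inv_into_into)
  have "continuous_map (top_of_set J) (mtop M) \<beta>" "continuous_map (top_of_set I) (mtop M) (\<lambda>t. cinv c (x t))"
    using \<beta> geodesic_on_chart_geodesic[OF I xy] unfolding geodesic_on_def by blast+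
  then have "closedin (top_of_set K) {t \<in> topspace (top_of_set K). \<beta> t = cinv c (x t)}"
    using smooth_manifold continuous_map_from_subtopology_mono K(2,3)
    by (intro closedin_continuous_maps_eq[of "mtop M"]) (simp add: smooth_manifold_def, blast+)
  then have "closedin (top_of_set K) E" by (simp add: E_def)
  moreover have "continuous_on E v"
    by (rule continuous_on_vector_derivative[OF has_vector_derivative_at_within[OF chart_geodesicD(3)[OF v E(2)]]])
  then have "continuous_on E (\<lambda>t. v t - y t)"
    by (intro continuous_on_diff
        continuous_on_vector_derivative[OF has_vector_derivative_at_within[OF chart_geodesicD(3)[OF xy E(1)]]])
  then have "closedin (top_of_set E) S"
    unfolding S_def by (rule continuous_closedin_preimage_constant)
  ultimately have "closedin (top_of_set K) S" using closedin_trans by blast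
  moreover have "openin (top_of_set K) S"
    unfolding openin_subopen[of _ S]
  proof
    fix t assume t: "t \<in> S"
    then have "\<forall>\<^sub>F s in nhds t. \<beta> s = cinv c (x s) \<and> v s = y s"
      using E[of t] by (intro geodesic_on_eq_near[OF I(1) _ xy \<beta> _ v]) (auto simp: S_def E_def)
    then obtain W where "open W" "t \<in> W" "\<forall>s\<in>W. \<beta> s = cinv c (x s) \<and> v s = y s"
      unfolding eventually_nhds by blast
    then show "\<exists>V. openin (top_of_set K) V \<and> t \<in> V \<and> V \<subseteq> S"
      using t by (intro exI[of _ "K \<inter> W"]) (auto simp: openin_open S_def E_def)
  qed
  ultimately have "S = {} \<or> S = K" using K(1) unfolding connected_clopen by blast
  moreover have "t0 \<in> E" using K(4) start(1) by (simp add: E_def)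
  moreover have "v t0 = y t0"
    by (rule vector_derivative_unique_at[OF chart_geodesicD(2)[OF v E(2)[OF \<open>t0 \<in> E\<close>]] start(2)])
  ultimately show ?thesis using K(5) by (auto simp: S_def E_def)
qed

lemma exp_map_chart_geodesic_unit_time:
  assumes I: "open I" "is_interval I" "{0..1} \<subseteq> I"
    and xy: "chart_geodesic (cmap c ` cdom c) (gmat M c) I x y" and Q: "Q \<in> cdom c" "x 0 = cmap c Q"
  shows "exp_map M c Q (y 0) = cinv c (x 1)"
  unfolding exp_map_def
proof (rule the_equality)
  have Q0: "cinv c (x 0) = Q" by (simp add: Q cinv_cmap)
  have "0 \<in> I" using I(3) by auto
  then have "((cmap c \<circ> (\<lambda>t. cinv c (x t))) has_vector_derivative y 0) (at 0)"
    using has_vector_derivative_transform_within_open[OF chart_geodesicD(2)[OF xy] I(1)] chart_geodesicD(1)[OF xy]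
    by (simp add: f_inv_into_f)
  then show "\<exists>I' \<gamma>. geodesic_on M I' \<gamma> \<and> {0..1} \<subseteq> I' \<and> \<gamma> 0 = Q \<and>
       ((cmap c \<circ> \<gamma>) has_vector_derivative y 0) (at 0) \<and> cinv c (x 1) = \<gamma> 1"
    using geodesic_on_chart_geodesic[OF I(1,2) xy] I(3) Q0 by blast
  fix q assume "\<exists>J \<beta>. geodesic_on M J \<beta> \<and> {0..1} \<subseteq> J \<and> \<beta> 0 = Q \<and>
       ((cmap c \<circ> \<beta>) has_vector_derivative y 0) (at 0) \<and> q = \<beta> 1"
  then obtain J \<beta> where "geodesic_on M J \<beta>" "{0..1} \<subseteq> J" "\<beta> 0 = Q"
    "((cmap c \<circ> \<beta>) has_vector_derivative y 0) (at 0)" "q = \<beta> 1" by blast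
  then show "q = cinv c (x 1)"
    using geodesic_unique[OF I(1,2) xy, of J \<beta> "{0..1}" 0 1] I(3) Q0 by simp
qed

lemma exp_map_chart_geodesic:
  assumes "chart_geodesic (cmap c ` cdom c) (gmat M c) {-d<..<d} x y" "Q \<in> cdom c" "x 0 = cmap c Q" "s \<in> {-d<..<d}"
  shows "exp_map M c Q (s *\<^sub>R y 0) = cinv c (x s)"
proof -
  have "open ((*) s -` {-d<..<d})" by (intro open_vimage continuous_intros open_greaterThanLessThan)
  moreover have "convex ((*) s -` {-d<..<d})"
    by (intro convex_linear_vimage bounded_linear.linear bounded_linear_mult_right convex_real_interval)
  moreover have "{0..1} \<subseteq> (*) s -` {-d<..<d}"
    using convex_scale_mem[of "{-d<..<d}" s] assms(4) by (auto simp: mult.commute)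
  ultimately have "exp_map M c Q (s *\<^sub>R y (s * 0)) = cinv c (x (s * 1))"
    using chart_geodesic_scale[OF assms(1)] assms(2,3)
    by (intro exp_map_chart_geodesic_unit_time) (simp_all add: is_interval_convex_1)
  then show ?thesis by simp
qed

lemma cmap_exp_map_chart_geodesic:
  assumes "chart_geodesic (cmap c ` cdom c) (gmat M c) {-d<..<d} x y" "Q \<in> cdom c" "x 0 = cmap c Q" "s \<in> {-d<..<d}"
  shows "cmap c (exp_map M c Q (s *\<^sub>R y 0)) = x s"
  using exp_map_chart_geodesic[OF assms] chart_geodesicD(1)[OF assms(1,4)] by (simp add: f_inv_into_f)

lemma dir_deriv_exp_map_0:
  assumes Q: "Q \<in> cdom c"
  shows "dir_deriv (cmap c \<circ> exp_map M c Q) 0 u = u"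
proof -
  obtain d e X Y where d: "d > (0::real)" "e > (0::real)"
    and start: "\<And>\<eta>. \<eta> \<in> ball u e \<Longrightarrow> X \<eta> 0 = cmap c Q" "\<And>\<eta>. \<eta> \<in> ball u e \<Longrightarrow> Y \<eta> 0 = \<eta>"
    and geodesic: "\<And>\<eta>. \<eta> \<in> ball u e \<Longrightarrow> chart_geodesic (cmap c ` cdom c) (gmat M c) {-d<..<d} (X \<eta>) (Y \<eta>)"
    by (rule local_geodesic_flow[OF imageI[OF Q, of "cmap c"], of u]) blast
  have u: "u \<in> ball u e" and zero: "0 \<in> {-d<..<d}" using d by auto
  have X': "(X u has_vector_derivative u) (at 0)"
    using chart_geodesicD(2)[OF geodesic[OF u] zero] start(2)[OF u] by simp
  have X_eq: "X u s = (cmap c \<circ> exp_map M c Q) (0 + s *\<^sub>R u)" if "s \<in> {-d<..<d}" for s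
    using cmap_exp_map_chart_geodesic[OF geodesic[OF u] Q start(1)[OF u] that] start(2)[OF u] by simp
  show ?thesis
    by (rule dir_deriv_at_line)
       (rule has_vector_derivative_transform_within_open[OF X' open_greaterThanLessThan zero X_eq])
qed

lemma dir_deriv_exp_map_variation:
  assumes Q: "Q \<in> cdom c" and "e > 0"
    and start: "\<And>\<eta>. \<eta> \<in> ball \<xi> e \<Longrightarrow> X \<eta> 0 = cmap c Q" "\<And>\<eta>. \<eta> \<in> ball \<xi> e \<Longrightarrow> Y \<eta> 0 = \<eta>"
    and geodesic: "\<And>\<eta>. \<eta> \<in> ball \<xi> e \<Longrightarrow> chart_geodesic (cmap c ` cdom c) (gmat M c) {-d<..<d} (X \<eta>) (Y \<eta>)"
    and s: "s \<in> {-d<..<d}" "s \<noteq> 0"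
    and variation: "((\<lambda>\<sigma>. X (\<xi> + \<sigma> *\<^sub>R u) s) has_vector_derivative a) (at 0)"
  shows "s *\<^sub>R dir_deriv (cmap c \<circ> exp_map M c Q) (s *\<^sub>R \<xi>) u = a"
proof -
  have "((\<lambda>\<tau>. X (\<xi> + ((1/s) * \<tau>) *\<^sub>R u) s) has_vector_derivative (1/s) *\<^sub>R a) (at 0)"
    using has_vector_derivative_scale[of "\<lambda>\<sigma>. X (\<xi> + \<sigma> *\<^sub>R u) s" a "1/s" 0] variation by simp
  then have "((\<lambda>\<tau>. (cmap c \<circ> exp_map M c Q) (s *\<^sub>R \<xi> + \<tau> *\<^sub>R u)) has_vector_derivative (1/s) *\<^sub>R a) (at 0)"
  proof (rule has_vector_derivative_transform_within_open[where S="{\<tau>. \<xi> + ((1/s) * \<tau>) *\<^sub>R u \<in> ball \<xi> e}"])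
    show "open {\<tau>. \<xi> + ((1/s) * \<tau>) *\<^sub>R u \<in> ball \<xi> e}"
      unfolding mem_ball by (intro open_Collect_less continuous_intros)
    fix \<tau> assume "\<tau> \<in> {\<tau>. \<xi> + ((1/s) * \<tau>) *\<^sub>R u \<in> ball \<xi> e}"
    then have near: "\<xi> + ((1/s) * \<tau>) *\<^sub>R u \<in> ball \<xi> e" by simp
    have "s *\<^sub>R (\<xi> + ((1/s) * \<tau>) *\<^sub>R u) = s *\<^sub>R \<xi> + \<tau> *\<^sub>R u" using s(2) by (simp add: scaleR_add_right)
    then show "X (\<xi> + ((1/s) * \<tau>) *\<^sub>R u) s = (cmap c \<circ> exp_map M c Q) (s *\<^sub>R \<xi> + \<tau> *\<^sub>R u)"
      using cmap_exp_map_chart_geodesic[OF geodesic[OF near] Q start(1)[OF near] s(1)] start(2)[OF near] by simp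
  qed (use \<open>e > 0\<close> in simp)
  then show ?thesis using s(2) by (simp add: dir_deriv_at_line)
qed

lemma dir_deriv_exp_map_jacobi_field:
  assumes xy: "chart_geodesic (cmap c ` cdom c) (gmat M c) {-d<..<d} x y" and "d > 0"
    and Q: "Q \<in> cdom c" "x 0 = cmap c Q"
  obtains \<delta> a b where "0 < \<delta>" "\<delta> \<le> d" "\<And>u. a u 0 = 0" "\<And>u. b u 0 = u"
    "\<And>u. jacobi_field {-\<delta><..<\<delta>} x y (a u) (b u)"
    "\<And>s u. s \<in> {-\<delta><..<\<delta>} \<Longrightarrow> s *\<^sub>R dir_deriv (cmap c \<circ> exp_map M c Q) (s *\<^sub>R y 0) u = a u s"
proof -
  obtain d' e X Y a b where d': "d' > 0" and e: "e > 0"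
    and start: "\<And>\<eta>. \<eta> \<in> ball (y 0) e \<Longrightarrow> X \<eta> 0 = cmap c Q" "\<And>\<eta>. \<eta> \<in> ball (y 0) e \<Longrightarrow> Y \<eta> 0 = \<eta>"
    and geodesic: "\<And>\<eta>. \<eta> \<in> ball (y 0) e \<Longrightarrow> chart_geodesic (cmap c ` cdom c) (gmat M c) {-d'<..<d'} (X \<eta>) (Y \<eta>)"
    and ab: "\<And>u. a u 0 = 0" "\<And>u. b u 0 = u"
    and jacobi: "\<And>u. jacobi_field {-d'<..<d'} (X (y 0)) (Y (y 0)) (a u) (b u)"
    and variation: "\<And>u t. t \<in> {-d'<..<d'} \<Longrightarrow> ((\<lambda>\<sigma>. X (y 0 + \<sigma> *\<^sub>R u) t) has_vector_derivative a u t) (at 0)"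
    by (rule local_geodesic_flow[OF imageI[OF Q(1), of "cmap c"], of "y 0"]) blast
  define \<delta> where "\<delta> = min d d'"
  have \<delta>: "\<delta> > 0" "\<delta> \<le> d" "\<delta> \<le> d'" using \<open>d > 0\<close> d' by (auto simp: \<delta>_def)
  have y0: "y 0 \<in> ball (y 0) e" using e by simp
  have agree: "X (y 0) t = x t" "Y (y 0) t = y t" if "t \<in> {-\<delta><..<\<delta>}" for t
    by (rule chart_geodesics_eq[OF open_greaterThanLessThan connected_Ioo chart_geodesic_subset[OF geodesic[OF y0]]
          chart_geodesic_subset[OF xy] _ _ _ that, of 0]; use \<delta> start[OF y0] Q(2) in auto)+
  have "jacobi_field {-\<delta><..<\<delta>} x y (a u) (b u)" for u
    by (rule jacobi_field_cong[OF jacobi _ agree]) (use \<delta>(3) in auto)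
  moreover have "s *\<^sub>R dir_deriv (cmap c \<circ> exp_map M c Q) (s *\<^sub>R y 0) u = a u s" if "s \<in> {-\<delta><..<\<delta>}" for s u
  proof (cases "s = 0")
    case False
    have "s \<in> {-d'<..<d'}" using that \<delta>(3) by auto
    then show ?thesis by (intro dir_deriv_exp_map_variation[OF Q(1) e start geodesic _ False] variation)
  qed (simp add: ab)
  ultimately show thesis by (rule that[of \<delta> a b, OF \<delta>(1,2) ab])
qed

end

section \<open>Jacobi fields in a parallel frame\<close>

locale framed_geodesic = chart_metric U G for U :: "(real^'n::finite) set" and G +
  fixes d :: real and x y :: "real \<Rightarrow> real^'n" and E :: "real \<Rightarrow> real^'n^'n"
  assumes d_pos: "d > 0" and geodesic: "chart_geodesic U G {-d<..<d} x y"
    and parallel: "t \<in> {-d<..<d} \<Longrightarrow> (E has_vector_derivative - (matrix (\<Gamma> (x t) (y t)) ** E t)) (at t)"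
    and det_E_0: "det (E 0) \<noteq> 0"
begin

abbreviation "I \<equiv> {-d<..<d}"

lemmas xU = chart_geodesicD(1)[OF geodesic]
  and x' = chart_geodesicD(2)[OF geodesic]
  and y' = chart_geodesicD(3)[OF geodesic]

lemma zero_in_I: "0 \<in> I"
  using d_pos by simp

lemma x_image: "x ` I \<subseteq> U"
  using xU by blast

lemmas smooth_x = smooth_on_chart_geodesic(1)[OF open_greaterThanLessThan geodesic]
  and smooth_y = smooth_on_chart_geodesic(2)[OF open_greaterThanLessThan geodesic]

lemma smooth_connection: "smooth_on I (\<lambda>t. matrix (\<Gamma> (x t) (y t)))"
  by (intro smooth_on_matrix smooth_christoffel_fields x_image smooth_x smooth_y smooth_on_const
      open_greaterThanLessThan)

lemma smooth_E: "smooth_on I E"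
proof (rule smooth_on_bootstrap[OF open_greaterThanLessThan parallel])
  fix k assume "Ck_on k I E"
  with smooth_connection show "Ck_on k I (\<lambda>t. - (matrix (\<Gamma> (x t) (y t)) ** E t))"
    by (intro Ck_on_bounded_linear[OF bounded_linear_minus[OF bounded_linear_ident]]
        Ck_on_bilinear[OF bounded_bilinear_matrix_mult]) (auto simp: smooth_on_def)
qed

lemma parallel_vector:
  assumes t: "t \<in> I"
  shows "((\<lambda>s. E s *v v) has_vector_derivative - \<Gamma> (x t) (y t) (E t *v v)) (at t)"
proof -
  have "((\<lambda>s. E s *v v) has_vector_derivative - (matrix (\<Gamma> (x t) (y t)) ** E t) *v v) (at t)"
    by (rule bounded_linear.has_vector_derivative[OF
          bounded_bilinear.bounded_linear_left[OF bounded_bilinear_matrix_vector_mult] parallel[OF t]])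
  then show ?thesis
    by (simp add: bounded_bilinear.minus_left[OF bounded_bilinear_matrix_vector_mult]
        matrix_vector_mul_assoc[symmetric] matrix_vector_mult_matrix[OF christoffel_linear_right[OF xU[OF t]]])
qed

lemma g_frame:
  assumes t: "t \<in> I"
  shows "g (x t) (E t *v v) (E t *v w) = g (x 0) (E 0 *v v) (E 0 *v w)"
proof -
  have "((\<lambda>s. g (x s) (E s *v v) (E s *v w)) has_vector_derivative 0) (at s)" if s: "s \<in> I" for s
    using g_along[OF xU[OF s] x'[OF s] parallel_vector[OF s] parallel_vector[OF s], of v w]
      metric_compatible[OF xU[OF s], of "y s" "E s *v v" "E s *v w"]
    by (simp add: ginner_simps)
  then obtain k where "\<And>s. s \<in> I \<Longrightarrow> g (x s) (E s *v v) (E s *v w) = k"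
    using has_vector_derivative_zero_constant[OF convex_real_interval(8) has_vector_derivative_at_within] by blast
  then show ?thesis using t zero_in_I by simp
qed

lemma det_E_nonzero:
  assumes t: "t \<in> I"
  shows "det (E t) \<noteq> 0"
  unfolding det_nonzero_iff_ker
proof (intro allI impI)
  fix v assume "E t *v v = 0"
  then have "g (x 0) (E 0 *v v) (E 0 *v v) = 0" using g_frame[OF t, of v v] by (simp add: ginner_simps)
  then have "E 0 *v v = 0" using posG[OF xU[OF zero_in_I], of "E 0 *v v"] by fastforce
  then show "v = 0" using det_E_0 unfolding det_nonzero_iff_ker by blast
qed

lemma det_G_frame:
  assumes t: "t \<in> I"
  shows "det (G (x t)) * (det (E t))\<^sup>2 = det (G (x 0)) * (det (E 0))\<^sup>2"
proof -
  have "v \<bullet> ((transpose (E s) ** G (x s) ** E s) *v w) = g (x s) (E s *v v) (E s *v w)" for s v w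
    using dot_lmul_matrix[of v "transpose (E s)" "G (x s) *v (E s *v w)"]
    by (simp add: ginner_def matrix_vector_mul_assoc[symmetric])
  then have "(transpose (E t) ** G (x t) ** E t) *v w = (transpose (E 0) ** G (x 0) ** E 0) *v w" for w
    by (intro vector_eq_ldot[THEN iffD1]) (simp add: g_frame[OF t])
  then have "transpose (E t) ** G (x t) ** E t = transpose (E 0) ** G (x 0) ** E 0"
    by (simp add: matrix_eq)
  then have "det (transpose (E t) ** G (x t) ** E t) = det (transpose (E 0) ** G (x 0) ** E 0)" by simp
  then show ?thesis by (simp add: det_mul power2_eq_square mult_ac)
qed

definition F :: "real \<Rightarrow> real^'n^'n" where
  "F t = matrix_inv (E t)"

lemma EF: "t \<in> I \<Longrightarrow> E t ** F t = mat 1" and FE: "t \<in> I \<Longrightarrow> F t ** E t = mat 1"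
  using matrix_inv_mult[OF det_E_nonzero] by (simp_all add: F_def)

lemma smooth_F: "smooth_on I F"
  unfolding F_def by (rule smooth_on_matrix_inv[OF open_greaterThanLessThan smooth_E det_E_nonzero])

lemma F':
  assumes t: "t \<in> I"
  shows "(F has_vector_derivative F t ** matrix (\<Gamma> (x t) (y t))) (at t)"
  using matrix_inv_derivative[OF open_greaterThanLessThan t smooth_E det_E_nonzero parallel[OF t]]
  by (simp add: F_def[abs_def] matrix_mult_linear_simps matrix_mul_assoc[symmetric] matrix_inv_mult det_E_nonzero[OF t])

definition R :: "real \<Rightarrow> real^'n^'n" where
  "R t = F t ** matrix (\<lambda>v. curvature (x t) v (y t) (y t)) ** E t"

lemma smooth_R: "smooth_on I R"
  unfolding R_def
  by (intro smooth_on_matrix_mult smooth_E smooth_F smooth_on_matrix smooth_curvature_fields x_image smooth_x smooth_y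
      open_greaterThanLessThan)

lemma frame_R:
  assumes t: "t \<in> I"
  shows "E t *v (R t *v v) = curvature (x t) (E t *v v) (y t) (y t)"
proof -
  have "E t *v (R t *v v) = (E t ** F t) *v (matrix (\<lambda>v. curvature (x t) v (y t) (y t)) *v (E t *v v))"
    by (simp add: R_def matrix_vector_mul_assoc matrix_mul_assoc)
  then show ?thesis
    by (simp add: EF[OF t] matrix_vector_mult_matrix[OF curvature_linear(1)[OF xU[OF t]]])
qed

lemma frame_shift:
  assumes "t0 \<in> I"
  shows "framed_geodesic U G (d - \<bar>t0\<bar>) (\<lambda>s. x (t0 + s)) (\<lambda>s. y (t0 + s)) (\<lambda>s. E (t0 + s))"
proof unfold_locales
  have shift: "t0 + s \<in> I" if "s \<in> {-(d - \<bar>t0\<bar>)<..<d - \<bar>t0\<bar>}" for s using that by auto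
  show "chart_geodesic U G {-(d - \<bar>t0\<bar>)<..<d - \<bar>t0\<bar>} (\<lambda>s. x (t0 + s)) (\<lambda>s. y (t0 + s))"
    by (rule chart_geodesic_shift[OF geodesic shift])
  show "((\<lambda>s. E (t0 + s)) has_vector_derivative - (matrix (\<Gamma> (x (t0 + t)) (y (t0 + t))) ** E (t0 + t))) (at t)"
    if "t \<in> {-(d - \<bar>t0\<bar>)<..<d - \<bar>t0\<bar>}" for t
    using parallel[OF shift[OF that]] by (simp add: has_vector_derivative_shift_iff)
qed (use assms det_E_nonzero in auto)

lemma jacobi_field_frame:
  assumes ab: "jacobi_field J x y a b" and s: "s \<in> J" "s \<in> I"
  shows "((\<lambda>s. F s *v a s) has_vector_derivative F s *v (b s + \<Gamma> (x s) (y s) (a s))) (at s)"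
    and "((\<lambda>s. F s *v (b s + \<Gamma> (x s) (y s) (a s))) has_vector_derivative - (R s *v (F s *v a s))) (at s)"
proof -
  let ?x = "x s" and ?y = "y s"
  note a' = jacobi_fieldD(1)[OF ab s(1)] and b' = jacobi_fieldD(2)[OF ab s(1)] and xs = xU[OF s(2)]
  note mult = has_vector_derivative_matrix_vector_mult[OF F'[OF s(2)]]
  have connection: "(F s ** matrix (\<Gamma> ?x ?y)) *v v = F s *v \<Gamma> ?x ?y v" for v
    by (simp add: matrix_vector_mul_assoc[symmetric] matrix_vector_mult_matrix[OF christoffel_linear_right[OF xs]])
  show "((\<lambda>s. F s *v a s) has_vector_derivative F s *v (b s + \<Gamma> ?x ?y (a s))) (at s)"
    using mult[OF a'] by (simp add: connection matrix_vector_right_distrib)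
  have \<Gamma>': "((\<lambda>s. \<Gamma> (x s) (y s) (a s)) has_vector_derivative
      d\<Gamma> ?x ?y ?y (a s) + \<Gamma> ?x ?y (b s) + \<Gamma> ?x (- \<Gamma> ?x ?y ?y) (a s)) (at s)"
    by (rule christoffel_along[OF open_greaterThanLessThan s(2) xU x'[OF s(2)] y'[OF s(2)] a'])
  have "- (d\<Gamma> ?x (a s) ?y ?y + 2 *\<^sub>R \<Gamma> ?x ?y (b s)) + (d\<Gamma> ?x ?y ?y (a s) + \<Gamma> ?x ?y (b s) + \<Gamma> ?x (- \<Gamma> ?x ?y ?y) (a s))
      + \<Gamma> ?x ?y (b s + \<Gamma> ?x ?y (a s)) = - curvature ?x (a s) ?y ?y"
    using christoffel_sym[OF xs, of "\<Gamma> ?x ?y ?y" "a s"] christoffel_sym[OF xs, of "a s" ?y]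
      dchristoffel_sym[OF xs, of ?y "a s" ?y]
    by (simp add: christoffel_simps[OF xs] curvature_def scaleR_2)
  also have "curvature ?x (a s) ?y ?y = E s *v (R s *v (F s *v a s))"
    unfolding frame_R[OF s(2)] by (simp add: matrix_vector_mul_assoc EF[OF s(2)])
  finally have "F s *v (- (d\<Gamma> ?x (a s) ?y ?y + 2 *\<^sub>R \<Gamma> ?x ?y (b s))
        + (d\<Gamma> ?x ?y ?y (a s) + \<Gamma> ?x ?y (b s) + \<Gamma> ?x (- \<Gamma> ?x ?y ?y) (a s)))
      + F s *v \<Gamma> ?x ?y (b s + \<Gamma> ?x ?y (a s)) = F s *v (- (E s *v (R s *v (F s *v a s))))"
    by (simp only: matrix_vector_right_distrib[symmetric])
  also have "\<dots> = - (R s *v (F s *v a s))"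
    by (simp only: bounded_bilinear.minus_right[OF bounded_bilinear_matrix_vector_mult] matrix_vector_mul_assoc
        matrix_mul_assoc FE[OF s(2)] matrix_mul_lid)
  finally show "((\<lambda>s. F s *v (b s + \<Gamma> (x s) (y s) (a s))) has_vector_derivative - (R s *v (F s *v a s))) (at s)"
    using mult[OF has_vector_derivative_add[OF b' \<Gamma>']] by (simp only: connection)
qed

text \<open>The columns of \<open>A\<close> are the frame components of the Jacobi fields with \<open>a(0) = 0\<close> whose initial
  derivatives are the columns of \<open>E 0\<close>.\<close>

lemma jacobi_fields_matrix_equation:
  assumes J: "J \<subseteq> I" "0 \<in> J" and jacobi: "\<And>u. jacobi_field J x y (a u) (b u)"
    and start: "\<And>u. a u 0 = 0" "\<And>u. b u 0 = u"
  obtains A C where "\<And>s. A s = F s ** (\<chi> i j. a (axis j 1) s $ i) ** E 0"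
    "\<And>s. s \<in> J \<Longrightarrow> (A has_vector_derivative C s) (at s)"
    "\<And>s. s \<in> J \<Longrightarrow> (C has_vector_derivative - (R s ** A s)) (at s)"
    "A 0 = 0" "C 0 = mat 1"
proof -
  let ?e = "\<lambda>j. axis j 1 :: real^'n"
  define A1 :: "real \<Rightarrow> real^'n^'n" where "A1 s = (\<chi> i j. (F s *v a (?e j) s) $ i)" for s
  define C1 :: "real \<Rightarrow> real^'n^'n" where "C1 s = (\<chi> i j. (F s *v (b (?e j) s + \<Gamma> (x s) (y s) (a (?e j) s))) $ i)" for s
  have bounded_linear_E0: "bounded_linear (\<lambda>X. X ** E 0)"
    by (rule bounded_bilinear.bounded_linear_left[OF bounded_bilinear_matrix_mult])
  note mult_E0 = bounded_linear.has_vector_derivative[OF bounded_linear_E0]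
  have A1': "(A1 has_vector_derivative C1 s) (at s)" if "s \<in> J" for s
    unfolding A1_def C1_def using that J(1)
    by (intro has_vector_derivative_columns jacobi_field_frame(1)[OF jacobi]) auto
  have C1': "(C1 has_vector_derivative - (R s ** A1 s)) (at s)" if "s \<in> J" for s
  proof -
    have "(C1 has_vector_derivative (\<chi> i j. (- (R s *v (F s *v a (?e j) s))) $ i)) (at s)"
      unfolding C1_def using that J(1)
      by (intro has_vector_derivative_columns jacobi_field_frame(2)[OF jacobi]) auto
    moreover have "(\<chi> i j. (- (R s *v (F s *v a (?e j) s))) $ i) = - (R s ** A1 s)"
      by (simp add: vec_eq_iff A1_def matrix_matrix_mult_def matrix_vector_mult_def)
    ultimately show ?thesis by simp
  qed
  show thesis
  proof (rule that[of "\<lambda>s. A1 s ** E 0" "\<lambda>s. C1 s ** E 0"])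
    show "A1 s ** E 0 = F s ** (\<chi> i j. a (axis j 1) s $ i) ** E 0" for s
      by (simp add: A1_def matrix_matrix_mult_def matrix_vector_mult_def)
    show "((\<lambda>s. A1 s ** E 0) has_vector_derivative C1 s ** E 0) (at s)" if "s \<in> J" for s
      by (rule mult_E0[OF A1'[OF that]])
    show "((\<lambda>s. C1 s ** E 0) has_vector_derivative - (R s ** (A1 s ** E 0))) (at s)" if "s \<in> J" for s
      using mult_E0[OF C1'[OF that]] by (simp add: matrix_mult_linear_simps matrix_mul_assoc)
    have "A1 0 = 0" by (simp add: A1_def start vec_eq_iff)
    then show "A1 0 ** E 0 = 0" by simp
    have "C1 0 = F 0"
      by (simp add: C1_def start christoffel_simps[OF xU[OF zero_in_I]] matrix_vector_mult_basis column_def vec_eq_iff)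
    then show "C1 0 ** E 0 = mat 1" by (simp add: FE[OF zero_in_I])
  qed
qed

end

lemma framed_geodesic_exists:
  fixes U :: "(real^'n::finite) set"
  assumes "chart_metric U G" and x0: "x0 \<in> U"
  obtains d x y E where "framed_geodesic U G d x y E" "x 0 = x0" "y 0 = \<xi>" "E 0 = mat 1"
proof -
  interpret chart_metric U G by fact
  obtain d0 e X Y where d0: "d0 > (0::real)" and e: "e > (0::real)"
    and start: "\<And>\<eta>. \<eta> \<in> ball \<xi> e \<Longrightarrow> X \<eta> 0 = x0" "\<And>\<eta>. \<eta> \<in> ball \<xi> e \<Longrightarrow> Y \<eta> 0 = \<eta>"
    and flow: "\<And>\<eta>. \<eta> \<in> ball \<xi> e \<Longrightarrow> chart_geodesic U G {-d0<..<d0} (X \<eta>) (Y \<eta>)"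
    by (rule local_geodesic_flow[OF x0, of \<xi>]) blast
  define x where "x = X \<xi>"
  define y where "y = Y \<xi>"
  have geodesic: "chart_geodesic U G {-d0<..<d0} x y" and start: "x 0 = x0" "y 0 = \<xi>"
    using flow start e by (auto simp: x_def y_def)
  have "smooth_on {-d0<..<d0} (\<lambda>t. matrix (\<Gamma> (x t) (y t)))"
    using smooth_on_chart_geodesic[OF open_greaterThanLessThan geodesic] chart_geodesicD(1)[OF geodesic]
    by (intro smooth_on_matrix smooth_christoffel_fields smooth_on_const) auto
  then have continuous: "continuous_on {-d0<..<d0} (\<lambda>t. matrix (\<Gamma> (x t) (y t)))"
    by (rule smooth_on_imp_continuous_on)
  obtain d Z where d: "d > 0" "d \<le> d0" and Z: "\<And>Z0 :: real^'n^'n. Z Z0 0 = Z0"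
    "\<And>Z0 t. t \<in> {-d<..<d} \<Longrightarrow> (Z Z0 has_vector_derivative - (matrix (\<Gamma> (x t) (y t)) ** Z Z0 t)) (at t)"
    by (rule linear_ode_existence[OF bounded_bilinear_minus_matrix_mult continuous d0]) blast
  have "chart_geodesic U G {-d<..<d} x y"
    by (rule chart_geodesic_subset[OF geodesic]) (use d(2) in auto)
  then have "framed_geodesic U G d x y (Z (mat 1))"
    using d(1) Z by unfold_locales (auto simp: det_I)
  then show thesis using start Z(1) by (rule that)
qed

section \<open>The volume density along a geodesic\<close>

locale framed_manifold_geodesic =
  riemannian_chart M c + framed_geodesic "cmap c ` cdom c" "gmat M c" d x y E
  for M :: "('a, 'n::finite, 'z) manifold_scheme" and c d x y E
begin

definition base_point :: 'a where
  "base_point = cinv c (x 0)"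

lemma base_point: "base_point \<in> cdom c" "cmap c base_point = x 0"
  using xU[OF zero_in_I] by (simp_all add: base_point_def inv_into_into f_inv_into_f)

definition dexp :: "real \<Rightarrow> real^'n^'n" where
  "dexp s = F s ** matrix (dir_deriv (cmap c \<circ> exp_map M c base_point) (s *\<^sub>R y 0)) ** E 0"

lemma volume_density_eq_det_dexp:
  assumes s: "s \<in> I"
  shows "volume_density M c base_point (s *\<^sub>R y 0) = \<bar>det (dexp s)\<bar>"
proof -
  let ?D = "matrix (dir_deriv (cmap c \<circ> exp_map M c base_point) (s *\<^sub>R y 0))"
  have nonzero: "det (gmat M c (x 0)) \<noteq> 0" "det (E s) \<noteq> 0"
    using det_G_nonzero[OF xU[OF zero_in_I]] det_E_nonzero[OF s] by auto
  have "det (gmat M c (x s)) = det (gmat M c (x 0)) * (det (E 0) / det (E s))\<^sup>2"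
    using det_G_frame[OF s] nonzero by (simp add: field_simps)
  then have "sqrt (det (gmat M c (x s))) = sqrt (det (gmat M c (x 0))) * \<bar>det (E 0) / det (E s)\<bar>"
    by (simp add: real_sqrt_mult)
  then have "volume_density M c base_point (s *\<^sub>R y 0) = \<bar>det (E 0) / det (E s)\<bar> * \<bar>det ?D\<bar>"
    using nonzero(1) cmap_exp_map_chart_geodesic[OF geodesic base_point(1) base_point(2)[symmetric] s]
    by (simp add: volume_density_def vol_density_def base_point(2))
  also have "\<dots> = \<bar>det (dexp s)\<bar>"
    by (simp add: dexp_def F_def det_mul det_matrix_inv[OF nonzero(2)] abs_mult)
  finally show ?thesis .
qed

lemma dexp_0: "dexp 0 = mat 1"
proof -
  have "matrix (dir_deriv (cmap c \<circ> exp_map M c base_point) 0) = mat 1"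
    by (simp add: dir_deriv_exp_map_0[OF base_point(1)] matrix_def mat_def vec_eq_iff axis_def)
  then show ?thesis by (simp add: dexp_def FE[OF zero_in_I])
qed

lemma dexp_jacobi_equation:
  obtains \<delta> A C where "0 < \<delta>" "\<delta> \<le> d" "\<And>s. s \<in> {-\<delta><..<\<delta>} \<Longrightarrow> A s = s *\<^sub>R dexp s"
    "\<And>s. s \<in> {-\<delta><..<\<delta>} \<Longrightarrow> (A has_vector_derivative C s) (at s)"
    "\<And>s. s \<in> {-\<delta><..<\<delta>} \<Longrightarrow> (C has_vector_derivative - (R s ** A s)) (at s)"
    "A 0 = 0" "C 0 = mat 1"
proof -
  obtain \<delta> a b where \<delta>: "0 < \<delta>" "\<delta> \<le> d" and start: "\<And>u. a u 0 = 0" "\<And>u. b u 0 = u"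
    and jacobi: "\<And>u. jacobi_field {-\<delta><..<\<delta>} x y (a u) (b u)"
    and a: "\<And>s u. s \<in> {-\<delta><..<\<delta>} \<Longrightarrow> s *\<^sub>R dir_deriv (cmap c \<circ> exp_map M c base_point) (s *\<^sub>R y 0) u = a u s"
    by (rule dir_deriv_exp_map_jacobi_field[OF geodesic d_pos base_point(1) base_point(2)[symmetric]]) blast
  have J: "{-\<delta><..<\<delta>} \<subseteq> I" "0 \<in> {-\<delta><..<\<delta>}" using \<delta> by auto
  obtain A C where A: "\<And>s. A s = F s ** (\<chi> i j. a (axis j 1) s $ i) ** E 0"
    and ode: "\<And>s. s \<in> {-\<delta><..<\<delta>} \<Longrightarrow> (A has_vector_derivative C s) (at s)"
      "\<And>s. s \<in> {-\<delta><..<\<delta>} \<Longrightarrow> (C has_vector_derivative - (R s ** A s)) (at s)" "A 0 = 0" "C 0 = mat 1"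
    by (rule jacobi_fields_matrix_equation[OF J jacobi start]) blast
  have "A s = s *\<^sub>R dexp s" if "s \<in> {-\<delta><..<\<delta>}" for s
  proof -
    have "(\<chi> i j. a (axis j 1) s $ i) = s *\<^sub>R matrix (dir_deriv (cmap c \<circ> exp_map M c base_point) (s *\<^sub>R y 0))"
      by (simp add: a[OF that, symmetric] matrix_def vec_eq_iff)
    then show ?thesis unfolding A dexp_def by (simp add: matrix_mult_linear_simps)
  qed
  with \<delta> ode show thesis by (intro that[of \<delta> A C])
qed

end

section \<open>The matrix Riccati equation\<close>

text \<open>\<open>riccati_coeff r k\<close> is the \<open>k\<close>-th derivative at \<open>0\<close> of the solution of
  \<open>s V' + 2 V + s (V\<^sup>2 + R) = 0\<close>, where \<open>r i\<close> is the \<open>i\<close>-th derivative of \<open>R\<close> at \<open>0\<close>.\<close>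

fun riccati_coeff :: "(nat \<Rightarrow> real^'n^'n) \<Rightarrow> nat \<Rightarrow> real^'n^'n" where
  "riccati_coeff r 0 = 0"
| "riccati_coeff r (Suc k) = - ((real (Suc k) / real (k + 3)) *\<^sub>R
     (r k + (\<Sum>i\<le>k. real (k choose i) *\<^sub>R (riccati_coeff r i ** riccati_coeff r (k - i)))))"

text \<open>\<open>density_coeff \<tau> k\<close> is the \<open>k\<close>-th derivative at \<open>0\<close> of the function with value \<open>1\<close> at \<open>0\<close>
  whose logarithmic derivative has the derivatives \<open>\<tau> i\<close> at \<open>0\<close>.\<close>

fun density_coeff :: "(nat \<Rightarrow> real) \<Rightarrow> nat \<Rightarrow> real" where
  "density_coeff \<tau> 0 = 1"
| "density_coeff \<tau> (Suc k) = (\<Sum>i\<le>k. real (k choose i) * (density_coeff \<tau> i * \<tau> (k - i)))"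

definition jacobi_density_coeff :: "(nat \<Rightarrow> real^'n^'n) \<Rightarrow> nat \<Rightarrow> real" where
  "jacobi_density_coeff r = density_coeff (\<lambda>j. trace (riccati_coeff r j))"

declare riccati_coeff.simps(2) [simp del] density_coeff.simps(2) [simp del]

lemma nderiv_eq_density_coeff:
  assumes I: "open I" "0 \<in> I" and f: "smooth_on I f" "f 0 = 1" and \<tau>: "smooth_on I \<tau>"
    and f': "\<And>s. s \<in> I \<Longrightarrow> vderiv f s = f s * \<tau> s"
  shows "nderiv k f 0 = density_coeff (\<lambda>j. nderiv j \<tau> 0) k"
proof (induction k rule: less_induct)
  case (less k)
  show ?case
  proof (cases k)
    case (Suc j)
    have "nderiv (Suc j) f 0 = nderiv j (\<lambda>s. f s * \<tau> s) 0"
      unfolding nderiv_Suc_vderiv by (rule nderiv_cong[OF I(1) f' I(2)])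
    also have "\<dots> = (\<Sum>i\<le>j. real (j choose i) *\<^sub>R (nderiv i f 0 * nderiv (j - i) \<tau> 0))"
      by (rule nderiv_bilinear[OF bounded_bilinear_mult I(1) f(1) \<tau> I(2)])
    finally show ?thesis using less by (simp add: Suc density_coeff.simps(2))
  qed (simp add: f(2))
qed

lemma riccati_derivative_recursion:
  fixes V R :: "real \<Rightarrow> real^'n^'n"
  assumes I: "open I" "0 \<in> I" and V: "smooth_on I V" and R: "smooth_on I R"
    and riccati: "\<And>s. s \<in> I \<Longrightarrow> s *\<^sub>R (vderiv V s + (V s ** V s + R s)) + 2 *\<^sub>R V s = 0"
  shows "real (k + 3) *\<^sub>R nderiv (Suc k) V 0 = - (real (Suc k) *\<^sub>R
    (nderiv k R 0 + (\<Sum>i\<le>k. real (k choose i) *\<^sub>R (nderiv i V 0 ** nderiv (k - i) V 0))))"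
proof -
  let ?W = "\<lambda>s. vderiv V s + (V s ** V s + R s)"
  note VV = smooth_on_matrix_mult[OF I(1) V V] and V' = smooth_on_vderiv[OF V]
  have W: "smooth_on I ?W" by (intro smooth_on_add I(1) V' VV R)
  have "0 = nderiv (Suc k) (\<lambda>s. s *\<^sub>R ?W s + 2 *\<^sub>R V s) 0"
    using nderiv_cong[OF I(1) riccati I(2), of "\<lambda>s. s" "Suc k"] by (simp add: nderiv_const)
  also have "\<dots> = nderiv (Suc k) (\<lambda>s. s *\<^sub>R ?W s) 0 + nderiv (Suc k) (\<lambda>s. 2 *\<^sub>R V s) 0"
    by (rule nderiv_add[OF I(1) smooth_on_bilinear[OF bounded_bilinear_scaleR I(1) smooth_on_id[OF I(1)] W]
          smooth_on_bounded_linear[OF bounded_linear_scaleR_right I(1) V] I(2)])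
  also have "nderiv (Suc k) (\<lambda>s. s *\<^sub>R ?W s) 0 = real (Suc k) *\<^sub>R nderiv k ?W 0"
    by (simp add: nderiv_scaleR_id[OF I(1) W I(2)])
  also have "nderiv k ?W 0 = nderiv (Suc k) V 0 + (nderiv k (\<lambda>s. V s ** V s) 0 + nderiv k R 0)"
    by (simp add: nderiv_add[OF I(1) V' smooth_on_add[OF I(1) VV R] I(2)] nderiv_add[OF I(1) VV R I(2)]
        nderiv_Suc_vderiv)
  also have "nderiv k (\<lambda>s. V s ** V s) 0 = (\<Sum>i\<le>k. real (k choose i) *\<^sub>R (nderiv i V 0 ** nderiv (k - i) V 0))"
    by (rule nderiv_bilinear[OF bounded_bilinear_matrix_mult I(1) V V I(2)])
  also have "nderiv (Suc k) (\<lambda>s. 2 *\<^sub>R V s) 0 = 2 *\<^sub>R nderiv (Suc k) V 0"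
    by (rule nderiv_bounded_linear[OF I(1) bounded_linear_scaleR_right V I(2)])
  finally have sum_zero: "real (Suc k) *\<^sub>R (nderiv (Suc k) V 0
      + ((\<Sum>i\<le>k. real (k choose i) *\<^sub>R (nderiv i V 0 ** nderiv (k - i) V 0)) + nderiv k R 0))
      + 2 *\<^sub>R nderiv (Suc k) V 0 = 0" by (rule sym)
  have "real (k + 3) *\<^sub>R nderiv (Suc k) V 0 = real (Suc k) *\<^sub>R nderiv (Suc k) V 0 + 2 *\<^sub>R nderiv (Suc k) V 0"
    by (simp add: scaleR_add_left[symmetric])
  then show ?thesis
    unfolding eq_neg_iff_add_eq_0 using sum_zero by (simp only: scaleR_add_right add_ac)
qed

lemma nderiv_eq_riccati_coeff:
  fixes V R :: "real \<Rightarrow> real^'n^'n"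
  assumes I: "open I" "0 \<in> I" and V: "smooth_on I V" and R: "smooth_on I R"
    and riccati: "\<And>s. s \<in> I \<Longrightarrow> s *\<^sub>R (vderiv V s + (V s ** V s + R s)) + 2 *\<^sub>R V s = 0"
  shows "nderiv k V 0 = riccati_coeff (\<lambda>i. nderiv i R 0) k"
proof (induction k rule: less_induct)
  case (less k)
  show ?case
  proof (cases k)
    case 0
    then show ?thesis using riccati[OF I(2)] by simp
  next
    case (Suc j)
    have "nderiv (Suc j) V 0 = (1 / real (j + 3)) *\<^sub>R (real (j + 3) *\<^sub>R nderiv (Suc j) V 0)" by simp
    also have "\<dots> = - ((real (Suc j) / real (j + 3)) *\<^sub>R
        (nderiv j R 0 + (\<Sum>i\<le>j. real (j choose i) *\<^sub>R (nderiv i V 0 ** nderiv (j - i) V 0))))"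
      by (subst riccati_derivative_recursion[OF assms]) simp_all
    also have "\<dots> = riccati_coeff (\<lambda>i. nderiv i R 0) (Suc j)"
      unfolding riccati_coeff.simps(2) using less.IH by (simp add: Suc)
    finally show ?thesis by (simp add: Suc)
  qed
qed

lemma jacobi_equation_divide_by_time:
  fixes A C R :: "real \<Rightarrow> real^'n^'n"
  assumes I: "open I" "convex I" "0 \<in> I" and R: "smooth_on I R"
    and A: "\<And>s. s \<in> I \<Longrightarrow> (A has_vector_derivative C s) (at s)"
    and C: "\<And>s. s \<in> I \<Longrightarrow> (C has_vector_derivative - (R s ** A s)) (at s)"
    and start: "A 0 = 0" "C 0 = mat 1"
  obtains B where "smooth_on I B" "B 0 = mat 1" "\<And>s. s \<in> I \<Longrightarrow> A s = s *\<^sub>R B s"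
    "\<And>s. s \<in> I \<Longrightarrow> s *\<^sub>R vderiv (vderiv B) s + 2 *\<^sub>R vderiv B s = - (s *\<^sub>R (R s ** B s))"
proof -
  have smooth_A: "smooth_on I A"
  proof (rule smooth_on_bootstrap[OF I(1) A])
    fix k assume "Ck_on k I A"
    then have "Ck_on k I (\<lambda>s. - (R s ** A s))"
      using R by (intro Ck_on_bilinear[OF bounded_bilinear_minus_matrix_mult I(1)]) (auto simp: smooth_on_def)
    then show "Ck_on k I C" using Ck_on_SucD Ck_on_Suc_has_vector_derivativeI[OF I(1) C] by blast
  qed
  then obtain B where B: "smooth_on I B" and AB: "\<And>s. s \<in> I \<Longrightarrow> A s = s *\<^sub>R B s"
    using smooth_on_divide_by_time[OF I smooth_A start(1)] by blast
  have nderiv_A: "nderiv (Suc k) A s = s *\<^sub>R nderiv (Suc k) B s + real (Suc k) *\<^sub>R nderiv k B s" if "s \<in> I" for k s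
    using nderiv_cong[OF I(1) AB that, of "\<lambda>s. s" "Suc k"] nderiv_scaleR_id[OF I(1) B that] by simp
  have A': "vderiv A s = C s" if "s \<in> I" for s by (rule vector_derivative_at[OF A[OF that]])
  have "nderiv 2 A s = - (R s ** A s)" if "s \<in> I" for s
    using nderiv_SucI[OF I(1) that _ C[OF that], of 1 A] A' by (simp add: nderiv_Suc numeral_2_eq_2)
  then have "s *\<^sub>R vderiv (vderiv B) s + 2 *\<^sub>R vderiv B s = - (s *\<^sub>R (R s ** B s))" if "s \<in> I" for s
    using nderiv_A[OF that, of 1] that by (simp add: nderiv_Suc numeral_2_eq_2 AB matrix_mult_linear_simps)
  moreover have "B 0 = mat 1" using nderiv_A[OF I(3), of 0] A'[OF I(3)] start(2) by (simp add: nderiv_Suc)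
  ultimately show thesis by (intro that[OF B _ AB])
qed

lemma riccati_equation:
  fixes B R :: "real \<Rightarrow> real^'n^'n"
  assumes I: "open I" and B: "smooth_on I B" and nonzero: "\<And>s. s \<in> I \<Longrightarrow> det (B s) \<noteq> 0"
    and jacobi: "\<And>s. s \<in> I \<Longrightarrow> s *\<^sub>R vderiv (vderiv B) s + 2 *\<^sub>R vderiv B s = - (s *\<^sub>R (R s ** B s))"
  defines "V \<equiv> \<lambda>s. vderiv B s ** matrix_inv (B s)"
  assumes s: "s \<in> I"
  shows "s *\<^sub>R (vderiv V s + (V s ** V s + R s)) + 2 *\<^sub>R V s = 0"
proof -
  let ?B' = "vderiv B s" and ?inv = "matrix_inv (B s)"
  have "(V has_vector_derivative ?B' ** - (?inv ** ?B' ** ?inv) + vderiv (vderiv B) s ** ?inv) (at s)"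
    unfolding V_def
    by (rule has_vector_derivative_matrix_mult[OF smooth_on_has_vector_derivative[OF smooth_on_vderiv[OF B] I s]
          matrix_inv_derivative[OF I s B nonzero smooth_on_has_vector_derivative[OF B I s]]])
  then have V': "vderiv V s = vderiv (vderiv B) s ** ?inv - V s ** V s"
    by (simp add: vector_derivative_at V_def matrix_mult_linear_simps matrix_mul_assoc)
  have "(s *\<^sub>R vderiv (vderiv B) s + 2 *\<^sub>R ?B') ** ?inv = - (s *\<^sub>R (R s ** B s)) ** ?inv"
    by (simp only: jacobi[OF s])
  then have "s *\<^sub>R (vderiv (vderiv B) s ** ?inv) + 2 *\<^sub>R V s = - (s *\<^sub>R R s)"
    by (simp add: matrix_mult_linear_simps V_def matrix_mul_assoc[symmetric] matrix_inv_mult nonzero[OF s])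
  then show ?thesis unfolding V' by (simp add: algebra_simps)
qed

lemma nderiv_abs_det_jacobi_equation:
  fixes B R :: "real \<Rightarrow> real^'n^'n"
  assumes "\<delta> > 0" and B: "smooth_on {-\<delta><..<\<delta>} B" and B0: "B 0 = mat 1" and R: "smooth_on {-\<delta><..<\<delta>} R"
    and jacobi: "\<And>s. s \<in> {-\<delta><..<\<delta>} \<Longrightarrow>
      s *\<^sub>R vderiv (vderiv B) s + 2 *\<^sub>R vderiv B s = - (s *\<^sub>R (R s ** B s))"
  obtains \<epsilon> where "0 < \<epsilon>" "\<epsilon> \<le> \<delta>" "smooth_on {-\<epsilon><..<\<epsilon>} (\<lambda>s. \<bar>det (B s)\<bar>)"
    "\<And>k. nderiv k (\<lambda>s. \<bar>det (B s)\<bar>) 0 = jacobi_density_coeff (\<lambda>i. nderiv i R 0) k"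
proof -
  have smooth_det: "smooth_on {-\<delta><..<\<delta>} (\<lambda>s. det (B s))"
    by (intro smooth_on_det smooth_on_vec_nth B open_greaterThanLessThan)
  then have "isCont (\<lambda>s. det (B s)) 0"
    using smooth_on_imp_continuous_on[OF smooth_det] \<open>\<delta> > 0\<close> by (simp add: continuous_on_eq_continuous_at)
  then obtain e where e: "e > 0" "\<And>s. dist s 0 < e \<Longrightarrow> dist (det (B s)) (det (B 0)) < 1"
    unfolding continuous_at_eps_delta by (metis zero_less_one)
  define \<epsilon> where "\<epsilon> = min \<delta> e"
  let ?I = "{-\<epsilon><..<\<epsilon>}"
  have \<epsilon>: "0 < \<epsilon>" "\<epsilon> \<le> \<delta>" and I: "?I \<subseteq> {-\<delta><..<\<delta>}" "0 \<in> ?I" "open ?I"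
    using \<open>\<delta> > 0\<close> e(1) by (auto simp: \<epsilon>_def)
  have det_pos: "det (B s) > 0" if "s \<in> ?I" for s
    using e(2)[of s] that B0 by (simp add: \<epsilon>_def dist_real_def abs_less_iff) linarith
  then have nonzero: "det (B s) \<noteq> 0" if "s \<in> ?I" for s using that by fastforce
  note on_I = smooth_on_subset[OF _ open_greaterThanLessThan I(3,1)]
  note B_I = on_I[OF B] and R_I = on_I[OF R] and det_I = on_I[OF smooth_det]
  define V where "V s = vderiv B s ** matrix_inv (B s)" for s
  have V: "smooth_on ?I V"
    unfolding V_def by (intro smooth_on_matrix_mult I(3) smooth_on_vderiv smooth_on_matrix_inv B_I nonzero)
  have "s *\<^sub>R (vderiv V s + (V s ** V s + R s)) + 2 *\<^sub>R V s = 0" if "s \<in> ?I" for s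
    unfolding V_def by (rule riccati_equation[OF I(3) B_I nonzero jacobi[OF subsetD[OF I(1)]] that])
  then have "nderiv k V 0 = riccati_coeff (\<lambda>i. nderiv i R 0) k" for k
    by (rule nderiv_eq_riccati_coeff[OF I(3,2) V R_I])
  then have trace_V: "nderiv k (\<lambda>s. trace (V s)) 0 = trace (riccati_coeff (\<lambda>i. nderiv i R 0) k)" for k
    by (simp add: nderiv_bounded_linear[OF I(3) bounded_linear_trace V I(2)])
  have "vderiv (\<lambda>s. det (B s)) s = det (B s) * trace (V s)" if "s \<in> ?I" for s
    unfolding V_def
    by (rule vector_derivative_at)
       (rule det_derivative[OF smooth_on_has_vector_derivative[OF B_I I(3) that] nonzero[OF that]])
  then have "nderiv k (\<lambda>s. det (B s)) 0 = jacobi_density_coeff (\<lambda>i. nderiv i R 0) k" for k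
    using nderiv_eq_density_coeff[OF I(3,2) det_I _ smooth_on_bounded_linear[OF bounded_linear_trace I(3) V]] B0
    by (simp add: jacobi_density_coeff_def trace_V)
  moreover have abs_det: "\<bar>det (B s)\<bar> = det (B s)" if "s \<in> ?I" for s using det_pos[OF that] by simp
  ultimately show thesis
    using \<epsilon> nderiv_cong[OF I(3) abs_det I(2)]
    by (intro that[of \<epsilon>] smooth_on_cong[OF det_I I(3)]) simp_all
qed

lemma nderiv_abs_det_jacobi_equation_divided:
  fixes A C D R :: "real \<Rightarrow> real^'n^'n"
  assumes "\<delta> > 0" and R: "smooth_on {-\<delta><..<\<delta>} R"
    and A: "\<And>s. s \<in> {-\<delta><..<\<delta>} \<Longrightarrow> (A has_vector_derivative C s) (at s)"
    and C: "\<And>s. s \<in> {-\<delta><..<\<delta>} \<Longrightarrow> (C has_vector_derivative - (R s ** A s)) (at s)"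
    and start: "A 0 = 0" "C 0 = mat 1"
    and D: "\<And>s. s \<in> {-\<delta><..<\<delta>} \<Longrightarrow> A s = s *\<^sub>R D s" "D 0 = mat 1"
  obtains \<epsilon> where "0 < \<epsilon>" "\<epsilon> \<le> \<delta>" "smooth_on {-\<epsilon><..<\<epsilon>} (\<lambda>s. \<bar>det (D s)\<bar>)"
    "\<And>k. nderiv k (\<lambda>s. \<bar>det (D s)\<bar>) 0 = jacobi_density_coeff (\<lambda>i. nderiv i R 0) k"
proof -
  have zero: "0 \<in> {-\<delta><..<\<delta>}" using \<open>\<delta> > 0\<close> by simp
  obtain B where B: "smooth_on {-\<delta><..<\<delta>} B" "B 0 = mat 1" and AB: "\<And>s. s \<in> {-\<delta><..<\<delta>} \<Longrightarrow> A s = s *\<^sub>R B s"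
    and jacobi: "\<And>s. s \<in> {-\<delta><..<\<delta>} \<Longrightarrow>
      s *\<^sub>R vderiv (vderiv B) s + 2 *\<^sub>R vderiv B s = - (s *\<^sub>R (R s ** B s))"
    by (rule jacobi_equation_divide_by_time[OF open_greaterThanLessThan convex_real_interval(8) zero R A C start]) blast+
  obtain \<epsilon> where \<epsilon>: "0 < \<epsilon>" "\<epsilon> \<le> \<delta>" and smooth: "smooth_on {-\<epsilon><..<\<epsilon>} (\<lambda>s. \<bar>det (B s)\<bar>)"
    and coeff: "\<And>k. nderiv k (\<lambda>s. \<bar>det (B s)\<bar>) 0 = jacobi_density_coeff (\<lambda>i. nderiv i R 0) k"
    by (rule nderiv_abs_det_jacobi_equation[OF \<open>\<delta> > 0\<close> B R jacobi]) blast+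
  have BD: "B s = D s" if "s \<in> {-\<delta><..<\<delta>}" for s
    using AB[OF that] D(1)[OF that] B(2) D(2) by (cases "s = 0") auto
  show thesis
  proof (rule that[OF \<epsilon>])
    show "smooth_on {-\<epsilon><..<\<epsilon>} (\<lambda>s. \<bar>det (D s)\<bar>)"
      by (rule smooth_on_cong[OF smooth open_greaterThanLessThan]) (use BD \<epsilon>(2) in auto)
    show "nderiv k (\<lambda>s. \<bar>det (D s)\<bar>) 0 = jacobi_density_coeff (\<lambda>i. nderiv i R 0) k" for k
      using nderiv_cong[OF open_greaterThanLessThan _ zero, of "\<lambda>s. \<bar>det (D s)\<bar>" "\<lambda>s. \<bar>det (B s)\<bar>" k] BD coeff
      by simp
  qed
qed

section \<open>The first Taylor coefficients\<close>

lemma density_coeff_odd_imp_even_zero: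
  assumes odd: "\<And>k. odd k \<Longrightarrow> density_coeff \<tau> k = 0" and "even k"
  shows "\<tau> k = 0"
  using \<open>even k\<close>
proof (induction k rule: less_induct)
  case (less k)
  have "density_coeff \<tau> i * \<tau> (k - i) = 0" if "i \<in> {..k} - {0}" for i
    using that less.IH[of "k - i"] odd[of i] less.prems by (cases "even i") auto
  then have "(\<Sum>i\<in>{..k} - {0}. real (k choose i) * (density_coeff \<tau> i * \<tau> (k - i))) = 0"
    by (intro sum.neutral) simp
  then have "density_coeff \<tau> (Suc k) = \<tau> k"
    by (simp add: density_coeff.simps(2) sum.remove[of "{..k}" 0])
  then show ?case using odd[of "Suc k"] less.prems by simp
qed

lemma density_coeff_of_odd:
  assumes even: "\<And>k. even k \<Longrightarrow> \<tau> k = 0"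
  shows "density_coeff \<tau> 2 = \<tau> 1"
    and "density_coeff \<tau> 4 = \<tau> 3 + 3 * (\<tau> 1)\<^sup>2"
    and "density_coeff \<tau> 6 = \<tau> 5 + 15 * \<tau> 1 * \<tau> 3 + 15 * \<tau> 1 ^ 3"
    and "density_coeff \<tau> 8 = \<tau> 7 + 28 * \<tau> 1 * \<tau> 5 + 35 * (\<tau> 3)\<^sup>2 + 210 * (\<tau> 1)\<^sup>2 * \<tau> 3 + 105 * \<tau> 1 ^ 4"
proof -
  have even_values: "\<tau> 0 = 0" "\<tau> 2 = 0" "\<tau> 4 = 0" "\<tau> 6 = 0" by (simp_all add: even)
  note recursion = density_coeff.simps(2)[of \<tau>]
  have odd_coeffs: "density_coeff \<tau> 1 = 0" "density_coeff \<tau> 3 = 0" "density_coeff \<tau> 5 = 0" "density_coeff \<tau> 7 = 0"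
    using recursion[of 0] recursion[of 2] recursion[of 4] recursion[of 6] even_values
    by (simp_all add: eval_nat_numeral)
  show coeff_2: "density_coeff \<tau> 2 = \<tau> 1"
    using recursion[of 1] even_values odd_coeffs by (simp add: eval_nat_numeral)
  show coeff_4: "density_coeff \<tau> 4 = \<tau> 3 + 3 * (\<tau> 1)\<^sup>2"
    using recursion[of 3] even_values odd_coeffs coeff_2 by (simp add: eval_nat_numeral)
  show coeff_6: "density_coeff \<tau> 6 = \<tau> 5 + 15 * \<tau> 1 * \<tau> 3 + 15 * \<tau> 1 ^ 3"
    using recursion[of 5] even_values odd_coeffs coeff_2 coeff_4 by (simp add: eval_nat_numeral algebra_simps)
  show "density_coeff \<tau> 8 = \<tau> 7 + 28 * \<tau> 1 * \<tau> 5 + 35 * (\<tau> 3)\<^sup>2 + 210 * (\<tau> 1)\<^sup>2 * \<tau> 3 + 105 * \<tau> 1 ^ 4"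
    using recursion[of 7] even_values odd_coeffs coeff_2 coeff_4 coeff_6
    by (simp add: eval_nat_numeral algebra_simps)
qed

lemma riccati_coeff_values:
  fixes r :: "nat \<Rightarrow> real^'n^'n"
  shows "riccati_coeff r 1 = - (1/3) *\<^sub>R r 0"
    and "riccati_coeff r 2 = - (1/2) *\<^sub>R r 1"
    and "riccati_coeff r 3 = - (3/5) *\<^sub>R r 2 - (2/15) *\<^sub>R (r 0 ** r 0)"
    and "riccati_coeff r 4 = - (2/3) *\<^sub>R r 3 - (1/3) *\<^sub>R (r 0 ** r 1) - (1/3) *\<^sub>R (r 1 ** r 0)"
    and "riccati_coeff r 5 = - (5/7) *\<^sub>R r 4 - (4/7) *\<^sub>R (r 0 ** r 2) - (4/7) *\<^sub>R (r 2 ** r 0)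
      - (15/14) *\<^sub>R (r 1 ** r 1) - (16/63) *\<^sub>R (r 0 ** r 0 ** r 0)"
proof -
  note recursion = riccati_coeff.simps(2)[of r]
  note simps = matrix_mult_linear_simps scaleR_add_right scaleR_diff_right matrix_mul_assoc
  show coeff_1: "riccati_coeff r 1 = - (1/3) *\<^sub>R r 0" using recursion[of 0] by simp
  show coeff_2: "riccati_coeff r 2 = - (1/2) *\<^sub>R r 1" using recursion[of 1] by (simp add: eval_nat_numeral)
  have "riccati_coeff r 3 = - (3/5) *\<^sub>R (r 2 + 2 *\<^sub>R (riccati_coeff r 1 ** riccati_coeff r 1))"
    using recursion[of 2] by (simp add: eval_nat_numeral)
  then show coeff_3: "riccati_coeff r 3 = - (3/5) *\<^sub>R r 2 - (2/15) *\<^sub>R (r 0 ** r 0)"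
    unfolding coeff_1 by (simp add: simps)
  have "riccati_coeff r 4 = - (2/3) *\<^sub>R (r 3 + 3 *\<^sub>R (riccati_coeff r 1 ** riccati_coeff r 2)
      + 3 *\<^sub>R (riccati_coeff r 2 ** riccati_coeff r 1))"
    using recursion[of 3] by (simp add: simps eval_nat_numeral)
  then show "riccati_coeff r 4 = - (2/3) *\<^sub>R r 3 - (1/3) *\<^sub>R (r 0 ** r 1) - (1/3) *\<^sub>R (r 1 ** r 0)"
    unfolding coeff_1 coeff_2 by (simp add: simps)
  have "riccati_coeff r 5 = - (5/7) *\<^sub>R (r 4 + 4 *\<^sub>R (riccati_coeff r 1 ** riccati_coeff r 3)
      + 6 *\<^sub>R (riccati_coeff r 2 ** riccati_coeff r 2) + 4 *\<^sub>R (riccati_coeff r 3 ** riccati_coeff r 1))"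
    using recursion[of 4] by (simp add: simps eval_nat_numeral)
  then show "riccati_coeff r 5 = - (5/7) *\<^sub>R r 4 - (4/7) *\<^sub>R (r 0 ** r 2) - (4/7) *\<^sub>R (r 2 ** r 0)
      - (15/14) *\<^sub>R (r 1 ** r 1) - (16/63) *\<^sub>R (r 0 ** r 0 ** r 0)"
    unfolding coeff_1 coeff_2 coeff_3 by (simp add: simps vec_eq_iff)
qed

lemma trace_matrix_mult_cyclic: "trace (X ** Y ** Z) = trace (Z ** X ** Y)"
  for X Y Z :: "real^'n^'n"
  using trace_mul_sym[of "X ** Y" Z] by (simp add: matrix_mul_assoc)

context
  fixes r :: "nat \<Rightarrow> real^'n^'n"
begin

lemmas trace_cyclic_simps =
  trace_mul_sym[of "r 1" "r 0"] trace_mul_sym[of "r 2" "r 0"]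
  trace_matrix_mult_cyclic[of "r 0" "r 1" "r 0"] trace_matrix_mult_cyclic[of "r 1" "r 0" "r 0"]
  trace_matrix_mult_cyclic[of "r 0" "r 2" "r 0"] trace_matrix_mult_cyclic[of "r 2" "r 0" "r 0"]
  trace_matrix_mult_cyclic[of "r 1" "r 0" "r 1"] trace_matrix_mult_cyclic[of "r 1" "r 1" "r 0"]

lemmas trace_simps = trace_linear_simps matrix_mult_linear_simps matrix_mul_assoc scaleR_diff_right scaleR_scaleR

lemma trace_riccati_coeff:
  "trace (riccati_coeff r 1) = - (1/3) * trace (r 0)"
  "trace (riccati_coeff r 2) = - (1/2) * trace (r 1)"
  "trace (riccati_coeff r 3) = - (3/5) * trace (r 2) - (2/15) * trace (r 0 ** r 0)"
  "trace (riccati_coeff r 4) = - (2/3) * trace (r 3) - (2/3) * trace (r 0 ** r 1)"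
  "trace (riccati_coeff r 5) = - (5/7) * trace (r 4) - (8/7) * trace (r 0 ** r 2)
    - (15/14) * trace (r 1 ** r 1) - (16/63) * trace (r 0 ** r 0 ** r 0)"
  unfolding riccati_coeff_values using trace_cyclic_simps by (simp_all add: trace_simps)

lemma trace_riccati_coeff_6:
  "trace (riccati_coeff r 6) = - (3/4) * trace (r 5) - (5/3) * trace (r 0 ** r 3)
    - (9/2) * trace (r 1 ** r 2) - (8/3) * trace (r 0 ** r 0 ** r 1)"
proof -
  let ?v = "riccati_coeff r"
  have "trace (?v 6) = - (3/4) * (trace (r 5) + 10 * trace (?v 1 ** ?v 4) + 20 * trace (?v 2 ** ?v 3))"
    using riccati_coeff.simps(2)[of r 5] trace_mul_sym[of "?v 4" "?v 1"] trace_mul_sym[of "?v 3" "?v 2"]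
    by (simp add: trace_linear_simps eval_nat_numeral)
  also have "trace (?v 1 ** ?v 4) = (2/9) * trace (r 0 ** r 3) + (2/9) * trace (r 0 ** r 0 ** r 1)"
    unfolding riccati_coeff_values using trace_cyclic_simps by (simp add: trace_simps)
  also have "trace (?v 2 ** ?v 3) = (3/10) * trace (r 1 ** r 2) + (1/15) * trace (r 0 ** r 0 ** r 1)"
    unfolding riccati_coeff_values using trace_cyclic_simps by (simp add: trace_simps)
  finally show ?thesis by (simp add: algebra_simps)
qed

lemma trace_riccati_coeff_7:
  "trace (riccati_coeff r 7) = - (7/9) * trace (r 6) - (20/9) * trace (r 0 ** r 4)
    - (70/9) * trace (r 1 ** r 3) - (28/5) * trace (r 2 ** r 2) - (272/45) * trace (r 0 ** r 0 ** r 2)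
    - (100/9) * trace (r 0 ** r 1 ** r 1) - (16/15) * trace (r 0 ** r 0 ** r 0 ** r 0)"
proof -
  let ?v = "riccati_coeff r"
  have "trace (?v 7) = - (7/9) * (trace (r 6) + 12 * trace (?v 1 ** ?v 5) + 30 * trace (?v 2 ** ?v 4)
      + 20 * trace (?v 3 ** ?v 3))"
    using riccati_coeff.simps(2)[of r 6] trace_mul_sym[of "?v 5" "?v 1"] trace_mul_sym[of "?v 4" "?v 2"]
    by (simp add: trace_linear_simps eval_nat_numeral)
  also have "trace (?v 1 ** ?v 5) = (5/21) * trace (r 0 ** r 4) + (8/21) * trace (r 0 ** r 0 ** r 2)
      + (5/14) * trace (r 0 ** r 1 ** r 1) + (16/189) * trace (r 0 ** r 0 ** r 0 ** r 0)"
    unfolding riccati_coeff_values using trace_cyclic_simps by (simp add: trace_simps)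
  also have "trace (?v 2 ** ?v 4) = (1/3) * trace (r 1 ** r 3) + (1/3) * trace (r 0 ** r 1 ** r 1)"
    unfolding riccati_coeff_values using trace_cyclic_simps by (simp add: trace_simps)
  also have "trace (?v 3 ** ?v 3) = (9/25) * trace (r 2 ** r 2) + (4/25) * trace (r 0 ** r 0 ** r 2)
      + (4/225) * trace (r 0 ** r 0 ** r 0 ** r 0)"
    unfolding riccati_coeff_values using trace_cyclic_simps by (simp add: trace_simps)
  finally show ?thesis by (simp add: algebra_simps)
qed

end

section \<open>Densities without odd Taylor coefficients\<close>

locale odd_free_jacobi_density =
  fixes I :: "real set" and R :: "real \<Rightarrow> real^'n^'n"
  assumes open_I: "open I" and smooth: "smooth_on I R"
    and odd_free: "t \<in> I \<Longrightarrow> odd k \<Longrightarrow> jacobi_density_coeff (\<lambda>i. nderiv i R t) k = 0"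
begin

abbreviation r :: "nat \<Rightarrow> real \<Rightarrow> real^'n^'n" where
  "r k \<equiv> nderiv k R"

lemma trace_riccati_coeff_even:
  assumes "t \<in> I" "even k"
  shows "trace (riccati_coeff (\<lambda>i. r i t) k) = 0"
  using density_coeff_odd_imp_even_zero[of "\<lambda>k. trace (riccati_coeff (\<lambda>i. r i t) k)" k] odd_free assms
  by (simp add: jacobi_density_coeff_def)

lemmas r' = has_vector_derivative_nderiv[OF smooth open_I]

lemma trace_r_r':
  assumes "t \<in> I"
  shows "((\<lambda>t. trace (r i t ** r j t)) has_vector_derivative
    trace (r i t ** r (Suc j) t) + trace (r (Suc i) t ** r j t)) (at t)"
  using has_vector_derivative_trace[OF has_vector_derivative_matrix_mult[OF r' r', OF assms assms, of i j]]
  by (simp add: trace_linear_simps)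

lemma derivative_eq:
  fixes f :: "real \<Rightarrow> real"
  assumes t: "t \<in> I" and f: "(f has_vector_derivative a) (at t)" and g: "(g has_vector_derivative b) (at t)"
    and eq: "\<And>s. s \<in> I \<Longrightarrow> f s = g s"
  shows "a = b"
  by (rule vector_derivative_unique_at[OF f has_vector_derivative_transform_within_open[OF g open_I t]])
     (simp add: eq)

lemma trace_r_Suc:
  assumes "t \<in> I"
  shows "trace (r (Suc k) t) = 0"
  using assms
proof (induction k arbitrary: t)
  case 0
  then show ?case using trace_riccati_coeff_even[of t 2] trace_riccati_coeff(2)[of "\<lambda>i. r i t"] by simp
next
  case (Suc k)
  show ?case
    by (rule derivative_eq[OF Suc.prems has_vector_derivative_trace[OF r'[OF Suc.prems]]
          has_vector_derivative_const]) (rule Suc.IH)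
qed

lemma trace_r_eq_0: "t \<in> I \<Longrightarrow> k > 0 \<Longrightarrow> trace (r k t) = 0"
  using trace_r_Suc[of t "k - 1"] by simp

lemma trace_r0_r1: "t \<in> I \<Longrightarrow> trace (r 0 t ** r 1 t) = 0"
  using trace_riccati_coeff_even[of t 4] trace_riccati_coeff(4)[of "\<lambda>i. r i t"] trace_r_eq_0[of t 3] by simp

lemma trace_r0_r2:
  assumes "t \<in> I"
  shows "trace (r 0 t ** r 2 t) = - trace (r 1 t ** r 1 t)"
  using derivative_eq[OF assms trace_r_r'[OF assms] has_vector_derivative_const trace_r0_r1]
  by (simp add: numeral_2_eq_2)

lemma trace_r0_r3:
  assumes "t \<in> I"
  shows "trace (r 0 t ** r 3 t) = - 3 * trace (r 1 t ** r 2 t)"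
  using derivative_eq[OF assms trace_r_r'[OF assms] has_vector_derivative_minus[OF trace_r_r'[OF assms]] trace_r0_r2]
    trace_mul_sym[of "r 2 t" "r 1 t"]
  by (simp add: eval_nat_numeral)

lemma trace_r0_r4:
  assumes "t \<in> I"
  shows "trace (r 0 t ** r 4 t) = - 4 * trace (r 1 t ** r 3 t) - 3 * trace (r 2 t ** r 2 t)"
  using derivative_eq[OF assms trace_r_r'[OF assms]
      has_vector_derivative_mult_right[OF trace_r_r'[OF assms], of "- 3"] trace_r0_r3]
  by (simp add: eval_nat_numeral)

lemma trace_r1_r2:
  assumes "t \<in> I"
  shows "trace (r 1 t ** r 2 t) = (16/3) * trace (r 0 t ** r 0 t ** r 1 t)"
  using trace_riccati_coeff_even[OF assms, of 6] trace_riccati_coeff_6[of "\<lambda>i. r i t"]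
    trace_r_eq_0[OF assms, of 5] trace_r0_r3[OF assms]
  by simp

lemma trace_r1_r3:
  assumes "t \<in> I"
  shows "trace (r 1 t ** r 3 t) =
    (16/3) * (trace (r 0 t ** r 0 t ** r 2 t) + 2 * trace (r 0 t ** r 1 t ** r 1 t)) - trace (r 2 t ** r 2 t)"
proof -
  note mult = has_vector_derivative_matrix_mult
  have "((\<lambda>t. trace (r 0 t ** r 0 t ** r 1 t)) has_vector_derivative
      trace (r 0 t ** r 0 t ** r 2 t) + 2 * trace (r 0 t ** r 1 t ** r 1 t)) (at t)"
    using has_vector_derivative_trace[OF mult[OF mult[OF r' r'] r'], OF assms assms assms, of 0 0 1]
      trace_matrix_mult_cyclic[of "r 1 t" "r 0 t" "r 1 t"] trace_matrix_mult_cyclic[of "r 1 t" "r 1 t" "r 0 t"]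
    by (simp add: trace_linear_simps matrix_mult_linear_simps matrix_mul_assoc numeral_2_eq_2)
  from derivative_eq[OF assms trace_r_r'[OF assms] has_vector_derivative_mult_right[OF this] trace_r1_r2]
  show ?thesis by (simp add: eval_nat_numeral field_simps)
qed

lemma jacobi_density_coeff_values:
  assumes t: "t \<in> I"
  defines "\<rho> \<equiv> \<lambda>i. r i t"
  shows "jacobi_density_coeff \<rho> 2 = - (1/3) * trace (\<rho> 0)"
    and "jacobi_density_coeff \<rho> 4 = (trace (\<rho> 0))\<^sup>2 / 3 - (2/15) * trace (\<rho> 0 ** \<rho> 0)"
    and "jacobi_density_coeff \<rho> 6 = - (5/9) * trace (\<rho> 0) ^ 3 + (2/3) * trace (\<rho> 0) * trace (\<rho> 0 ** \<rho> 0)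
      - (16/63) * trace (\<rho> 0 ** \<rho> 0 ** \<rho> 0) + trace (\<rho> 1 ** \<rho> 1) / 14"
    and "jacobi_density_coeff \<rho> 8 = (35/27) * trace (\<rho> 0) ^ 4 - (28/9) * (trace (\<rho> 0))\<^sup>2 * trace (\<rho> 0 ** \<rho> 0)
      + (64/27) * trace (\<rho> 0) * trace (\<rho> 0 ** \<rho> 0 ** \<rho> 0) - (2/3) * trace (\<rho> 0) * trace (\<rho> 1 ** \<rho> 1)
      + (28/45) * (trace (\<rho> 0 ** \<rho> 0))\<^sup>2 - (16/15) * trace (\<rho> 0 ** \<rho> 0 ** \<rho> 0 ** \<rho> 0)
      - (16/135) * trace (\<rho> 0 ** \<rho> 0 ** \<rho> 2) + (20/27) * trace (\<rho> 0 ** \<rho> 1 ** \<rho> 1) - (2/45) * trace (\<rho> 2 ** \<rho> 2)"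
proof -
  define \<tau> where "\<tau> k = trace (riccati_coeff \<rho> k)" for k
  have "\<tau> k = 0" if "even k" for k
    using trace_riccati_coeff_even[OF t that] by (simp add: \<tau>_def \<rho>_def)
  note coeff = density_coeff_of_odd[of \<tau>, OF this]
  have jacobi: "jacobi_density_coeff \<rho> k = density_coeff \<tau> k" for k
    by (simp add: jacobi_density_coeff_def \<tau>_def[abs_def])
  have \<tau>1: "\<tau> 1 = - (1/3) * trace (\<rho> 0)" by (simp only: \<tau>_def trace_riccati_coeff)
  have \<tau>3: "\<tau> 3 = - (2/15) * trace (\<rho> 0 ** \<rho> 0)"
    using trace_r_eq_0[OF t, of 2] by (simp add: \<tau>_def \<rho>_def trace_riccati_coeff)
  have \<tau>5: "\<tau> 5 = trace (\<rho> 1 ** \<rho> 1) / 14 - (16/63) * trace (\<rho> 0 ** \<rho> 0 ** \<rho> 0)"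
    using trace_r_eq_0[OF t, of 4] trace_r0_r2[OF t] by (simp add: \<tau>_def \<rho>_def trace_riccati_coeff)
  have \<tau>7: "\<tau> 7 = - (16/135) * trace (\<rho> 0 ** \<rho> 0 ** \<rho> 2) + (20/27) * trace (\<rho> 0 ** \<rho> 1 ** \<rho> 1)
      - (2/45) * trace (\<rho> 2 ** \<rho> 2) - (16/15) * trace (\<rho> 0 ** \<rho> 0 ** \<rho> 0 ** \<rho> 0)"
    using trace_r_eq_0[OF t, of 6] trace_r0_r4[OF t] trace_r1_r3[OF t]
    by (simp add: \<tau>_def \<rho>_def trace_riccati_coeff_7 field_simps)
  show "jacobi_density_coeff \<rho> 2 = - (1/3) * trace (\<rho> 0)"
    by (simp only: jacobi coeff \<tau>1)
  show "jacobi_density_coeff \<rho> 4 = (trace (\<rho> 0))\<^sup>2 / 3 - (2/15) * trace (\<rho> 0 ** \<rho> 0)"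
    by (simp only: jacobi coeff \<tau>1 \<tau>3) (simp add: power_divide)
  show "jacobi_density_coeff \<rho> 6 = - (5/9) * trace (\<rho> 0) ^ 3 + (2/3) * trace (\<rho> 0) * trace (\<rho> 0 ** \<rho> 0)
      - (16/63) * trace (\<rho> 0 ** \<rho> 0 ** \<rho> 0) + trace (\<rho> 1 ** \<rho> 1) / 14"
    by (simp only: jacobi coeff \<tau>1 \<tau>3 \<tau>5) (simp add: power_divide)
  show "jacobi_density_coeff \<rho> 8 = (35/27) * trace (\<rho> 0) ^ 4 - (28/9) * (trace (\<rho> 0))\<^sup>2 * trace (\<rho> 0 ** \<rho> 0)
      + (64/27) * trace (\<rho> 0) * trace (\<rho> 0 ** \<rho> 0 ** \<rho> 0) - (2/3) * trace (\<rho> 0) * trace (\<rho> 1 ** \<rho> 1)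
      + (28/45) * (trace (\<rho> 0 ** \<rho> 0))\<^sup>2 - (16/15) * trace (\<rho> 0 ** \<rho> 0 ** \<rho> 0 ** \<rho> 0)
      - (16/135) * trace (\<rho> 0 ** \<rho> 0 ** \<rho> 2) + (20/27) * trace (\<rho> 0 ** \<rho> 1 ** \<rho> 1) - (2/45) * trace (\<rho> 2 ** \<rho> 2)"
    by (simp only: jacobi coeff \<tau>1 \<tau>3 \<tau>5 \<tau>7) (simp add: power_divide power2_eq_square power4_eq_xxxx algebra_simps)
qed

end

section \<open>The Jacobi operators along a geodesic\<close>

context framed_geodesic
begin

lemma tensor_field_iterated_cov_deriv: "tensor_field (4 + k) ((cov_deriv G ^^ k) (riemann_tensor G))"
proof (induction k)
  case (Suc k)
  from tensor_field_cov_deriv[OF Suc] show ?case by simp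
qed (simp add: tensor_field_riemann)

lemma g_frame_nderiv_R:
  assumes "t \<in> I"
  shows "g (x 0) (E 0 *v (nderiv k R t *v v)) (E 0 *v w)
    = (cov_deriv G ^^ k) (riemann_tensor G) (x t) ([E t *v v, y t, y t, E t *v w] @ replicate k (y t))"
  using assms
proof (induction k arbitrary: t)
  case 0
  then show ?case
    using g_frame[OF 0, of "R t *v v" w] by (simp add: riemann_tensor_eq[OF xU[OF 0]] frame_R[OF 0])
next
  case (Suc k)
  note t = Suc.prems
  let ?T = "(cov_deriv G ^^ k) (riemann_tensor G)" and ?Ws = "[\<lambda>s. E s *v v, y, y, \<lambda>s. E s *v w] @ replicate k y"
  have "(W has_vector_derivative - \<Gamma> (x t) (y t) (W t)) (at t)" if "W \<in> set ?Ws" for W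
    using that parallel_vector[OF t] y'[OF t] by auto
  then have "((\<lambda>s. ?T (x s) (map (\<lambda>W. W s) ?Ws)) has_vector_derivative
      cov_deriv G ?T (x t) (map (\<lambda>W. W t) ?Ws @ [y t])) (at t)"
    by (intro tensor_along_parallel[OF tensor_field_iterated_cov_deriv open_greaterThanLessThan t xU x'[OF t]]) simp_all
  then have along: "((\<lambda>s. g (x 0) (E 0 *v (nderiv k R s *v v)) (E 0 *v w)) has_vector_derivative
      cov_deriv G ?T (x t) (map (\<lambda>W. W t) ?Ws @ [y t])) (at t)"
    by (rule has_vector_derivative_transform_within_open[OF _ open_greaterThanLessThan t]) (simp add: Suc.IH)
  have "linear (\<lambda>A. g (x 0) (E 0 *v (A *v v)) (E 0 *v w))"
    by (simp add: linear_iff ginner_simps matrix_vector_mult_add_rdistrib matrix_vector_right_distrib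
        scaleR_matrix_vector_assoc[symmetric] matrix_vector_mult_scaleR)
  then have "((\<lambda>s. g (x 0) (E 0 *v (nderiv k R s *v v)) (E 0 *v w)) has_vector_derivative
      g (x 0) (E 0 *v (nderiv (Suc k) R t *v v)) (E 0 *v w)) (at t)"
    unfolding linear_conv_bounded_linear
    by (rule bounded_linear.has_vector_derivative[OF _
          has_vector_derivative_nderiv[OF smooth_R open_greaterThanLessThan t]])
  from vector_derivative_unique_at[OF this along] show ?case by (simp add: replicate_append_same)
qed

end

context framed_manifold_geodesic
begin

lemma jacobi_op_eq_nderiv_R:
  assumes E0: "E 0 = mat 1"
  shows "jacobi_op M c base_point k (y 0) = nderiv k R 0"
  unfolding jacobi_op_def base_point(2)
proof (rule the_equality)
  let ?T = "(cov_deriv (gmat M c) ^^ k) (riemann_tensor (gmat M c))"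
  have R_eq: "g (x 0) (nderiv k R 0 *v v) w = ?T (x 0) ([v, y 0, y 0, w] @ replicate k (y 0))" for v w
    using g_frame_nderiv_R[OF zero_in_I, of k v w] by (simp add: E0)
  then show "\<forall>v w. g (x 0) (nderiv k R 0 *v v) w = ?T (x 0) ([v, y 0, y 0, w] @ replicate k (y 0))" by blast
  fix A assume "\<forall>v w. g (x 0) (A *v v) w = ?T (x 0) ([v, y 0, y 0, w] @ replicate k (y 0))"
  then have "A *v v = nderiv k R 0 *v v" for v
    by (intro g_nondegenerate[OF xU[OF zero_in_I]]) (simp add: R_eq)
  then show "A = nderiv k R 0" by (simp add: matrix_eq)
qed

lemma volume_density_nderiv:
  obtains \<epsilon> where "0 < \<epsilon>" "smooth_on {-\<epsilon><..<\<epsilon>} (\<lambda>s. volume_density M c base_point (s *\<^sub>R y 0))"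
    "\<And>k. nderiv k (\<lambda>s. volume_density M c base_point (s *\<^sub>R y 0)) 0 = jacobi_density_coeff (\<lambda>i. nderiv i R 0) k"
proof -
  obtain \<delta> A C where \<delta>: "0 < \<delta>" "\<delta> \<le> d" and A: "\<And>s. s \<in> {-\<delta><..<\<delta>} \<Longrightarrow> A s = s *\<^sub>R dexp s"
    and A': "\<And>s. s \<in> {-\<delta><..<\<delta>} \<Longrightarrow> (A has_vector_derivative C s) (at s)"
    and C': "\<And>s. s \<in> {-\<delta><..<\<delta>} \<Longrightarrow> (C has_vector_derivative - (R s ** A s)) (at s)"
    and start: "A 0 = 0" "C 0 = mat 1"
    by (rule dexp_jacobi_equation) blast
  have "{-\<delta><..<\<delta>} \<subseteq> I" using \<delta>(2) by auto
  then have R: "smooth_on {-\<delta><..<\<delta>} R"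
    by (rule smooth_on_subset[OF smooth_R open_greaterThanLessThan open_greaterThanLessThan])
  obtain \<epsilon> where \<epsilon>: "0 < \<epsilon>" "\<epsilon> \<le> \<delta>" and smooth: "smooth_on {-\<epsilon><..<\<epsilon>} (\<lambda>s. \<bar>det (dexp s)\<bar>)"
    and coeff: "\<And>k. nderiv k (\<lambda>s. \<bar>det (dexp s)\<bar>) 0 = jacobi_density_coeff (\<lambda>i. nderiv i R 0) k"
    by (rule nderiv_abs_det_jacobi_equation_divided[OF \<delta>(1) R A' C' start A dexp_0]) blast+
  have density: "volume_density M c base_point (s *\<^sub>R y 0) = \<bar>det (dexp s)\<bar>" if "s \<in> {-\<epsilon><..<\<epsilon>}" for s
    using that \<epsilon>(2) \<delta>(2) by (intro volume_density_eq_det_dexp) auto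
  show thesis
    using nderiv_cong[OF open_greaterThanLessThan density, where t = 0] \<epsilon>(1) coeff
    by (intro that[OF \<epsilon>(1) smooth_on_cong[OF smooth open_greaterThanLessThan density[symmetric]]]) simp_all
qed

end

section \<open>Harmonic spaces\<close>

lemma (in riemannian_chart) harmonic_volume_density_even:
  assumes harmonic: "harmonic_space M" and P: "P \<in> cdom c"
  obtains \<epsilon> where "\<epsilon> > 0"
    "\<And>s. s \<in> {-\<epsilon><..<\<epsilon>} \<Longrightarrow> volume_density M c P ((- s) *\<^sub>R \<xi>) = volume_density M c P (s *\<^sub>R \<xi>)"
proof -
  have "P \<in> topspace (mtop M)" "c \<in> charts_at M P"
    using P cdom_subset in_atlas by (auto simp: charts_at_def)
  then obtain \<delta> f where \<delta>: "\<delta> > 0"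
    and f: "\<And>\<eta>. gnorm M c P \<eta> < \<delta> \<Longrightarrow> volume_density M c P \<eta> = f (gnorm M c P \<eta>)"
    using harmonic unfolding harmonic_space_def by blast
  define n where "n = gnorm M c P \<xi> + 1"
  have "g (cmap c P) \<xi> \<xi> \<ge> 0"
    using posG[of "cmap c P" \<xi>] P by (cases "\<xi> = 0") (auto simp: ginner_simps intro: less_imp_le)
  then have n: "n > 0" "gnorm M c P \<xi> \<le> n" by (simp_all add: n_def gnorm_def add_nonneg_pos)
  have gnorm_scale: "gnorm M c P (s *\<^sub>R \<xi>) = \<bar>s\<bar> * gnorm M c P \<xi>" for s
    by (simp add: gnorm_def ginner_simps real_sqrt_mult mult.assoc[symmetric])
  show thesis
  proof (rule that[of "\<delta> / n"])
    fix s assume s: "s \<in> {-(\<delta> / n)<..<\<delta> / n}"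
    have "\<bar>s\<bar> * gnorm M c P \<xi> \<le> \<bar>s\<bar> * n" using n by (intro mult_left_mono) auto
    also have "\<dots> < \<delta>" using s n(1) by (cases "s \<ge> 0") (auto simp: field_simps)
    finally show "volume_density M c P ((- s) *\<^sub>R \<xi>) = volume_density M c P (s *\<^sub>R \<xi>)"
      using f[of "s *\<^sub>R \<xi>"] f[of "(- s) *\<^sub>R \<xi>"] by (simp only: gnorm_scale abs_minus_cancel)
  qed (use \<delta> n in simp)
qed

context framed_manifold_geodesic
begin

lemma harmonic_odd_jacobi_density_coeff:
  assumes "harmonic_space M" "odd k"
  shows "jacobi_density_coeff (\<lambda>i. nderiv i R 0) k = 0"
proof -
  let ?\<phi> = "\<lambda>s. volume_density M c base_point (s *\<^sub>R y 0)"
  obtain \<epsilon> where \<epsilon>: "0 < \<epsilon>" "smooth_on {-\<epsilon><..<\<epsilon>} ?\<phi>"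
    and coeff: "nderiv k ?\<phi> 0 = jacobi_density_coeff (\<lambda>i. nderiv i R 0) k"
    using volume_density_nderiv by metis
  obtain \<delta> where \<delta>: "\<delta> > 0" and even: "\<And>s. s \<in> {-\<delta><..<\<delta>} \<Longrightarrow> ?\<phi> (- s) = ?\<phi> s"
    by (rule harmonic_volume_density_even[OF assms(1) base_point(1)]) blast
  have "nderiv k ?\<phi> 0 = 0"
  proof (rule nderiv_odd_even_function[where I = "{-\<epsilon><..<\<epsilon>} \<inter> {-\<delta><..<\<delta>}"])
    show "smooth_on ({-\<epsilon><..<\<epsilon>} \<inter> {-\<delta><..<\<delta>}) ?\<phi>"
      by (rule smooth_on_subset[OF \<epsilon>(2)]) (auto intro: open_Int)
  qed (use \<epsilon>(1) \<delta> even assms(2) in \<open>auto intro: open_Int\<close>)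
  with coeff show ?thesis by simp
qed

lemma framed_manifold_geodesic_shift:
  assumes "t0 \<in> I"
  shows "framed_manifold_geodesic M c (d - \<bar>t0\<bar>) (\<lambda>s. x (t0 + s)) (\<lambda>s. y (t0 + s)) (\<lambda>s. E (t0 + s))"
  by (intro framed_manifold_geodesic.intro frame_shift assms riemannian_chart_axioms)

lemma harmonic_odd_free_jacobi_density:
  assumes "harmonic_space M"
  shows "odd_free_jacobi_density I R"
proof unfold_locales
  fix t k assume t: "t \<in> I" and "odd (k :: nat)"
  interpret shifted: framed_manifold_geodesic M c "d - \<bar>t\<bar>" "\<lambda>s. x (t + s)" "\<lambda>s. y (t + s)" "\<lambda>s. E (t + s)"
    by (rule framed_manifold_geodesic_shift[OF t])
  have "shifted.R = (\<lambda>s. R (t + s))"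
    by (simp add: fun_eq_iff shifted.R_def R_def shifted.F_def F_def)
  then show "jacobi_density_coeff (\<lambda>i. nderiv i R t) k = 0"
    using shifted.harmonic_odd_jacobi_density_coeff[OF assms \<open>odd k\<close>] by (simp add: nderiv_shift)
qed (simp_all add: smooth_R)

lemma taylor_H_eq_jacobi_density_coeff:
  "taylor_H M c base_point k (y 0) = jacobi_density_coeff (\<lambda>i. nderiv i R 0) k / fact k"
  using volume_density_nderiv by (metis taylor_H_def taylor_term_eq_nderiv)

end

lemma framed_manifold_geodesic_exists:
  fixes M :: "('a, 'n::finite, 'z) manifold_scheme"
  assumes "riemannian_manifold M" "c \<in> atlas M" "P \<in> cdom c"
  obtains d x y E where "framed_manifold_geodesic M c d x y E" "framed_manifold_geodesic.base_point c x = P"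
    "y 0 = \<xi>" "E 0 = mat 1"
proof -
  interpret riemannian_chart M c by unfold_locales (rule assms)+
  obtain d x y E where geodesic: "framed_geodesic (cmap c ` cdom c) (gmat M c) d x y E"
    and start: "x 0 = cmap c P" "y 0 = \<xi>" "E 0 = mat 1"
    by (rule framed_geodesic_exists[OF chart_metric_axioms imageI[OF assms(3)]])
  then interpret framed_manifold_geodesic M c d x y E by (intro framed_manifold_geodesic.intro riemannian_chart_axioms)
  show thesis
    by (rule that[OF framed_manifold_geodesic_axioms _ start(2,3)])
       (simp add: base_point_def start(1) cinv_cmap assms(3))
qed

theorem theorem1p4:
  fixes M :: "('a, 'n::finite) manifold" and P :: 'a and c :: "('a, 'n) chart"
    and \<xi> :: "real ^ 'n"
    and H :: "nat \<Rightarrow> real" and J J1 J2 :: "real ^ 'n ^ 'n"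
  assumes "harmonic_space M"
    and "P \<in> topspace (mtop M)"
    and "c \<in> charts_at M P"
  defines "H \<equiv> \<lambda>k. taylor_H M c P k \<xi>"
    and "J \<equiv> jacobi_op M c P 0 \<xi>"
    and "J1 \<equiv> jacobi_op M c P 1 \<xi>"
    and "J2 \<equiv> jacobi_op M c P 2 \<xi>"
  shows "(\<forall>k\<ge>1. H (2 * k + 1) = 0) \<and>
    H 2 = - (1/6) * trace J \<and>
    H 4 = (1/72) * (trace J)\<^sup>2 - (1/180) * trace (J ** J) \<and>
    H 6 = - ((trace J) ^ 3 / 1296) + trace J * trace (J ** J) / 1080
          - trace (J ** J ** J) / 2835 + trace (J1 ** J1) / 10080 \<and>
    H 8 = (trace J) ^ 4 / 31104 - (trace J)\<^sup>2 * trace (J ** J) / 12960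
          + trace J * trace (J ** J ** J) / 17010 - trace J * trace (J1 ** J1) / 60480
          + (trace (J ** J))\<^sup>2 / 64800 - trace (J ** J ** J ** J) / 37800
          - trace (J ** J ** J2) / 340200 + trace (J ** J1 ** J1) / 54432
          - trace (J2 ** J2) / 907200"
proof -
  have "riemannian_manifold M" "c \<in> atlas M" "P \<in> cdom c"
    using assms(1,3) by (simp_all add: harmonic_space_def charts_at_def)
  then obtain d x y E where "framed_manifold_geodesic M c d x y E"
    and P: "framed_manifold_geodesic.base_point c x = P" and start: "y 0 = \<xi>" "E 0 = mat 1"
    by (rule framed_manifold_geodesic_exists[where \<xi> = \<xi>])
  then interpret framed_manifold_geodesic M c d x y E by blast
  interpret odd_free_jacobi_density I R by (rule harmonic_odd_free_jacobi_density[OF assms(1)])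
  have H: "H k = jacobi_density_coeff (\<lambda>i. nderiv i R 0) k / fact k" for k
    using taylor_H_eq_jacobi_density_coeff[of k] by (simp add: H_def P start(1))
  have J: "J = nderiv 0 R 0" "J1 = nderiv 1 R 0" "J2 = nderiv 2 R 0"
    using jacobi_op_eq_nderiv_R[OF start(2)] by (simp_all only: J_def J1_def J2_def P start(1))
  show ?thesis
  proof (intro conjI allI impI)
    show "H (2 * k + 1) = 0" for k by (simp add: H odd_free[OF zero_in_I])
  qed (simp_all only: H J jacobi_density_coeff_values[OF zero_in_I],
      simp_all add: fact_numeral field_simps)
qed

end
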